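(* In the setting described in the context, let additionally $k_0\in L^\infty(\Omega)$ (with $k_0\in V_c(\Omega)$) and $c\in L^\infty(\Omega\times[0,T])$. Then the weak solution $k$ of the capital accumulation equation (with $k(\cdot,0)=k_0$ in $\Omega$, $k=0$ on $\Omega_{\mathcal{I}}\times(0,T)$) belongs to $\mathcal{C}(0,T;V_c(\Omega\cup\Omega_{\mathcal{I}}))\cap H^1(0,T;L^\infty(\Omega))$, where this intersection denotes the Banach space \[\mathcal{V}^\infty:=\{u\in\mathcal{C}([0,T];V_c(\Omega\cup\Omega_{\mathcal{I}})):\ \operatorname{ess\,sup}_{(x,t)\in\Omega\times(0,T)}|u(x,t)|<\infty\}\] with norm $\|u\|_{\mathcal{V}^\infty}:=\|u\|_{\mathcal{C}([0,T];V_c(\Omega\cup\Omega_{\mathcal{I}}))}+\|u\|_{L^\infty(\Omega\times(0,T))}$.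
   Context: Setting: $\Omega\subset\mathbb{R}^n$ open bounded Lipschitz domain with piecewise smooth boundary satisfying the cone condition; $T>0$, $\varepsilon,\sigma>0$, $0<\mu<\varepsilon$, $\xi>0$, $\delta>0$. $\Omega_{\mathcal{I}}:=\{y\in\mathbb{R}^n\setminus\Omega:\|y-x\|_2<\varepsilon\text{ for some }x\in\Omega\}$. For $\nu>0$, $\Gamma_\nu(x,y):=(2\pi\sigma^2)^{-n/2}\exp(-\|x-y\|_2^2/(2\sigma^2))\mathds{1}_{B_\nu(x)}(y)$ with $B_\nu(x)$ the closed ball. $\alpha_\varepsilon(x,y):=\operatorname{sign}(\|x\|_2-\|y\|_2)\Gamma_\varepsilon(x,y)^{1/2}$, $\mathcal{D}^*(u)(x,y):=-(u(y)-u(x))\alpha_\varepsilon(x,y)$, $|||u|||:=(\frac12\int\int_{(\Omega\cup\Omega_{\mathcal{I}})^2}\mathcal{D}^*(u)^2)^{1/2}$, $V_c:=V_c(\Omega\cup\Omega_{\mathcal{I}}):=\{u\in L^2(\Omega\cup\Omega_{\mathcal{I}}):|||u|||<\infty,\ u=0\text{ a.e. on }\Omega_{\mathcal{I}}\}$ with norm $|||\cdot|||$, $V_c'$ its dual w.r.t. the $L^2$ pairing; $V_c(\Omega)$: functions on $\Omega$ whose zero extension lies in $V_c$. ${\bf a}(u,v):=\frac12\int\int_{(\Omega\cup\Omega_{\mathcal{I}})^2}\mathcal{D}^*(u)\mathcal{D}^*(v)\,dy\,dx+\delta\int_\Omega uv\,dx$. $\Phi_\nu(k)(x,t):=\int_{\Omega\cup\Omega_{\mathcal{I}}}\phi(k(y,t))\Gamma_\nu(x,y)dy$,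 $\mathcal{P}(k)(x,t):=A_0(x)\exp\big(t\,\Phi_\mu(k)(x,t)/(\Phi_\varepsilon(k)(x,t)+\xi)\big)p(k(x,t))$, where $p:\mathbb{R}\to\mathbb{R}_+$ is bounded by $M_p>0$, $p(0)=0$, Lipschitz; $\phi:\mathbb{R}\to\mathbb{R}_+$ Lipschitz; $A_0\ge0$, $A_0\in L^\infty(\Omega)$. The weak solution is the unique $k\in C(0,T;V_c)\cap H^1(0,T;V_c)$, $H^1(0,T;V_c):=\{u\in L^2(0,T;V_c):u_t\in L^2(0,T;V_c')\}$, with the prescribed initial and volume constraint values, such that $\int_0^T\int_\Omega k_t\varphi+\int_0^T{\bf a}(k,\varphi)dt=\int_0^T\int_\Omega(\mathcal{P}(k)-c)\varphi$ for all $\varphi\in C(0,T;V_c)$ (it corresponds to $\partial_t k-\mathcal{NL}_\varepsilon(k)+\delta k=\mathcal{P}(k)-c$ on $\Omega\times(0,T)$ with $\mathcal{NL}_\varepsilon(u)(x)=\int(u(y)-u(x))\Gamma_\varepsilon(x,y)dy$). *)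

theory Defs
  imports "HOL-Analysis.Analysis"
begin

fun dderiv :: "'a::euclidean_space list \<Rightarrow> ('a \<Rightarrow> real) \<Rightarrow> 'a \<Rightarrow> real" where
  "dderiv [] f = f"
| "dderiv (v # vs) f = (\<lambda>x. frechet_derivative (dderiv vs f) (at x) v)"

definition smooth_on :: "'a::euclidean_space set \<Rightarrow> ('a \<Rightarrow> real) \<Rightarrow> bool" where
  "smooth_on U f \<longleftrightarrow> (\<forall>vs. \<forall>x\<in>U. dderiv vs f differentiable (at x))"

definition lipschitz_domain :: "'a::euclidean_space set \<Rightarrow> bool" where
  "lipschitz_domain \<Omega> \<longleftrightarrow>
     (\<forall>x0\<in>frontier \<Omega>. \<exists>r>0. \<exists>e g L. norm e = 1 \<and>
        L-lipschitz_on {z. z \<bullet> e = 0} g \<and>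
        (\<forall>y\<in>ball x0 r. y \<in> \<Omega> \<longleftrightarrow> y \<bullet> e < g (y - (y \<bullet> e) *\<^sub>R e)))"

definition piecewise_smooth_boundary :: "'a::euclidean_space set \<Rightarrow> bool" where
  "piecewise_smooth_boundary \<Omega> \<longleftrightarrow>
     (\<exists>F. finite F \<and> frontier \<Omega> = \<Union>(closure ` F) \<and>
        (\<forall>S\<in>F. \<exists>U h. open U \<and> smooth_on U h \<and>
            (\<forall>x\<in>U. frechet_derivative h (at x) \<noteq> (\<lambda>_. 0)) \<and> S = {x\<in>U. h x = 0}))"

definition cone_condition :: "'a::euclidean_space set \<Rightarrow> bool" where
  "cone_condition \<Omega> \<longleftrightarrow>
     (\<exists>r>0. \<exists>a. 0 < a \<and> a < 1 \<and>
        (\<forall>x\<in>\<Omega>. \<exists>v. norm v = 1 \<and>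
           (\<forall>y. norm y < r \<and> y \<bullet> v > a * norm y \<longrightarrow> x + y \<in> \<Omega>)))"

definition OmegaI :: "'a::euclidean_space set \<Rightarrow> real \<Rightarrow> 'a set" where
  "OmegaI \<Omega> \<epsilon> = {y. y \<notin> \<Omega> \<and> (\<exists>x\<in>\<Omega>. norm (y - x) < \<epsilon>)}"

definition Gam :: "real \<Rightarrow> real \<Rightarrow> 'a::euclidean_space \<Rightarrow> 'a \<Rightarrow> real" where
  "Gam \<sigma> \<nu> x y = (2 * pi * \<sigma>\<^sup>2) powr (- real DIM('a) / 2)
       * exp (- (norm (x - y))\<^sup>2 / (2 * \<sigma>\<^sup>2)) * indicator (cball x \<nu>) y"

definition alph :: "real \<Rightarrow> real \<Rightarrow> 'a::euclidean_space \<Rightarrow> 'a \<Rightarrow> real" where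
  "alph \<sigma> \<epsilon> x y = sgn (norm x - norm y) * sqrt (Gam \<sigma> \<epsilon> x y)"

definition Dstar :: "real \<Rightarrow> real \<Rightarrow> ('a::euclidean_space \<Rightarrow> real) \<Rightarrow> 'a \<Rightarrow> 'a \<Rightarrow> real" where
  "Dstar \<sigma> \<epsilon> u x y = - (u y - u x) * alph \<sigma> \<epsilon> x y"

definition tnorm_sq :: "'a::euclidean_space set \<Rightarrow> real \<Rightarrow> real \<Rightarrow> ('a \<Rightarrow> real) \<Rightarrow> ennreal" where
  "tnorm_sq \<Omega> \<epsilon> \<sigma> u =
     (\<integral>\<^sup>+ z. indicator ((\<Omega> \<union> OmegaI \<Omega> \<epsilon>) \<times> (\<Omega> \<union> OmegaI \<Omega> \<epsilon>)) z
              * ennreal ((Dstar \<sigma> \<epsilon> u (fst z) (snd z))\<^sup>2) \<partial>(lborel \<Otimes>\<^sub>M lborel))"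

definition tnorm :: "'a::euclidean_space set \<Rightarrow> real \<Rightarrow> real \<Rightarrow> ('a \<Rightarrow> real) \<Rightarrow> real" where
  "tnorm \<Omega> \<epsilon> \<sigma> u = sqrt (1/2 * enn2real (tnorm_sq \<Omega> \<epsilon> \<sigma> u))"

text \<open>The energy space V_c(Omega u Omega_I) (functions represented by Borel representatives).\<close>
definition Vc :: "'a::euclidean_space set \<Rightarrow> real \<Rightarrow> real \<Rightarrow> ('a \<Rightarrow> real) set" where
  "Vc \<Omega> \<epsilon> \<sigma> = {u. (\<lambda>x. indicator (\<Omega> \<union> OmegaI \<Omega> \<epsilon>) x * u x) \<in> borel_measurable lborel
      \<and> (\<integral>\<^sup>+ x. indicator (\<Omega> \<union> OmegaI \<Omega> \<epsilon>) x * ennreal ((u x)\<^sup>2) \<partial>lborel) < \<infinity>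
      \<and> tnorm_sq \<Omega> \<epsilon> \<sigma> u < \<infinity>
      \<and> (AE x in lborel. x \<in> OmegaI \<Omega> \<epsilon> \<longrightarrow> u x = 0)}"

definition abil :: "'a::euclidean_space set \<Rightarrow> real \<Rightarrow> real \<Rightarrow> real \<Rightarrow> ('a \<Rightarrow> real) \<Rightarrow> ('a \<Rightarrow> real) \<Rightarrow> real" where
  "abil \<Omega> \<epsilon> \<sigma> \<delta> u v =
     1/2 * (\<integral> z. indicator ((\<Omega> \<union> OmegaI \<Omega> \<epsilon>) \<times> (\<Omega> \<union> OmegaI \<Omega> \<epsilon>)) z
              * (Dstar \<sigma> \<epsilon> u (fst z) (snd z) * Dstar \<sigma> \<epsilon> v (fst z) (snd z)) \<partial>(lborel \<Otimes>\<^sub>M lborel))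
     + \<delta> * (\<integral> x. indicator \<Omega> x * (u x * v x) \<partial>lborel)"

definition Phi :: "'a::euclidean_space set \<Rightarrow> real \<Rightarrow> real \<Rightarrow> (real \<Rightarrow> real) \<Rightarrow> real
                   \<Rightarrow> (real \<Rightarrow> 'a \<Rightarrow> real) \<Rightarrow> 'a \<Rightarrow> real \<Rightarrow> real" where
  "Phi \<Omega> \<epsilon> \<sigma> \<phi> \<nu> k x t =
     (\<integral> y. indicator (\<Omega> \<union> OmegaI \<Omega> \<epsilon>) y * (\<phi> (k t y) * Gam \<sigma> \<nu> x y) \<partial>lborel)"

definition Pop :: "'a::euclidean_space set \<Rightarrow> real \<Rightarrow> real \<Rightarrow> real \<Rightarrow> real \<Rightarrow> ('a \<Rightarrow> real)
                   \<Rightarrow> (real \<Rightarrow> real) \<Rightarrow> (real \<Rightarrow> real) \<Rightarrow> (real \<Rightarrow> 'a \<Rightarrow> real) \<Rightarrow> 'a \<Rightarrow> real \<Rightarrow> real" where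
  "Pop \<Omega> \<epsilon> \<sigma> \<mu> \<xi> A0 p \<phi> k x t =
     A0 x * exp (t * Phi \<Omega> \<epsilon> \<sigma> \<phi> \<mu> k x t / (Phi \<Omega> \<epsilon> \<sigma> \<phi> \<epsilon> k x t + \<xi>)) * p (k t x)"

definition CVc :: "'a::euclidean_space set \<Rightarrow> real \<Rightarrow> real \<Rightarrow> real \<Rightarrow> (real \<Rightarrow> 'a \<Rightarrow> real) \<Rightarrow> bool" where
  "CVc \<Omega> \<epsilon> \<sigma> T u \<longleftrightarrow> (\<forall>t\<in>{0..T}. u t \<in> Vc \<Omega> \<epsilon> \<sigma>) \<and>
     (\<forall>t\<in>{0..T}. ((\<lambda>s. tnorm \<Omega> \<epsilon> \<sigma> (\<lambda>x. u s x - u t x)) \<longlongrightarrow> 0) (at t within {0..T}))"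

text \<open>Joint measurability of (x,t) |-> u t x (choice of representative).\<close>
definition jointly_measurable :: "(real \<Rightarrow> 'a::euclidean_space \<Rightarrow> real) \<Rightarrow> bool" where
  "jointly_measurable u \<longleftrightarrow> (\<lambda>z. u (snd z) (fst z)) \<in> borel_measurable (lborel \<Otimes>\<^sub>M lborel)"

definition test_fun :: "real \<Rightarrow> (real \<Rightarrow> real) \<Rightarrow> bool" where
  "test_fun T \<psi> \<longleftrightarrow> (\<forall>n. \<forall>t. ((deriv ^^ n) \<psi>) differentiable (at t)) \<and>
     (\<exists>a b. 0 < a \<and> b < T \<and> (\<forall>t. t \<notin> {a..b} \<longrightarrow> \<psi> t = 0))"

text \<open>kt is the weak time derivative of k, belonging to L^2(0,T; V_c'), where V_c' is the
  dual of V_c w.r.t. the L^2(Omega) pairing.\<close>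
definition weak_deriv_Vc' :: "'a::euclidean_space set \<Rightarrow> real \<Rightarrow> real \<Rightarrow> real
      \<Rightarrow> (real \<Rightarrow> 'a \<Rightarrow> real) \<Rightarrow> (real \<Rightarrow> ('a \<Rightarrow> real) \<Rightarrow> real) \<Rightarrow> bool" where
  "weak_deriv_Vc' \<Omega> \<epsilon> \<sigma> T k kt \<longleftrightarrow>
     (\<forall>v\<in>Vc \<Omega> \<epsilon> \<sigma>. (\<lambda>t. indicator {0<..<T} t * kt t v) \<in> borel_measurable lborel) \<and>
     (\<exists>g. g \<in> borel_measurable lborel \<and>
          (\<integral>\<^sup>+ t. indicator {0<..<T} t * ennreal ((g t)\<^sup>2) \<partial>lborel) < \<infinity> \<and>
          (AE t in lborel. t \<in> {0<..<T} \<longrightarrow>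
              (\<forall>u\<in>Vc \<Omega> \<epsilon> \<sigma>. \<forall>v\<in>Vc \<Omega> \<epsilon> \<sigma>. \<forall>a b.
                  kt t (\<lambda>x. a * u x + b * v x) = a * kt t u + b * kt t v) \<and>
              (\<forall>v\<in>Vc \<Omega> \<epsilon> \<sigma>. \<bar>kt t v\<bar> \<le> g t * tnorm \<Omega> \<epsilon> \<sigma> v))) \<and>
     (\<forall>v\<in>Vc \<Omega> \<epsilon> \<sigma>. \<forall>\<psi>. test_fun T \<psi> \<longrightarrow>
        (\<integral> t. indicator {0<..<T} t * (kt t v * \<psi> t) \<partial>lborel)
        = - (\<integral> t. indicator {0<..<T} t *
                ((\<integral> x. indicator \<Omega> x * (k t x * v x) \<partial>lborel) * deriv \<psi> t) \<partial>lborel))"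

definition weak_solution :: "'a::euclidean_space set \<Rightarrow> real \<Rightarrow> real \<Rightarrow> real \<Rightarrow> real \<Rightarrow> real \<Rightarrow> real
      \<Rightarrow> ('a \<Rightarrow> real) \<Rightarrow> (real \<Rightarrow> real) \<Rightarrow> (real \<Rightarrow> real) \<Rightarrow> ('a \<Rightarrow> real \<Rightarrow> real) \<Rightarrow> ('a \<Rightarrow> real)
      \<Rightarrow> (real \<Rightarrow> 'a \<Rightarrow> real) \<Rightarrow> bool" where
  "weak_solution \<Omega> \<epsilon> \<sigma> \<mu> \<xi> \<delta> T A0 p \<phi> c k0 k \<longleftrightarrow>
     CVc \<Omega> \<epsilon> \<sigma> T k \<and> jointly_measurable k \<and>
     (AE x in lborel. x \<in> \<Omega> \<longrightarrow> k 0 x = k0 x) \<and>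
     (\<exists>kt. weak_deriv_Vc' \<Omega> \<epsilon> \<sigma> T k kt \<and>
        (\<forall>w. CVc \<Omega> \<epsilon> \<sigma> T w \<and> jointly_measurable w \<longrightarrow>
           (\<integral> t. indicator {0..T} t * kt t (w t) \<partial>lborel)
           + (\<integral> t. indicator {0..T} t * abil \<Omega> \<epsilon> \<sigma> \<delta> (k t) (w t) \<partial>lborel)
           = (\<integral> t. indicator {0..T} t *
                (\<integral> x. indicator \<Omega> x * ((Pop \<Omega> \<epsilon> \<sigma> \<mu> \<xi> A0 p \<phi> k x t - c x t) * w t x) \<partial>lborel)
              \<partial>lborel)))"

definition Vinf :: "'a::euclidean_space set \<Rightarrow> real \<Rightarrow> real \<Rightarrow> real \<Rightarrow> (real \<Rightarrow> 'a \<Rightarrow> real) set" where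
  "Vinf \<Omega> \<epsilon> \<sigma> T = {u. CVc \<Omega> \<epsilon> \<sigma> T u \<and>
      (\<exists>M. AE z in lborel \<Otimes>\<^sub>M lborel. z \<in> \<Omega> \<times> {0<..<T} \<longrightarrow> \<bar>u (snd z) (fst z)\<bar> \<le> M)}"

end

theory Submission
  imports Defs "HOL-Computational_Algebra.Polynomial"
begin

text \<open>The kernel is bounded, so the nonlocal operator is a bounded zeroth-order operator and the equation is an ordinary
  differential equation in time, pointwise in space. Testing with \<open>\<psi>(t) 1_E(x)\<close> gives, for all Borel \<open>E \<subseteq> \<Omega>\<close>, an
  integrated equation on \<open>[0, t]\<close>; the initial value enters through a nonlocal Poincare inequality, which turns
  continuity in the energy norm into continuity in \<open>L\<^sup>2\<close>. Since \<open>E\<close> is arbitrary, for almost every \<open>x\<close> one has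
  \<open>k(t,x) = k(0,x) + \<integral>\<^sub>0\<^sup>t (F - N)\<close>, where \<open>F = P(k) - c\<close> is essentially bounded and \<open>|N| \<le> A |k| + B\<close> because
  \<open>\<integral> |k(t,y)| dy\<close> is bounded in \<open>t\<close>. Gronwall's lemma bounds \<open>k\<close>.\<close>

section \<open>Smooth test functions and weak derivatives in time\<close>

definition flat :: "real poly \<Rightarrow> real \<Rightarrow> real" where
  "flat P x = (if x > 0 then poly P (1 / x) * exp (- (1 / x)) else 0)"

definition flat_step :: "real poly \<Rightarrow> real poly" where
  "flat_step P = [:0, 0, 1:] * (P - pderiv P)"

lemma poly_times_exp_minus_tendsto_0:
  "((\<lambda>y. poly P y * exp (- y)) \<longlongrightarrow> (0::real)) at_top"
proof -
  have "((\<lambda>y. \<Sum>i\<le>degree P. coeff P i * (y ^ i / exp y)) \<longlongrightarrow> (\<Sum>i\<le>degree P. coeff P i * 0)) at_top"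
    by (intro tendsto_intros tendsto_power_div_exp_0)
  moreover have "(\<Sum>i\<le>degree P. coeff P i * (y ^ i / exp y)) = poly P y * exp (- y)" for y
    by (simp add: poly_altdef sum_distrib_right exp_minus divide_inverse mult.assoc)
  ultimately show ?thesis by simp
qed

lemma has_real_derivative_transfer_eventually:
  assumes "(f has_real_derivative D) (at x)" "\<forall>\<^sub>F y in nhds x. f y = g y"
  shows "(g has_real_derivative D) (at x)"
  using assms DERIV_cong_ev[of x x f g D D] by simp

lemma flat_has_derivative: "(flat P has_real_derivative flat (flat_step P) x) (at x)"
proof -
  consider "x > 0" | "x < 0" | "x = 0" by linarith
  then show ?thesis
  proof cases
    case 1
    have "((\<lambda>x. poly P (1 / x) * exp (- (1 / x))) has_real_derivative flat (flat_step P) x) (at x)"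
    proof -
      have inv: "((\<lambda>x. 1 / x) has_real_derivative - (1 / x\<^sup>2)) (at x)"
        using 1 by (auto intro!: derivative_eq_intros simp: power2_eq_square)
      have "((\<lambda>x. poly P (1 / x)) has_real_derivative poly (pderiv P) (1 / x) * - (1 / x\<^sup>2)) (at x)"
        by (rule DERIV_chain2[OF poly_DERIV inv])
      moreover have "((\<lambda>x. exp (- (1 / x))) has_real_derivative exp (- (1 / x)) * (1 / x\<^sup>2)) (at x)"
        using DERIV_chain2[OF DERIV_exp DERIV_minus[OF inv]] by simp
      ultimately have "((\<lambda>x. poly P (1 / x) * exp (- (1 / x))) has_real_derivative
          poly (pderiv P) (1 / x) * - (1 / x\<^sup>2) * exp (- (1 / x))
          + exp (- (1 / x)) * (1 / x\<^sup>2) * poly P (1 / x)) (at x)"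
        by (rule DERIV_mult)
      then show ?thesis
        using 1 by (simp add: flat_def flat_step_def power2_eq_square algebra_simps)
    qed
    moreover have "\<forall>\<^sub>F y in nhds x. y \<in> {0<..}"
      using 1 by (intro eventually_nhds_in_open) auto
    then have "\<forall>\<^sub>F y in nhds x. poly P (1 / y) * exp (- (1 / y)) = flat P y"
      by eventually_elim (simp add: flat_def)
    ultimately show ?thesis
      by (rule has_real_derivative_transfer_eventually)
  next
    case 2
    have "\<forall>\<^sub>F y in nhds x. y \<in> {..<0}"
      using 2 by (intro eventually_nhds_in_open) auto
    then have "\<forall>\<^sub>F y in nhds x. 0 = flat P y"
      by eventually_elim (simp add: flat_def)
    moreover have "((\<lambda>_. 0) has_real_derivative flat (flat_step P) x) (at x)"
      using 2 by (simp add: flat_def)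
    ultimately show ?thesis
      by (rule has_real_derivative_transfer_eventually[rotated])
  next
    case 3
    have "((\<lambda>h. poly ([:0, 1:] * P) (inverse h) * exp (- inverse h)) \<longlongrightarrow> 0) (at_right 0)"
      by (rule filterlim_compose[OF poly_times_exp_minus_tendsto_0 filterlim_inverse_at_top_right])
    moreover have "\<forall>\<^sub>F h in at_right (0::real). h \<in> {0<..<1}"
      by (rule eventually_at_right_real) simp
    then have "\<forall>\<^sub>F h in at_right 0. poly ([:0, 1:] * P) (inverse h) * exp (- inverse h) = flat P h / h"
      by eventually_elim (simp add: flat_def field_simps)
    ultimately have "((\<lambda>h. flat P h / h) \<longlongrightarrow> 0) (at_right 0)"
      by (simp cong: filterlim_cong)
    moreover have "\<forall>\<^sub>F h in at_left (0::real). h \<in> {-1<..<0}"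
      by (rule eventually_at_left_real) simp
    then have "\<forall>\<^sub>F h in at_left 0. 0 = flat P h / h"
      by eventually_elim (simp add: flat_def)
    then have "((\<lambda>h. flat P h / h) \<longlongrightarrow> 0) (at_left 0)"
      by (rule Lim_transform_eventually[OF tendsto_const])
    ultimately have "((\<lambda>h. flat P h / h) \<longlongrightarrow> 0) (at 0)"
      by (simp add: filterlim_split_at)
    then show ?thesis
      using 3 by (simp add: DERIV_def flat_def)
  qed
qed

definition infinitely_differentiable :: "(real \<Rightarrow> real) \<Rightarrow> bool" where
  "infinitely_differentiable f \<longleftrightarrow> (\<forall>n t. ((deriv ^^ n) f) differentiable (at t))"

lemma infinitely_differentiable_coinduct:
  assumes "f \<in> S" and step: "\<And>f. f \<in> S \<Longrightarrow> \<exists>f'\<in>S. \<forall>x. (f has_real_derivative f' x) (at x)"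
  shows "infinitely_differentiable f"
proof -
  have "(deriv ^^ n) f \<in> S" for n
  proof (induction n)
    case (Suc n)
    obtain f' where f': "f' \<in> S" "\<And>x. ((deriv ^^ n) f has_real_derivative f' x) (at x)"
      using step[OF Suc] by blast
    have "deriv ((deriv ^^ n) f) = f'"
      using f'(2) by (intro ext DERIV_imp_deriv)
    with f'(1) show ?case by simp
  qed (simp add: assms)
  then show ?thesis
    unfolding infinitely_differentiable_def
    by (meson step real_differentiable_def)
qed

inductive_set flat_products :: "(real \<Rightarrow> real) set" where
  prod: "(\<lambda>x. a * (flat P (m * (x - s)) * flat Q (1 - m * (x - s)))) \<in> flat_products"
| add: "f \<in> flat_products \<Longrightarrow> g \<in> flat_products \<Longrightarrow> (\<lambda>x. f x + g x) \<in> flat_products"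

lemma flat_products_derivative:
  assumes "f \<in> flat_products"
  shows "\<exists>f'\<in>flat_products. \<forall>x. (f has_real_derivative f' x) (at x)"
  using assms
proof induction
  case (prod a P m s Q)
  let ?f' = "\<lambda>x. (a * m) * (flat (flat_step P) (m * (x - s)) * flat Q (1 - m * (x - s)))
    + (- a * m) * (flat P (m * (x - s)) * flat (flat_step Q) (1 - m * (x - s)))"
  have "?f' \<in> flat_products"
    by (intro flat_products.intros)
  moreover have "((\<lambda>x. a * (flat P (m * (x - s)) * flat Q (1 - m * (x - s)))) has_real_derivative ?f' x) (at x)" for x
    by (auto intro!: derivative_eq_intros DERIV_chain2[OF flat_has_derivative] simp: algebra_simps)
  ultimately show ?case by (intro bexI[of _ ?f'] allI)
next
  case (add f g)
  then obtain f' g' where "f' \<in> flat_products" "\<forall>x. (f has_real_derivative f' x) (at x)"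
    "g' \<in> flat_products" "\<forall>x. (g has_real_derivative g' x) (at x)" by blast
  then show ?case
    by (intro bexI[of _ "\<lambda>x. f' x + g' x"]) (auto intro!: derivative_intros flat_products.add)
qed

lemma flat_products_smooth: "f \<in> flat_products \<Longrightarrow> infinitely_differentiable f"
  by (erule infinitely_differentiable_coinduct) (rule flat_products_derivative)

lemma infinitely_differentiable_antiderivative:
  assumes "\<And>x. (F has_real_derivative f x) (at x)" "infinitely_differentiable f"
  shows "infinitely_differentiable F"
  unfolding infinitely_differentiable_def
proof (intro allI)
  fix n t
  have *: "deriv F = f"
    using assms(1) by (intro ext DERIV_imp_deriv)
  show "(deriv ^^ n) F differentiable at t"
  proof (cases n)
    case 0
    then show ?thesis
      using assms(1) real_differentiable_def by auto
  next
    case (Suc m)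
    then have "(deriv ^^ n) F = (deriv ^^ m) f"
      by (simp add: funpow_swap1 * del: funpow.simps) (simp add: funpow_swap1 *)
    then show ?thesis
      using assms(2) by (simp add: infinitely_differentiable_def)
  qed
qed

lemma smooth_step_exists:
  obtains \<eta> \<theta> :: "real \<Rightarrow> real" where
    "\<And>x. 0 \<le> \<eta> x" "\<And>x. x \<notin> {0..1} \<Longrightarrow> \<eta> x = 0" "continuous_on UNIV \<eta>"
    "\<And>x. (\<theta> has_real_derivative \<eta> x) (at x)"
    "\<And>x. x \<le> 0 \<Longrightarrow> \<theta> x = 0" "\<And>x. x \<ge> 1 \<Longrightarrow> \<theta> x = 1" "\<And>x. 0 \<le> \<theta> x \<and> \<theta> x \<le> 1"
    "\<And>m s r. infinitely_differentiable (\<lambda>x. \<theta> (m * (x - s)) - \<theta> (m * (x - r)))"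
proof -
  define \<beta> where "\<beta> x = flat 1 x * flat 1 (1 - x)" for x
  have pos: "\<beta> x > 0" if "0 < x" "x < 1" for x
    using that by (simp add: \<beta>_def flat_def)
  have nonneg: "\<beta> x \<ge> 0" for x
    by (simp add: \<beta>_def flat_def)
  have zero: "\<beta> x = 0" if "x \<notin> {0<..<1}" for x
    using that by (auto simp: \<beta>_def flat_def)
  have cont: "isCont \<beta> x" for x
  proof -
    have fc: "isCont (flat 1) y" for y
      by (rule DERIV_isCont[OF flat_has_derivative])
    have "isCont (\<lambda>x. flat 1 (1 - x)) x"
      by (rule isCont_o2[OF _ fc]) (intro continuous_intros)
    with fc show ?thesis
      unfolding \<beta>_def by (rule isCont_mult)
  qed
  obtain F where F: "\<And>x. (F has_real_derivative \<beta> x) (at x)"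
    using einterval_antiderivative[of "-\<infinity>" "\<infinity>" \<beta>] cont
    by (auto simp: has_real_derivative_iff_has_vector_derivative)
  have mono: "F x \<le> F y" if "x \<le> y" for x y
    using DERIV_nonneg_imp_nondecreasing[OF that] F nonneg by blast
  have F_left: "F x = F 0" if "x \<le> 0" for x
  proof (cases "x = 0")
    case False
    then have "\<exists>z. x < z \<and> z < 0 \<and> F 0 - F x = (0 - x) * \<beta> z"
      using that F by (intro MVT2) auto
    then show ?thesis using zero by auto
  qed simp
  have F_right: "F x = F 1" if "x \<ge> 1" for x
  proof (cases "x = 1")
    case False
    then have "\<exists>z. 1 < z \<and> z < x \<and> F x - F 1 = (x - 1) * \<beta> z"
      using that F by (intro MVT2) auto
    then show ?thesis using zero by auto
  qed simp
  have "\<exists>z. 0 < z \<and> z < 1 \<and> F 1 - F 0 = (1 - 0) * \<beta> z"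
    using F by (intro MVT2) auto
  then have lt: "F 0 < F 1" using pos by fastforce
  define C where "C = F 1 - F 0"
  have C: "C > 0" using lt by (simp add: C_def)
  let ?\<eta> = "\<lambda>x. \<beta> x / C" and ?\<theta> = "\<lambda>x. (F x - F 0) / C"
  have d: "(?\<theta> has_real_derivative ?\<eta> x) (at x)" for x
    using C by (auto intro!: derivative_eq_intros F)
  show ?thesis
  proof
    show "0 \<le> ?\<eta> x" for x using nonneg C by simp
    show "?\<eta> x = 0" if "x \<notin> {0..1}" for x using zero that by auto
    show "continuous_on UNIV ?\<eta>"
      using C by (intro continuous_intros) (auto intro: continuous_at_imp_continuous_on cont)
    show "(?\<theta> has_real_derivative ?\<eta> x) (at x)" for x by fact
    show "?\<theta> x = 0" if "x \<le> 0" for x using F_left[OF that] by simp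
    show "?\<theta> x = 1" if "x \<ge> 1" for x using F_right[OF that] C by (simp add: C_def)
    show "0 \<le> ?\<theta> x \<and> ?\<theta> x \<le> 1" for x
    proof -
      have "F 0 \<le> F x" "F x \<le> F 1"
        using mono[of 0 x] F_left[of x] mono[of x 1] F_right[of x] by (metis linear order.refl)+
      then show ?thesis using C by (simp add: C_def)
    qed
    fix m s r :: real
    let ?f = "\<lambda>x. (m / C) * (flat 1 (m * (x - s)) * flat 1 (1 - m * (x - s)))
      + (- m / C) * (flat 1 (m * (x - r)) * flat 1 (1 - m * (x - r)))"
    show "infinitely_differentiable (\<lambda>x. ?\<theta> (m * (x - s)) - ?\<theta> (m * (x - r)))"
    proof (rule infinitely_differentiable_antiderivative)
      show "((\<lambda>x. ?\<theta> (m * (x - s)) - ?\<theta> (m * (x - r))) has_real_derivative ?f x) (at x)" for x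
      proof -
        have sc: "((\<lambda>x. ?\<theta> (m * (x - q))) has_real_derivative ?\<eta> (m * (x - q)) * m) (at x)" for q
          by (rule DERIV_chain2[OF d]) (auto intro!: derivative_eq_intros)
        show ?thesis
          by (rule DERIV_cong[OF DERIV_diff[OF sc sc]]) (simp add: \<beta>_def mult_ac)
      qed
      show "infinitely_differentiable ?f"
        by (intro flat_products_smooth flat_products.intros)
    qed
  qed
qed

lemma weak_derivative_imp_increment:
  fixes G h :: "real \<Rightarrow> real"
  assumes contG: "continuous_on {0..T} G"
    and h: "integrable lborel (\<lambda>t. indicator {0<..<T} t * h t)"
    and weak: "\<And>\<psi>. test_fun T \<psi> \<Longrightarrow> (\<integral>t. indicator {0<..<T} t * (h t * \<psi> t) \<partial>lborel)
        = - (\<integral>t. indicator {0<..<T} t * (G t * deriv \<psi> t) \<partial>lborel)"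
    and sr: "0 < s" "s < r" "r < T"
  shows "G r - G s = (\<integral>t. indicator {s<..r} t * h t \<partial>lborel)"
proof (rule smooth_step_exists)
  fix \<eta> \<theta> :: "real \<Rightarrow> real"
  assume \<eta>0: "\<And>x. 0 \<le> \<eta> x" and \<eta>z: "\<And>x. x \<notin> {0..1} \<Longrightarrow> \<eta> x = 0" and \<eta>c: "continuous_on UNIV \<eta>"
    and \<theta>: "\<And>x. (\<theta> has_real_derivative \<eta> x) (at x)"
    and \<theta>0: "\<And>x. x \<le> 0 \<Longrightarrow> \<theta> x = 0" and \<theta>1: "\<And>x. x \<ge> 1 \<Longrightarrow> \<theta> x = 1"
    and \<theta>b: "\<And>x. 0 \<le> \<theta> x \<and> \<theta> x \<le> 1"
    and sm: "\<And>m s r. infinitely_differentiable (\<lambda>x. \<theta> (m * (x - s)) - \<theta> (m * (x - r)))"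
  have \<eta>m[measurable]: "\<eta> \<in> borel_measurable lborel"
    using borel_measurable_continuous_onI[OF \<eta>c] by simp
  have "has_bochner_integral lborel (\<lambda>x. \<eta> x * indicator {0..1} x) (\<theta> 1 - \<theta> 0)"
    using \<theta> \<eta>0 by (intro has_bochner_integral_FTC_Icc_nonneg) auto
  moreover have "\<eta> x * indicator {0..1} x = \<eta> x" for x
    using \<eta>z[of x] by (auto simp: indicator_def)
  ultimately have \<eta>_int: "integrable lborel \<eta>" and \<eta>1: "(\<integral>x. \<eta> x \<partial>lborel) = 1"
    using \<theta>0[of 0] \<theta>1[of 1] by (auto simp: has_bochner_integral_iff)
  define g where "g t = indicator {0..T} t * G t" for t
  have gm[measurable]: "g \<in> borel_measurable lborel"
    using borel_measurable_continuous_on_indicator[OF _ contG] by (simp add: g_def[abs_def])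
  obtain B where B: "\<And>t. \<bar>g t\<bar> \<le> B"
  proof -
    have "bounded (G ` {0..T})"
      using contG by (intro compact_imp_bounded compact_continuous_image) auto
    then obtain B where "\<forall>t\<in>{0..T}. \<bar>G t\<bar> \<le> B"
      by (auto simp: bounded_iff)
    then have "\<bar>g t\<bar> \<le> max B 0" for t
      by (cases "t \<in> {0..T}") (auto simp: g_def le_max_iff_disj)
    then show thesis by (rule that)
  qed
  have gc: "isCont g x" if "x \<in> {0<..<T}" for x
  proof -
    have "isCont G x"
      using continuous_on_interior[OF contG, of x] that by simp
    moreover have "\<forall>\<^sub>F t in nhds x. g t = G t"
      using eventually_nhds_in_open[of "{0<..<T}" x] that
      by (auto elim!: eventually_mono simp: g_def)
    ultimately show ?thesis
      by (simp add: isCont_cong)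
  qed
  obtain N where N: "real N > 1 / (T - r)"
    using reals_Archimedean2 by blast
  define m where "m n = real n + real N" for n
  have "N > 0"
    using N sr by (metis diff_gt_0_iff_gt divide_pos_pos of_nat_0_less_iff order.strict_trans zero_less_one)
  then have m0: "m n > 0" for n by (simp add: m_def)
  have minf: "filterlim m at_top sequentially"
    unfolding m_def
    by (rule filterlim_at_top_mono[OF filterlim_real_sequentially]) (auto simp: eventually_sequentially)
  have aff: "(\<integral>t. g t * (m n * \<eta> (m n * (t - x))) \<partial>lborel) = (\<integral>u. g (x + u / m n) * \<eta> u \<partial>lborel)" for n x
  proof -
    have "(\<integral>t. g t * (m n * \<eta> (m n * (t - x))) \<partial>lborel) =
        \<bar>1 / m n\<bar> *\<^sub>R (\<integral>u. g (x + 1 / m n * u) * (m n * \<eta> (m n * (x + 1 / m n * u - x))) \<partial>lborel)"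
      using m0[of n] by (intro lborel_integral_real_affine) simp
    also have "\<dots> = (\<integral>u. \<bar>1 / m n\<bar> * (g (x + 1 / m n * u) * (m n * \<eta> (m n * (x + 1 / m n * u - x)))) \<partial>lborel)"
      by simp
    also have "\<dots> = (\<integral>u. g (x + u / m n) * \<eta> u \<partial>lborel)"
      using m0[of n] by (intro Bochner_Integration.integral_cong) auto
    finally show ?thesis .
  qed
  have approx_int: "integrable lborel (\<lambda>t. g t * (m n * \<eta> (m n * (t - x))))" for n x
  proof -
    have "integrable lborel (\<lambda>t. \<eta> (- m n * x + m n * t))"
      using m0[of n] by (intro lborel_integrable_real_affine \<eta>_int) simp
    then have "integrable lborel (\<lambda>t. (B * m n) * \<eta> (m n * (t - x)))"
      by (intro integrable_mult_right) (simp add: algebra_simps)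
    then show ?thesis
    proof (rule Bochner_Integration.integrable_bound)
      show "AE t in lborel. norm (g t * (m n * \<eta> (m n * (t - x)))) \<le> norm (B * m n * \<eta> (m n * (t - x)))"
      proof (rule AE_I2)
        fix t
        have "\<bar>g t\<bar> * (m n * \<eta> (m n * (t - x))) \<le> B * (m n * \<eta> (m n * (t - x)))"
          using B m0[of n] \<eta>0 by (intro mult_right_mono) (auto simp: less_imp_le)
        then show "norm (g t * (m n * \<eta> (m n * (t - x)))) \<le> norm (B * m n * \<eta> (m n * (t - x)))"
          using m0[of n] \<eta>0 B[of t] by (simp add: abs_mult mult.assoc)
      qed
    qed measurable
  qed
  have approx: "(\<lambda>n. \<integral>t. g t * (m n * \<eta> (m n * (t - x))) \<partial>lborel) \<longlonglongrightarrow> G x" if x: "x \<in> {0<..<T}" for x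
  proof -
    have "(\<lambda>n. \<integral>u. g (x + u / m n) * \<eta> u \<partial>lborel) \<longlonglongrightarrow> (\<integral>u. g x * \<eta> u \<partial>lborel)"
    proof (rule integral_dominated_convergence[where w="\<lambda>u. B * \<eta> u"])
      show "AE u in lborel. (\<lambda>n. g (x + u / m n) * \<eta> u) \<longlonglongrightarrow> g x * \<eta> u"
      proof (rule AE_I2)
        fix u
        have "(\<lambda>n. x + u / m n) \<longlonglongrightarrow> x + 0"
          by (intro tendsto_intros real_tendsto_divide_at_top[OF tendsto_const minf])
        then have "(\<lambda>n. g (x + u / m n)) \<longlonglongrightarrow> g x"
          using isCont_tendsto_compose[OF gc[OF x]] by simp
        then show "(\<lambda>n. g (x + u / m n) * \<eta> u) \<longlonglongrightarrow> g x * \<eta> u"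
          by (intro tendsto_intros)
      qed
      show "AE u in lborel. norm (g (x + u / m n) * \<eta> u) \<le> B * \<eta> u" for n
        using B \<eta>0 by (intro AE_I2) (auto simp: abs_mult intro!: mult_right_mono)
    qed (use \<eta>_int in auto)
    then show ?thesis
      using x unfolding aff by (simp add: \<eta>1) (simp add: g_def)
  qed
  define \<psi> where "\<psi> n x = \<theta> (m n * (x - s)) - \<theta> (m n * (x - r))" for n x
  have \<psi>d: "(\<psi> n has_real_derivative m n * \<eta> (m n * (x - s)) - m n * \<eta> (m n * (x - r))) (at x)" for n x
  proof -
    have sc: "((\<lambda>x. \<theta> (m n * (x - q))) has_real_derivative \<eta> (m n * (x - q)) * m n) (at x)" for q
      by (rule DERIV_chain2[OF \<theta>]) (auto intro!: derivative_eq_intros)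
    show ?thesis
      unfolding \<psi>_def by (rule DERIV_cong[OF DERIV_diff[OF sc sc]]) simp
  qed
  have \<psi>t: "test_fun T (\<psi> n)" for n
  proof -
    have "\<forall>k t. (deriv ^^ k) (\<psi> n) differentiable at t"
      using sm[of "m n" s r] unfolding \<psi>_def infinitely_differentiable_def by simp
    moreover have "1 / real N < T - r"
      using N sr \<open>N > 0\<close> by (simp add: field_simps)
    moreover have "1 / m n \<le> 1 / real N"
      using \<open>N > 0\<close> by (intro divide_left_mono) (auto simp: m_def)
    moreover have "\<forall>t. t \<notin> {s..r + 1 / m n} \<longrightarrow> \<psi> n t = 0"
    proof (intro allI impI)
      fix t assume "t \<notin> {s..r + 1 / m n}"
      then consider "t < s" | "t > r + 1 / m n" by fastforce
      then show "\<psi> n t = 0"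
      proof cases
        case 1
        then have "m n * (t - s) \<le> 0" "m n * (t - r) \<le> 0"
          using m0[of n] sr by (auto intro!: mult_nonneg_nonpos simp: less_imp_le)
        then show ?thesis by (simp add: \<psi>_def \<theta>0)
      next
        case 2
        then have "m n * (t - r) \<ge> 1" using m0[of n] by (simp add: field_simps)
        moreover have "m n * (t - s) \<ge> m n * (t - r)"
          using m0[of n] sr by (intro mult_left_mono) auto
        ultimately show ?thesis by (simp add: \<psi>_def \<theta>1)
      qed
    qed
    ultimately show ?thesis
      unfolding test_fun_def using \<open>0 < s\<close> by (smt (verit, best))
  qed
  have \<theta>m[measurable]: "\<theta> \<in> borel_measurable lborel"
    using borel_measurable_continuous_onI[OF DERIV_continuous_on[OF DERIV_subset[OF \<theta>]]] by simp
  define h' where "h' t = indicator {0<..<T} t * h t" for t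
  have h'[measurable]: "h' \<in> borel_measurable lborel" and h'i: "integrable lborel h'"
    using h by (auto simp: h'_def[abs_def])
  have "(\<lambda>n. \<integral>t. h' t * \<psi> n t \<partial>lborel) \<longlonglongrightarrow> (\<integral>t. h' t * indicator {s<..r} t \<partial>lborel)"
  proof (rule integral_dominated_convergence[where w="\<lambda>t. \<bar>h' t\<bar>"])
    show "AE t in lborel. (\<lambda>n. h' t * \<psi> n t) \<longlonglongrightarrow> h' t * indicator {s<..r} t"
    proof (rule AE_I2)
      fix t
      have one: "\<forall>\<^sub>F n in sequentially. \<theta> (m n * (t - q)) = 1" if "q < t" for q
      proof -
        have "\<forall>\<^sub>F n in sequentially. m n \<ge> 1 / (t - q)"
          using minf by (simp add: filterlim_at_top)
        then show ?thesis
          by eventually_elim (use that in \<open>simp add: \<theta>1 field_simps\<close>)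
      qed
      have zero: "\<forall>\<^sub>F n in sequentially. \<theta> (m n * (t - q)) = 0" if "t \<le> q" for q
        using that m0 by (intro always_eventually allI \<theta>0 mult_nonneg_nonpos) (auto simp: less_imp_le)
      consider "t \<le> s" | "s < t" "t \<le> r" | "r < t" by linarith
      then have "\<forall>\<^sub>F n in sequentially. indicator {s<..r} t = \<psi> n t"
      proof cases
        case 1
        then have "t \<le> r" using sr by simp
        from zero[OF 1] zero[OF this] show ?thesis
          by eventually_elim (use 1 in \<open>auto simp: \<psi>_def\<close>)
      next
        case 2
        from one[OF 2(1)] zero[OF 2(2)] show ?thesis
          by eventually_elim (use 2 in \<open>auto simp: \<psi>_def\<close>)
      next
        case 3
        then have "s < t" using sr by simp
        from one[OF this] one[OF 3] show ?thesis
          by eventually_elim (use 3 in \<open>auto simp: \<psi>_def\<close>)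
      qed
      then have "(\<lambda>n. \<psi> n t) \<longlonglongrightarrow> indicator {s<..r} t"
        by (rule Lim_transform_eventually[OF tendsto_const])
      then show "(\<lambda>n. h' t * \<psi> n t) \<longlonglongrightarrow> h' t * indicator {s<..r} t"
        by (intro tendsto_intros)
    qed
    show "AE t in lborel. norm (h' t * \<psi> n t) \<le> \<bar>h' t\<bar>" for n
    proof (rule AE_I2)
      fix t
      have "\<bar>\<psi> n t\<bar> \<le> 1"
        using \<theta>b[of "m n * (t - s)"] \<theta>b[of "m n * (t - r)"] unfolding \<psi>_def by linarith
      then show "norm (h' t * \<psi> n t) \<le> \<bar>h' t\<bar>"
        by (simp add: abs_mult mult_left_le)
    qed
  qed (use h'i in \<open>auto simp: \<psi>_def\<close>)
  moreover have "(\<integral>t. h' t * \<psi> n t \<partial>lborel) =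
      (\<integral>t. g t * (m n * \<eta> (m n * (t - r))) \<partial>lborel) - (\<integral>t. g t * (m n * \<eta> (m n * (t - s))) \<partial>lborel)" for n
  proof -
    have "(\<integral>t. h' t * \<psi> n t \<partial>lborel) = - (\<integral>t. indicator {0<..<T} t * (G t * deriv (\<psi> n) t) \<partial>lborel)"
      using weak[OF \<psi>t] by (simp add: h'_def mult.assoc)
    also have "(\<integral>t. indicator {0<..<T} t * (G t * deriv (\<psi> n) t) \<partial>lborel) =
        (\<integral>t. g t * (m n * \<eta> (m n * (t - s))) - g t * (m n * \<eta> (m n * (t - r))) \<partial>lborel)"
    proof (intro integral_cong_AE)
      have dm: "deriv (\<psi> n) t = m n * \<eta> (m n * (t - s)) - m n * \<eta> (m n * (t - r))" for t
        using \<psi>d by (rule DERIV_imp_deriv)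
      have *: "indicator {0<..<T} t * (G t * deriv (\<psi> n) t)
        = indicator {0<..<T} t * (g t * (m n * \<eta> (m n * (t - s)) - m n * \<eta> (m n * (t - r))))" for t
        unfolding dm by (auto simp: g_def indicator_def)
      show "(\<lambda>t. indicator {0<..<T} t * (G t * deriv (\<psi> n) t)) \<in> borel_measurable lborel"
        unfolding * by measurable
      have "AE t in lborel. t \<noteq> 0 \<and> t \<noteq> T"
        using AE_lborel_singleton[of 0] AE_lborel_singleton[of T] by eventually_elim simp
      then show "AE t in lborel. indicator {0<..<T} t * (G t * deriv (\<psi> n) t) =
        g t * (m n * \<eta> (m n * (t - s))) - g t * (m n * \<eta> (m n * (t - r)))"
        by eventually_elim (auto simp: g_def dm indicator_def algebra_simps)
    qed measurable
    also have "\<dots> = (\<integral>t. g t * (m n * \<eta> (m n * (t - s))) \<partial>lborel) - (\<integral>t. g t * (m n * \<eta> (m n * (t - r))) \<partial>lborel)"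
      by (intro Bochner_Integration.integral_diff approx_int)
    finally show ?thesis by simp
  qed
  moreover have "(\<lambda>n. (\<integral>t. g t * (m n * \<eta> (m n * (t - r))) \<partial>lborel)
      - (\<integral>t. g t * (m n * \<eta> (m n * (t - s))) \<partial>lborel)) \<longlonglongrightarrow> G r - G s"
    using sr by (intro tendsto_intros approx) auto
  ultimately have "G r - G s = (\<integral>t. h' t * indicator {s<..r} t \<partial>lborel)"
    by (simp add: LIMSEQ_unique)
  also have "\<dots> = (\<integral>t. indicator {s<..r} t * h t \<partial>lborel)"
    using sr by (intro Bochner_Integration.integral_cong) (auto simp: h'_def indicator_def)
  finally show ?thesis .
qed

section \<open>Time integration of the weak equation\<close>

lemma continuous_upper_tail_integral:
  fixes h :: "real \<Rightarrow> real"
  assumes h: "integrable lborel h"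
  shows "continuous_on UNIV (\<lambda>s. \<integral>t. indicator {s..} t * h t \<partial>lborel)"
proof (intro continuous_at_imp_continuous_on ballI continuous_at_sequentiallyI)
  fix s :: real and u :: "nat \<Rightarrow> real"
  assume u: "u \<longlonglongrightarrow> s"
  have [measurable]: "h \<in> borel_measurable lborel" using h by simp
  show "(\<lambda>n. \<integral>t. indicator {u n..} t * h t \<partial>lborel) \<longlonglongrightarrow> (\<integral>t. indicator {s..} t * h t \<partial>lborel)"
  proof (rule integral_dominated_convergence[where w="\<lambda>t. \<bar>h t\<bar>"])
    show "AE t in lborel. (\<lambda>n. indicator {u n..} t * h t) \<longlonglongrightarrow> indicator {s..} t * h t"
      using AE_lborel_singleton[of s]
    proof eventually_elim
      case (elim t)
      consider "t < s" | "s < t" using elim by linarith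
      then have "\<forall>\<^sub>F n in sequentially. indicator {s..} t * h t = indicator {u n..} t * h t"
      proof cases
        case 1
        from order_tendstoD(1)[OF u 1] show ?thesis
          by eventually_elim (use 1 in auto)
      next
        case 2
        from order_tendstoD(2)[OF u 2] show ?thesis
          by eventually_elim (use 2 in auto)
      qed
      then show ?case
        by (rule Lim_transform_eventually[OF tendsto_const])
    qed
    show "AE t in lborel. norm (indicator {u n..} t * h t) \<le> \<bar>h t\<bar>" for n
      by (auto simp: indicator_def)
  qed (use h in auto)
qed

lemma Gronwall_AE:
  fixes y :: "real \<Rightarrow> real"
  assumes A: "0 \<le> A" and M: "0 \<le> M"
    and y: "integrable lborel (\<lambda>t. indicator {0..T} t * y t)"
    and ineq: "AE t in lborel. t \<in> {0<..<T} \<longrightarrow>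
      \<bar>y t\<bar> \<le> M + A * (\<integral>r. indicator {0..t} r * \<bar>y r\<bar> \<partial>lborel)"
  shows "AE t in lborel. t \<in> {0<..<T} \<longrightarrow> \<bar>y t\<bar> \<le> M * exp (A * T)"
proof -
  define v where "v t = \<bar>indicator {0..T} t * y t\<bar>" for t
  have v: "integrable lborel v"
    unfolding v_def using y by (rule integrable_abs)
  then have [measurable]: "v \<in> borel_measurable lborel" by simp
  define Y where "Y t = (\<integral>r. indicator {0..} r * v r \<partial>lborel) - (\<integral>r. indicator {t..} r * v r \<partial>lborel)" for t
  have contY: "continuous_on UNIV Y"
    unfolding Y_def by (intro continuous_intros continuous_upper_tail_integral v)
  have vi: "integrable lborel (\<lambda>r. indicator S r * v r)" if "S \<in> sets borel" for S
    using integrable_mult_indicator[OF _ v, of S] that by simp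
  have Y_eq: "Y t = (\<integral>r. indicator {0..t} r * v r \<partial>lborel)" if "0 \<le> t" for t
  proof -
    have "Y t = (\<integral>r. indicator {0..} r * v r - indicator {t..} r * v r \<partial>lborel)"
      unfolding Y_def by (intro Bochner_Integration.integral_diff[symmetric] vi) auto
    also have "\<dots> = (\<integral>r. indicator {0..t} r * v r \<partial>lborel)"
    proof (rule integral_cong_AE)
      show "AE r in lborel. indicator {0..} r * v r - indicator {t..} r * v r = indicator {0..t} r * v r"
        using AE_lborel_singleton[of t] by eventually_elim (use that in \<open>auto simp: indicator_def\<close>)
    qed auto
    finally show ?thesis .
  qed
  define z where "z t = M + A * Y t" for t
  have contz: "continuous_on UNIV z"
    unfolding z_def by (intro continuous_intros contY)
  have [measurable]: "z \<in> borel_measurable lborel"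
    using borel_measurable_continuous_onI[OF contz] by simp
  have Y0: "0 \<le> Y t" if "0 \<le> t" for t
    unfolding Y_eq[OF that] by (intro integral_nonneg_AE) (auto simp: v_def)
  have z0: "0 \<le> z t" if "0 \<le> t" for t
    using Y0[OF that] A M by (simp add: z_def)
  have vY: "(\<integral>r. indicator {0..t} r * \<bar>y r\<bar> \<partial>lborel) = Y t" if "t \<in> {0<..<T}" for t
    using that by (subst Y_eq) (auto intro!: Bochner_Integration.integral_cong simp: v_def indicator_def)
  have yz: "AE t in lborel. t \<in> {0<..<T} \<longrightarrow> \<bar>y t\<bar> \<le> z t"
    using ineq by eventually_elim (auto simp: z_def vY)
  have vz: "AE t in lborel. 0 \<le> t \<longrightarrow> v t \<le> z t"
    using yz AE_lborel_singleton[of 0] AE_lborel_singleton[of T]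
  proof eventually_elim
    case (elim t)
    then show ?case using z0[of t]
      by (cases "t \<in> {0<..<T}") (auto simp: v_def indicator_def)
  qed
  obtain F where F: "\<And>x. (F has_real_derivative z x) (at x)"
  proof -
    have "isCont z x" for x
      using contz by (simp add: continuous_on_eq_continuous_at)
    then show thesis
      using einterval_antiderivative[of "-\<infinity>" "\<infinity>" z] that
      by (auto simp: has_real_derivative_iff_has_vector_derivative)
  qed
  have YF: "Y t \<le> F t - F 0" if "0 \<le> t" for t
  proof -
    have b: "has_bochner_integral lborel (\<lambda>x. z x * indicator {0..t} x) (F t - F 0)"
      using F z0 that by (intro has_bochner_integral_FTC_Icc_nonneg) auto
    have "Y t \<le> (\<integral>x. z x * indicator {0..t} x \<partial>lborel)"
      unfolding Y_eq[OF that]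
    proof (rule integral_mono_AE)
      show "AE r in lborel. indicator {0..t} r * v r \<le> z r * indicator {0..t} r"
        using vz by eventually_elim (auto simp: indicator_def)
    qed (use vi b in \<open>auto simp: has_bochner_integral_iff\<close>)
    then show ?thesis using b by (simp add: has_bochner_integral_iff)
  qed
  define q where "q t = M + A * (F t - F 0)" for t
  have zq: "z t \<le> q t" if "0 \<le> t" for t
    using YF[OF that] A by (auto simp: z_def q_def intro: mult_left_mono)
  have qM: "exp (- A * t) * q t \<le> M" if "0 \<le> t" for t
  proof -
    have "exp (- A * t) * q t \<le> exp (- A * 0) * q 0"
    proof (rule DERIV_nonpos_imp_nonincreasing[OF that, of "\<lambda>t. exp (- A * t) * q t"])
      fix x assume x: "0 \<le> x" "x \<le> t"
      have qd: "(q has_real_derivative A * z x) (at x)"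
        unfolding q_def by (auto intro!: derivative_eq_intros F)
      have "((\<lambda>t. exp (- A * t) * q t) has_real_derivative exp (- A * x) * (A * (z x - q x))) (at x)"
        by (auto intro!: derivative_eq_intros qd simp: algebra_simps)
      moreover have "exp (- A * x) * (A * (z x - q x)) \<le> 0"
        using zq[OF x(1)] A by (intro mult_nonneg_nonpos) auto
      ultimately show "\<exists>D. ((\<lambda>t. exp (- A * t) * q t) has_real_derivative D) (at x) \<and> D \<le> 0" by blast
    qed
    then show ?thesis by (simp add: q_def)
  qed
  show ?thesis
    using yz
  proof eventually_elim
    case (elim t)
    show ?case
    proof
      assume t: "t \<in> {0<..<T}"
      have "\<bar>y t\<bar> \<le> q t" using elim t zq[of t] by auto
      also have "q t = exp (A * t) * (exp (- A * t) * q t)"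
        by (simp add: exp_minus)
      also have "\<dots> \<le> exp (A * t) * M"
        using qM[of t] t by (intro mult_left_mono) auto
      also have "\<dots> \<le> exp (A * T) * M"
        using t A M by (intro mult_right_mono) (auto intro: mult_left_mono)
      finally show "\<bar>y t\<bar> \<le> M * exp (A * T)" by (simp add: mult.commute)
    qed
  qed
qed

lemma integrable_pair_product:
  fixes f :: "'a::euclidean_space \<Rightarrow> real" and g :: "'b::euclidean_space \<Rightarrow> real"
  assumes f: "integrable lborel f" and g: "integrable lborel g"
  shows "integrable (lborel \<Otimes>\<^sub>M lborel) (\<lambda>z. f (fst z) * g (snd z))"
proof (rule lborel_pair.Fubini_integrable)
  have [measurable]: "f \<in> borel_measurable lborel" "g \<in> borel_measurable lborel"
    using f g by auto
  show "(\<lambda>z. f (fst z) * g (snd z)) \<in> borel_measurable (lborel \<Otimes>\<^sub>M lborel)"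
    by measurable
  show "integrable lborel (\<lambda>x. \<integral>y. norm (f (fst (x, y)) * g (snd (x, y))) \<partial>lborel)"
    using f g by (simp add: abs_mult)
  show "AE x in lborel. integrable lborel (\<lambda>y. f (fst (x, y)) * g (snd (x, y)))"
    using g by simp
qed

lemma compact_avoiding_null_set:
  fixes a b :: real
  assumes N: "N \<in> null_sets lborel" and ab: "a < b"
  obtains K where "compact K" "K \<subseteq> {a..b}" "K \<inter> N = {}" "emeasure lborel K \<noteq> 0"
proof -
  have Nm[measurable]: "N \<in> sets borel" using null_setsD2[OF N] by simp
  have "0 < (b - a) / 2" using ab by simp
  then obtain U where U: "open U" "N \<subseteq> U" "emeasure lborel (U - N) < (b - a) / 2"
    by (rule outer_regular_lborel[OF Nm])
  have [measurable]: "U \<in> sets borel" using U by auto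
  have eU: "emeasure lborel U < (b - a) / 2"
    using emeasure_Diff_null_set[OF N, of U] U(3) by simp
  show thesis
  proof (rule that[of "{a..b} - U"])
    show "compact ({a..b} - U)" using U(1) by (intro compact_diff) auto
    show "emeasure lborel ({a..b} - U) \<noteq> 0"
    proof
      assume 0: "emeasure lborel ({a..b} - U) = 0"
      have "emeasure lborel {a..b} \<le> emeasure lborel (({a..b} - U) \<union> U)"
        by (intro emeasure_mono) auto
      also have "\<dots> \<le> emeasure lborel ({a..b} - U) + emeasure lborel U"
        by (intro emeasure_subadditive) auto
      also have "\<dots> < (b - a) / 2" using 0 eU by simp
      finally have "ennreal (b - a) < ennreal ((b - a) / 2)" using ab by simp
      then show False using ab by (simp add: ennreal_less_iff)
    qed
  qed (use U in auto)
qed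

lemma measurable_off_compact:
  fixes q :: "real \<Rightarrow> real \<Rightarrow> real" and \<psi> :: "real \<Rightarrow> real"
  assumes K: "compact K" "K \<inter> {0, T} = {}"
    and meas: "\<And>a. (\<lambda>t. indicator {0<..<T} t * q t a) \<in> borel_measurable lborel"
    and lin: "\<And>t a. t \<in> K \<Longrightarrow> t \<in> {0<..<T} \<Longrightarrow> q t a = a * q t 1"
    and const: "\<And>a b t. {a..b} \<inter> K = {} \<Longrightarrow> t \<in> {a..b} \<Longrightarrow> \<psi> t = \<psi> a"
    and \<psi>[measurable]: "\<psi> \<in> borel_measurable lborel"
  shows "(\<lambda>t. indicator {0..T} t * q t (\<psi> t)) \<in> borel_measurable lborel"
proof -
  have Km[measurable]: "K \<in> sets borel" using K(1) by (simp add: borel_compact)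
  have mclosed: "(\<lambda>t. indicator {0..T} t * q t a) \<in> borel_measurable lborel" for a
  proof -
    have "(\<lambda>t. indicator {0<..<T} t * q t a + (if t = 0 \<or> t = T then indicator {0..T} t * q t a else 0)) \<in> borel_measurable lborel"
    proof (intro borel_measurable_add meas)
      have "(if t = 0 \<or> t = T then indicator {0..T} t * q t a else 0)
          = (if t = 0 then indicator {0..T} 0 * q 0 a else if t = T then indicator {0..T} T * q T a else 0)" for t
        by auto
      then show "(\<lambda>t. if t = 0 \<or> t = T then indicator {0..T} t * q t a else 0) \<in> borel_measurable lborel"
        by simp
    qed
    moreover have "indicator {0<..<T} t * q t a + (if t = 0 \<or> t = T then indicator {0..T} t * q t a else 0)
        = indicator {0..T} t * q t a" for t
      by (auto simp: indicator_def)
    ultimately show ?thesis by simp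
  qed
  define C where "C = insert K ((\<lambda>(a, b). {a..b}) ` {(a, b). a \<in> \<rat> \<and> b \<in> \<rat> \<and> {a..b} \<inter> K = {}})"
  show ?thesis
  proof (rule measurable_piecewise_restrict[of C])
    have "countable (\<rat> \<times> \<rat> :: (real \<times> real) set)"
      by (simp add: countable_rat)
    then have "countable {(a::real, b::real). a \<in> \<rat> \<and> b \<in> \<rat> \<and> {a..b} \<inter> K = {}}"
      by (rule countable_subset[rotated]) auto
    then show "countable C" by (simp add: C_def)
    show "X \<inter> space lborel \<in> sets lborel" if "X \<in> C" for X
      using that by (auto simp: C_def)
    show "space lborel \<subseteq> \<Union> C"
    proof
      fix t :: real
      show "t \<in> \<Union> C"
      proof (cases "t \<in> K")
        case False
        have "open (- K)" using K(1) by (simp add: compact_imp_closed open_Compl)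
        then obtain e where e: "e > 0" "cball t e \<subseteq> - K"
          using False open_contains_cball by blast
        obtain a where a: "a \<in> \<rat>" "t - e < a" "a < t"
          using Rats_dense_in_real[of "t - e" t] e by auto
        obtain b where b: "b \<in> \<rat>" "t < b" "b < t + e"
          using Rats_dense_in_real[of t "t + e"] e by auto
        have "{a..b} \<subseteq> cball t e" using a b by (auto simp: dist_real_def)
        then have "{a..b} \<inter> K = {}" using e by blast
        then have "{a..b} \<in> C" using a b by (auto simp: C_def)
        moreover have "t \<in> {a..b}" using a b by simp
        ultimately show ?thesis by blast
      qed (simp add: C_def)
    qed
    show "(\<lambda>t. indicator {0..T} t * q t (\<psi> t)) \<in> borel_measurable (restrict_space lborel X)" if X: "X \<in> C" for X
    proof -
      consider "X = K" | a b where "X = {a..b}" "{a..b} \<inter> K = {}"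
        using X by (auto simp: C_def)
      then show ?thesis
      proof cases
        case 1
        have "(\<lambda>t. \<psi> t * (indicator {0<..<T} t * q t 1)) \<in> borel_measurable lborel"
          by (intro borel_measurable_times meas \<psi>)
        then have "(\<lambda>t. \<psi> t * (indicator {0<..<T} t * q t 1)) \<in> borel_measurable (restrict_space lborel K)"
          by (rule measurable_restrict_space1)
        moreover have "\<psi> t * (indicator {0<..<T} t * q t 1) = indicator {0..T} t * q t (\<psi> t)" if "t \<in> K" for t
        proof (cases "t \<in> {0<..<T}")
          case True
          then show ?thesis using lin[OF that True, of "\<psi> t"] by simp
        next
          case False
          moreover have "t \<noteq> 0" "t \<noteq> T" using K(2) that by auto
          ultimately have "t \<notin> {0..T}" by auto
          with False show ?thesis by simp
        qed
        ultimately show ?thesis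
          unfolding 1 by (subst measurable_cong[where g="\<lambda>t. \<psi> t * (indicator {0<..<T} t * q t 1)"])
            (auto simp: space_restrict_space)
      next
        case 2
        have "(\<lambda>t. indicator {0..T} t * q t (\<psi> a)) \<in> borel_measurable (restrict_space lborel X)"
          by (rule measurable_restrict_space1[OF mclosed])
        moreover have "indicator {0..T} t * q t (\<psi> t) = indicator {0..T} t * q t (\<psi> a)" if "t \<in> X" for t
          using const[OF 2(2), of t] that 2(1) by metis
        ultimately show ?thesis
          by (subst measurable_cong[where g="\<lambda>t. indicator {0..T} t * q t (\<psi> a)"])
            (auto simp: space_restrict_space)
      qed
    qed
  qed
qed

text \<open>For time-dependent \<open>\<psi>\<close> the function \<open>t \<mapsto> q t (\<psi> t)\<close> need not be measurable: linearity of \<open>q t\<close> may fail on a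
  null set of times, and a non-measurable integrand has integral \<open>0\<close>. The test functions \<open>\<psi> t = |K \<inter> (-\<infinity>, t]|\<close>, with
  \<open>K\<close> compact and disjoint from that null set, avoid this: off \<open>K\<close> they are locally constant.\<close>
lemma localise_weak_equation:
  fixes q :: "real \<Rightarrow> real \<Rightarrow> real" and f :: "real \<Rightarrow> real"
  assumes meas: "\<And>a. (\<lambda>t. indicator {0<..<T} t * q t a) \<in> borel_measurable lborel"
    and lin: "AE t in lborel. t \<in> {0<..<T} \<longrightarrow> (\<forall>a. q t a = a * q t 1)"
    and qi: "integrable lborel (\<lambda>t. indicator {0<..<T} t * q t 1)"
    and fi: "integrable lborel (\<lambda>t. indicator {0..T} t * f t)"
    and eq: "\<And>\<psi>. continuous_on UNIV \<psi> \<Longrightarrow> (\<integral>t. indicator {0..T} t * q t (\<psi> t) \<partial>lborel)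
        + (\<integral>t. indicator {0..T} t * (\<psi> t * f t) \<partial>lborel) = 0"
  shows "(\<integral>t. indicator {s..} t * (indicator {0<..<T} t * q t 1 + indicator {0..T} t * f t) \<partial>lborel) = 0"
proof -
  define h where "h t = indicator {0<..<T} t * q t 1 + indicator {0..T} t * f t" for t
  have hi: "integrable lborel h"
    unfolding h_def by (intro Bochner_Integration.integrable_add qi fi)
  then have [measurable]: "h \<in> borel_measurable lborel" by simp
  define H where "H s = (\<integral>t. indicator {s..} t * h t \<partial>lborel)" for s
  have contH: "continuous_on UNIV H"
    unfolding H_def by (rule continuous_upper_tail_integral[OF hi])
  have "AE t in lborel. t \<noteq> 0 \<and> t \<noteq> T \<and> (t \<in> {0<..<T} \<longrightarrow> (\<forall>a. q t a = a * q t 1))"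
    using lin AE_lborel_singleton[of 0] AE_lborel_singleton[of T] by eventually_elim blast
  then obtain N where N: "{t \<in> space lborel. \<not> (t \<noteq> 0 \<and> t \<noteq> T \<and> (t \<in> {0<..<T} \<longrightarrow> (\<forall>a. q t a = a * q t 1)))} \<subseteq> N"
      "emeasure lborel N = 0" "N \<in> sets lborel"
    by (rule AE_E)
  have Nnull: "N \<in> null_sets lborel" using N by auto
  have Ngood: "t \<noteq> 0" "t \<noteq> T" "t \<in> {0<..<T} \<Longrightarrow> q t a = a * q t 1" if "t \<notin> N" for t a
    using N(1) that by auto
  have zero_on: "(\<integral>s. indicator K s * H s \<partial>lborel) = 0" if K: "compact K" "K \<inter> N = {}" for K
  proof -
    have Km[measurable]: "K \<in> sets borel" using K(1) by (simp add: borel_compact)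
    have Kfin: "emeasure lborel K < \<infinity>"
      using K(1) by (intro emeasure_bounded_finite compact_imp_bounded)
    define \<psi> where "\<psi> t = measure lborel (K \<inter> {..t})" for t
    have fm: "K \<inter> {..t} \<in> fmeasurable lborel" for t
      using Kfin by (intro fmeasurableI2[OF fmeasurableI[of K]]) auto
    have step: "\<psi> t = \<psi> a + measure lborel (K \<inter> {a<..t})" if "a \<le> t" for a t
    proof -
      have "K \<inter> {..t} = (K \<inter> {..a}) \<union> (K \<inter> {a<..t})" using that by auto
      moreover have "K \<inter> {a<..t} \<in> fmeasurable lborel"
        using fm[of t] by (rule fmeasurableI2) auto
      ultimately show ?thesis
        unfolding \<psi>_def using fm[of a] by (auto simp: fmeasurable_def intro!: measure_Union)
    qed
    have const: "\<psi> t = \<psi> a" if "{a..b} \<inter> K = {}" "t \<in> {a..b}" for a b t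
    proof -
      have "K \<inter> {a<..t} \<subseteq> {a..b} \<inter> K" using that(2) by auto
      then have "K \<inter> {a<..t} = {}" using that(1) by blast
      then show ?thesis using step[of a t] that by simp
    qed
    have lip: "\<bar>\<psi> t - \<psi> a\<bar> \<le> t - a" if "a \<le> t" for a t
    proof -
      have "measure lborel (K \<inter> {a<..t}) \<le> measure lborel {a<..t}"
        by (intro measure_mono_fmeasurable) (auto simp: fmeasurable_def that)
      then show ?thesis using step[OF that] that by simp
    qed
    have cont\<psi>: "continuous_on UNIV \<psi>"
    proof (rule lipschitz_on_continuous_on[of 1], rule lipschitz_onI)
      show "dist (\<psi> x) (\<psi> y) \<le> 1 * dist x y" for x y
        using lip[of x y] lip[of y x] by (cases "x \<le> y") (auto simp: dist_real_def)
    qed simp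
    have [measurable]: "\<psi> \<in> borel_measurable lborel"
      using borel_measurable_continuous_onI[OF cont\<psi>] by simp
    have "(\<lambda>t. indicator {0..T} t * q t (\<psi> t)) \<in> borel_measurable lborel"
    proof (rule measurable_off_compact[OF K(1), where q=q and \<psi>=\<psi>])
      show "K \<inter> {0, T} = {}" using K(2) Ngood(1,2) by blast
      show "q t a = a * q t 1" if "t \<in> K" "t \<in> {0<..<T}" for t a
        using K(2) that Ngood(3) by blast
      show "\<psi> t = \<psi> a" if "{a..b} \<inter> K = {}" "t \<in> {a..b}" for a b t
        using const that by blast
    qed (intro meas, measurable)
    moreover have "AE t in lborel. indicator {0..T} t * q t (\<psi> t) = \<psi> t * (indicator {0<..<T} t * q t 1)"
    proof -
      have "AE t in lborel. t \<notin> N" using Nnull by (rule AE_not_in)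
      then show ?thesis
      proof eventually_elim
        case (elim t)
        show ?case
        proof (cases "t \<in> {0<..<T}")
          case True
          then show ?thesis using Ngood(3)[OF elim True, of "\<psi> t"] by simp
        next
          case False
          then have "t \<notin> {0..T}" using Ngood(1,2)[OF elim] by auto
          with False show ?thesis by simp
        qed
      qed
    qed
    ultimately have q\<psi>: "(\<integral>t. indicator {0..T} t * q t (\<psi> t) \<partial>lborel) = (\<integral>t. \<psi> t * (indicator {0<..<T} t * q t 1) \<partial>lborel)"
      using qi by (intro integral_cong_AE) auto
    have \<psi>b: "\<bar>\<psi> t\<bar> \<le> measure lborel K" for t
      unfolding \<psi>_def using Kfin by (auto intro!: measure_mono_fmeasurable fmeasurableI)
    have i\<psi>: "integrable lborel (\<lambda>t. \<psi> t * g t)" if g: "integrable lborel g" for g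
    proof (rule Bochner_Integration.integrable_bound[OF integrable_mult_right[OF g, of "measure lborel K"]])
      show "AE t in lborel. norm (\<psi> t * g t) \<le> norm (measure lborel K * g t)"
        using \<psi>b by (auto simp: abs_mult intro!: mult_right_mono)
    qed (use g in auto)
    have "(\<integral>t. \<psi> t * h t \<partial>lborel) = (\<integral>t. \<psi> t * (indicator {0<..<T} t * q t 1) \<partial>lborel)
        + (\<integral>t. \<psi> t * (indicator {0..T} t * f t) \<partial>lborel)"
      unfolding h_def distrib_left by (intro Bochner_Integration.integral_add i\<psi> qi fi)
    also have "\<dots> = 0"
      using eq[OF cont\<psi>] unfolding q\<psi> by (simp add: mult_ac)
    finally have "(\<integral>t. \<psi> t * h t \<partial>lborel) = 0" .
    moreover have "(\<integral>t. \<psi> t * h t \<partial>lborel) = (\<integral>s. indicator K s * H s \<partial>lborel)"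
    proof -
      define A where "A z = (if fst z \<le> snd z then indicator K (fst z) * h (snd z) else 0)" for z :: "real \<times> real"
      have "integrable (lborel \<Otimes>\<^sub>M lborel) (\<lambda>z. indicator K (fst z) * h (snd z))"
        using Kfin hi by (intro integrable_pair_product) auto
      then have Ai: "integrable (lborel \<Otimes>\<^sub>M lborel) A"
      proof (rule Bochner_Integration.integrable_bound)
        show "A \<in> borel_measurable (lborel \<Otimes>\<^sub>M lborel)"
          unfolding A_def by measurable
      qed (auto simp: A_def)
      have "(\<integral>s. \<integral>t. A (s, t) \<partial>lborel \<partial>lborel) = (\<integral>t. \<integral>s. A (s, t) \<partial>lborel \<partial>lborel)"
        using lborel_pair.Fubini_integral[of "\<lambda>s t. A (s, t)"] Ai by (simp add: case_prod_eta)
      moreover have "(\<integral>t. A (s, t) \<partial>lborel) = indicator K s * H s" for s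
      proof -
        have "A (s, t) = indicator K s * (indicator {s..} t * h t)" for t
          by (auto simp: A_def indicator_def)
        then show ?thesis by (simp add: H_def)
      qed
      moreover have "(\<integral>s. A (s, t) \<partial>lborel) = \<psi> t * h t" for t
      proof -
        have "A (s, t) = indicator (K \<inter> {..t}) s * h t" for s
          by (auto simp: A_def indicator_def)
        then show ?thesis by (simp add: \<psi>_def)
      qed
      ultimately show ?thesis by simp
    qed
    ultimately show ?thesis by simp
  qed
  have "H s = 0"
  proof (rule ccontr)
    assume ns: "H s \<noteq> 0"
    have "isCont (\<lambda>x. H x * H s) s"
      using contH by (intro continuous_intros) (simp add: continuous_on_eq_continuous_at)
    moreover have "0 < H s * H s" using ns by (simp add: mult_neg_neg mult_pos_pos zero_less_mult_iff) linarith
    ultimately have "\<forall>\<^sub>F x in at s. 0 < H x * H s"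
      unfolding isCont_def by (rule order_tendstoD)
    then obtain d where d: "d > 0" "\<And>x. x \<noteq> s \<Longrightarrow> dist x s < d \<Longrightarrow> 0 < H x * H s"
      by (auto simp: eventually_at)
    define a where "a = s + d / 3"
    define b where "b = s + d / 2"
    have ab: "a < b" using d by (simp add: a_def b_def)
    have pos: "0 < H x * H s" if "x \<in> {a..b}" for x
      using that d by (intro d(2)) (auto simp: a_def b_def dist_real_def)
    obtain K where K: "compact K" "K \<subseteq> {a..b}" "K \<inter> N = {}" "emeasure lborel K \<noteq> 0"
      using compact_avoiding_null_set[OF Nnull ab] by metis
    have Km[measurable]: "K \<in> sets borel" using K(1) by (simp add: borel_compact)
    have Hm[measurable]: "H \<in> borel_measurable lborel"
      using borel_measurable_continuous_onI[OF contH] by simp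
    have int: "integrable lborel (\<lambda>x. indicator K x *\<^sub>R (H x * H s))"
      using K(1) by (intro borel_integrable_compact continuous_intros continuous_on_subset[OF contH]) auto
    have "(\<integral>x. indicator K x *\<^sub>R (H x * H s) \<partial>lborel) = (\<integral>x. (indicator K x * H x) * H s \<partial>lborel)"
      by (simp add: mult.assoc)
    also have "\<dots> = 0" using zero_on[OF K(1,3)] by simp
    finally have "AE x in lborel. indicator K x *\<^sub>R (H x * H s) = 0"
      using K(2) pos by (subst (asm) integral_nonneg_eq_0_iff_AE[OF int]) (auto simp: indicator_def less_imp_le subset_iff)
    then have "AE x in lborel. x \<notin> K"
      by eventually_elim (use K(2) pos in \<open>fastforce simp: indicator_def split: if_splits\<close>)
    then have "emeasure lborel K = 0"
      using AE_iff_measurable[of K lborel "\<lambda>x. x \<notin> K"] by simp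
    then show False using K(4) by simp
  qed
  then show ?thesis by (simp add: H_def h_def)
qed

lemma weak_equation_integrated:
  fixes q :: "real \<Rightarrow> real \<Rightarrow> real" and f G :: "real \<Rightarrow> real"
  assumes meas: "\<And>a. (\<lambda>t. indicator {0<..<T} t * q t a) \<in> borel_measurable lborel"
    and lin: "AE t in lborel. t \<in> {0<..<T} \<longrightarrow> (\<forall>a. q t a = a * q t 1)"
    and qi: "integrable lborel (\<lambda>t. indicator {0<..<T} t * q t 1)"
    and fi: "integrable lborel (\<lambda>t. indicator {0..T} t * f t)"
    and eq: "\<And>\<psi>. continuous_on UNIV \<psi> \<Longrightarrow> (\<integral>t. indicator {0..T} t * q t (\<psi> t) \<partial>lborel)
        + (\<integral>t. indicator {0..T} t * (\<psi> t * f t) \<partial>lborel) = 0"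
    and contG: "continuous_on {0..T} G"
    and weak: "\<And>\<psi>. test_fun T \<psi> \<Longrightarrow> (\<integral>t. indicator {0<..<T} t * (q t 1 * \<psi> t) \<partial>lborel)
        = - (\<integral>t. indicator {0<..<T} t * (G t * deriv \<psi> t) \<partial>lborel)"
    and r: "0 < r" "r < T"
  shows "G r - G 0 = - (\<integral>t. indicator {0..r} t * f t \<partial>lborel)"
proof -
  define Q where "Q t = indicator {0<..<T} t * q t 1" for t
  define g where "g t = indicator {0..T} t * f t" for t
  have Qi: "integrable lborel Q" and gi: "integrable lborel g"
    using qi fi by (auto simp: Q_def[abs_def] g_def[abs_def])
  then have [measurable]: "Q \<in> borel_measurable lborel" "g \<in> borel_measurable lborel" by auto
  have tail: "integrable lborel (\<lambda>t. indicator S t * h t)" if "integrable lborel h" "S \<in> sets borel" for h :: "real \<Rightarrow> real" and S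
    using integrable_mult_indicator[of S lborel h] that by simp
  have diff: "(\<integral>t. indicator {a..} t * h t \<partial>lborel) - (\<integral>t. indicator {b..} t * h t \<partial>lborel)
      = (\<integral>t. indicator {a<..b} t * h t \<partial>lborel)" if h: "integrable lborel h" and "a \<le> b" for h :: "real \<Rightarrow> real" and a b
  proof -
    have [measurable]: "h \<in> borel_measurable lborel" using h by simp
    have "(\<integral>t. indicator {a..} t * h t \<partial>lborel) - (\<integral>t. indicator {b..} t * h t \<partial>lborel)
        = (\<integral>t. indicator {a..} t * h t - indicator {b..} t * h t \<partial>lborel)"
      by (intro Bochner_Integration.integral_diff[symmetric] tail h) auto
    also have "\<dots> = (\<integral>t. indicator {a<..b} t * h t \<partial>lborel)"
    proof (rule integral_cong_AE)
      show "AE t in lborel. indicator {a..} t * h t - indicator {b..} t * h t = indicator {a<..b} t * h t"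
        using AE_lborel_singleton[of a] AE_lborel_singleton[of b]
        by eventually_elim (use \<open>a \<le> b\<close> in \<open>auto simp: indicator_def\<close>)
    qed auto
    finally show ?thesis .
  qed
  define HQ where "HQ s = (\<integral>t. indicator {s..} t * Q t \<partial>lborel)" for s
  define Hg where "Hg s = (\<integral>t. indicator {s..} t * g t \<partial>lborel)" for s
  have HQg: "HQ s = - Hg s" for s
  proof -
    have "(\<integral>t. indicator {s..} t * (Q t + g t) \<partial>lborel) = 0"
      using localise_weak_equation[OF meas lin qi fi eq, of s] by (simp add: Q_def g_def)
    moreover have "(\<integral>t. indicator {s..} t * (Q t + g t) \<partial>lborel) = HQ s + Hg s"
      unfolding HQ_def Hg_def distrib_left by (intro Bochner_Integration.integral_add tail Qi gi) auto
    ultimately show ?thesis by simp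
  qed
  have inc: "G b - Hg b = G a - Hg a" if "0 < a" "a < b" "b < T" for a b
  proof -
    have "G b - G a = (\<integral>t. indicator {a<..b} t * q t 1 \<partial>lborel)"
      by (rule weak_derivative_imp_increment[OF contG qi weak that])
    also have "\<dots> = (\<integral>t. indicator {a<..b} t * Q t \<partial>lborel)"
      using that by (intro Bochner_Integration.integral_cong) (auto simp: Q_def indicator_def)
    also have "\<dots> = HQ a - HQ b"
      unfolding HQ_def using that by (subst diff[OF Qi]) auto
    finally show ?thesis by (simp add: HQg)
  qed
  have c1: "G x - Hg x = G r - Hg r" if "x \<in> {0<..<T}" for x
    using inc[of x r] inc[of r x] that r by (cases x r rule: linorder_cases) auto
  have c2: "continuous_on (closure {0<..<T}) (\<lambda>x. G x - Hg x)"
    using r contG continuous_on_subset[OF continuous_upper_tail_integral[OF gi]]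
    unfolding Hg_def by (intro continuous_intros) auto
  have c3: "0 \<in> closure {0<..<T}" using r by simp
  have "G 0 - Hg 0 = G r - Hg r"
    using continuous_constant_on_closure[OF c2 c1 c3] by simp
  then have "G r - G 0 = - (Hg 0 - Hg r)" by simp
  also have "Hg 0 - Hg r = (\<integral>t. indicator {0<..r} t * g t \<partial>lborel)"
    unfolding Hg_def using r by (subst diff[OF gi]) auto
  also have "\<dots> = (\<integral>t. indicator {0..r} t * g t \<partial>lborel)"
  proof (rule integral_cong_AE)
    show "AE t in lborel. indicator {0<..r} t * g t = indicator {0..r} t * g t"
      using AE_lborel_singleton[of 0] by eventually_elim (auto simp: indicator_def)
  qed auto
  also have "\<dots> = (\<integral>t. indicator {0..r} t * f t \<partial>lborel)"
    using r by (intro Bochner_Integration.integral_cong) (auto simp: g_def indicator_def)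
  finally show ?thesis .
qed

section \<open>The energy space\<close>

locale nonlocal_domain =
  fixes \<Omega> :: "'a::euclidean_space set" and \<epsilon> \<sigma> :: real
  assumes open_Omega: "open \<Omega>" and bounded_Omega: "bounded \<Omega>"
    and eps: "0 < \<epsilon>" and sig: "0 < \<sigma>"
begin

definition W :: "'a set" where "W = \<Omega> \<union> OmegaI \<Omega> \<epsilon>"

definition J :: "'a \<Rightarrow> 'a \<Rightarrow> real" where "J x y = (alph \<sigma> \<epsilon> x y)\<^sup>2"

definition J0 :: real where "J0 = (2 * pi * \<sigma>\<^sup>2) powr (- real DIM('a) / 2)"

lemma W_eq: "W = (\<Union>x\<in>\<Omega>. ball x \<epsilon>)"
  using eps by (auto simp: W_def OmegaI_def dist_norm norm_minus_commute)

lemma Omega_subset_W: "\<Omega> \<subseteq> W"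
  by (simp add: W_def)

lemma Omega_measurable[measurable]: "\<Omega> \<in> sets borel"
  using open_Omega by simp

lemma W_measurable[measurable]: "W \<in> sets borel"
  unfolding W_eq by (intro borel_open open_UN) auto

lemma bounded_W: "bounded W"
proof -
  obtain R where R: "\<And>x. x \<in> \<Omega> \<Longrightarrow> norm x \<le> R"
    using bounded_Omega by (auto simp: bounded_iff)
  have "norm y \<le> R + \<epsilon>" if "y \<in> W" for y
  proof -
    obtain x where "x \<in> \<Omega>" "dist x y < \<epsilon>" using \<open>y \<in> W\<close> by (auto simp: W_eq)
    then show ?thesis using R[of x] norm_triangle_ineq[of x "y - x"] by (simp add: dist_norm norm_minus_commute)
  qed
  then show ?thesis by (auto simp: bounded_iff)
qed

lemma finite_W: "emeasure lborel W < \<infinity>"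
  using bounded_W by (rule emeasure_bounded_finite)

lemma finite_Omega: "emeasure lborel \<Omega> < \<infinity>"
  using bounded_Omega by (rule emeasure_bounded_finite)

lemma J0_pos: "0 < J0"
  using sig by (simp add: J0_def)

lemma Gam_eq: "Gam \<sigma> \<nu> x y = J0 * exp (- (norm (x - y))\<^sup>2 / (2 * \<sigma>\<^sup>2)) * (if dist x y \<le> \<nu> then 1 else 0)"
  for x y :: 'a
  by (simp add: Gam_def J0_def indicator_def)

lemma Gam_nonneg: "0 \<le> Gam \<sigma> \<nu> x y" for x y :: 'a
  using J0_pos by (simp add: Gam_eq)

lemma Gam_le: "Gam \<sigma> \<nu> x y \<le> J0" for x y :: 'a
  using J0_pos by (simp add: Gam_eq mult_left_le)

lemma Gam_mono: "\<nu> \<le> \<nu>' \<Longrightarrow> Gam \<sigma> \<nu> x y \<le> Gam \<sigma> \<nu>' x y" for x y :: 'a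
  using J0_pos by (simp add: Gam_eq)

lemma Gam_measurable[measurable]:
  assumes [measurable]: "f \<in> M \<rightarrow>\<^sub>M borel" "g \<in> M \<rightarrow>\<^sub>M borel"
  shows "(\<lambda>z. Gam \<sigma> \<nu> (f z) (g z :: 'a)) \<in> borel_measurable M"
  unfolding Gam_eq by measurable

lemma J_eq: "J x y = (if norm x = norm y then 0 else Gam \<sigma> \<epsilon> x y)"
  using Gam_nonneg by (auto simp: J_def alph_def power_mult_distrib sgn_if)

lemma J_nonneg: "0 \<le> J x y"
  by (simp add: J_def)

lemma J_le: "J x y \<le> J0"
  using Gam_le J0_pos by (simp add: J_eq)

lemma J_sym: "J x y = J y x"
  by (auto simp: J_eq Gam_eq dist_commute norm_minus_commute)

lemma J_measurable[measurable]:
  assumes [measurable]: "f \<in> M \<rightarrow>\<^sub>M borel" "g \<in> M \<rightarrow>\<^sub>M borel"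
  shows "(\<lambda>z. J (f z) (g z)) \<in> borel_measurable M"
  unfolding J_eq by measurable

lemma Dstar_mult: "Dstar \<sigma> \<epsilon> u x y * Dstar \<sigma> \<epsilon> v x y = (u y - u x) * (v y - v x) * J x y"
  by (simp add: Dstar_def J_def power2_eq_square algebra_simps)

lemma Dstar_sq: "(Dstar \<sigma> \<epsilon> u x y)\<^sup>2 = (u y - u x)\<^sup>2 * J x y"
  by (simp add: Dstar_def J_def power2_eq_square algebra_simps)

lemma tnorm_sq_eq:
  assumes [measurable]: "u \<in> borel_measurable borel"
  shows "tnorm_sq \<Omega> \<epsilon> \<sigma> u =
    (\<integral>\<^sup>+x. \<integral>\<^sup>+y. indicator W x * (indicator W y * ennreal ((u y - u x)\<^sup>2 * J x y)) \<partial>lborel \<partial>lborel)"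
proof -
  have "tnorm_sq \<Omega> \<epsilon> \<sigma> u = (\<integral>\<^sup>+z. (\<lambda>z. indicator W (fst z) * (indicator W (snd z) *
      ennreal ((u (snd z) - u (fst z))\<^sup>2 * J (fst z) (snd z)))) z \<partial>(lborel \<Otimes>\<^sub>M lborel))"
    unfolding tnorm_sq_def W_def[symmetric] Dstar_sq
    by (intro nn_integral_cong) (auto simp: indicator_def)
  also have "\<dots> = (\<integral>\<^sup>+x. \<integral>\<^sup>+y. indicator W x * (indicator W y * ennreal ((u y - u x)\<^sup>2 * J x y)) \<partial>lborel \<partial>lborel)"
    by (subst lborel.nn_integral_fst[symmetric]) auto
  finally show ?thesis .
qed

lemma tnorm_sq_scale:
  assumes [measurable]: "u \<in> borel_measurable borel"
  shows "tnorm_sq \<Omega> \<epsilon> \<sigma> (\<lambda>x. a * u x) = ennreal (a\<^sup>2) * tnorm_sq \<Omega> \<epsilon> \<sigma> u"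
proof -
  have "indicator W x * (indicator W y * ennreal ((a * u y - a * u x)\<^sup>2 * J x y))
      = ennreal (a\<^sup>2) * (indicator W x * (indicator W y * ennreal ((u y - u x)\<^sup>2 * J x y)))" for x y
    using J_nonneg by (auto simp: indicator_def ennreal_mult[symmetric] right_diff_distrib[symmetric] power_mult_distrib mult.assoc)
  then show ?thesis
    by (simp add: tnorm_sq_eq nn_integral_cmult)
qed

lemma tnorm_sq_le:
  assumes [measurable]: "u \<in> borel_measurable borel"
  shows "tnorm_sq \<Omega> \<epsilon> \<sigma> u \<le> ennreal (2 * J0) * (2 * (emeasure lborel W * (\<integral>\<^sup>+x. indicator W x * ennreal ((u x)\<^sup>2) \<partial>lborel)))"
proof -
  have "tnorm_sq \<Omega> \<epsilon> \<sigma> u \<le> (\<integral>\<^sup>+x. \<integral>\<^sup>+y. ennreal (2 * J0) * (indicator W x * (indicator W y * ennreal ((u y)\<^sup>2))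
      + indicator W y * (indicator W x * ennreal ((u x)\<^sup>2))) \<partial>lborel \<partial>lborel)"
    unfolding tnorm_sq_eq[OF assms]
  proof (intro nn_integral_mono)
    fix x y
    have "(u y - u x)\<^sup>2 \<le> 2 * ((u y)\<^sup>2 + (u x)\<^sup>2)"
      using zero_le_power2[of "u y + u x"] by (simp add: power2_eq_square algebra_simps)
    then have "(u y - u x)\<^sup>2 * J x y \<le> 2 * ((u y)\<^sup>2 + (u x)\<^sup>2) * J0"
      using J_le J_nonneg by (intro mult_mono) auto
    then have "ennreal ((u y - u x)\<^sup>2 * J x y) \<le> ennreal (2 * J0) * (ennreal ((u y)\<^sup>2) + ennreal ((u x)\<^sup>2))"
      using J0_pos by (auto simp: ennreal_mult[symmetric] ennreal_plus[symmetric] algebra_simps simp del: ennreal_plus intro!: ennreal_leI)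
    then show "indicator W x * (indicator W y * ennreal ((u y - u x)\<^sup>2 * J x y)) \<le>
      ennreal (2 * J0) * (indicator W x * (indicator W y * ennreal ((u y)\<^sup>2)) + indicator W y * (indicator W x * ennreal ((u x)\<^sup>2)))"
      by (auto simp: indicator_def)
  qed
  also have "\<dots> = ennreal (2 * J0) * ((\<integral>\<^sup>+x. \<integral>\<^sup>+y. indicator W x * (indicator W y * ennreal ((u y)\<^sup>2)) \<partial>lborel \<partial>lborel)
      + (\<integral>\<^sup>+x. \<integral>\<^sup>+y. indicator W y * (indicator W x * ennreal ((u x)\<^sup>2)) \<partial>lborel \<partial>lborel))"
    by (simp add: nn_integral_cmult nn_integral_add)
  also have "\<dots> = ennreal (2 * J0) * (2 * (emeasure lborel W * (\<integral>\<^sup>+x. indicator W x * ennreal ((u x)\<^sup>2) \<partial>lborel)))"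
  proof -
    let ?I = "\<integral>\<^sup>+x. indicator W x * ennreal ((u x)\<^sup>2) \<partial>lborel"
    have "(\<integral>\<^sup>+x. \<integral>\<^sup>+y. indicator W x * (indicator W y * ennreal ((u y)\<^sup>2)) \<partial>lborel \<partial>lborel)
        = (\<integral>\<^sup>+x. indicator W x * ?I \<partial>lborel)"
      by (intro nn_integral_cong nn_integral_cmult) measurable
    also have "\<dots> = (\<integral>\<^sup>+x. indicator W x \<partial>lborel) * ?I"
      by (rule nn_integral_multc) measurable
    also have "\<dots> = emeasure lborel W * ?I"
      by simp
    finally have 1: "(\<integral>\<^sup>+x. \<integral>\<^sup>+y. indicator W x * (indicator W y * ennreal ((u y)\<^sup>2)) \<partial>lborel \<partial>lborel)
        = emeasure lborel W * ?I" .
    have "(\<integral>\<^sup>+x. \<integral>\<^sup>+y. indicator W y * (indicator W x * ennreal ((u x)\<^sup>2)) \<partial>lborel \<partial>lborel)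
        = (\<integral>\<^sup>+x. (\<integral>\<^sup>+y. indicator W y \<partial>lborel) * (indicator W x * ennreal ((u x)\<^sup>2)) \<partial>lborel)"
      by (intro nn_integral_cong nn_integral_multc) measurable
    also have "\<dots> = (\<integral>\<^sup>+y. indicator W y \<partial>lborel) * ?I"
      by (rule nn_integral_cmult) measurable
    also have "\<dots> = emeasure lborel W * ?I"
      by simp
    finally have 2: "(\<integral>\<^sup>+x. \<integral>\<^sup>+y. indicator W y * (indicator W x * ennreal ((u x)\<^sup>2)) \<partial>lborel \<partial>lborel)
        = emeasure lborel W * ?I" .
    show ?thesis unfolding 1 2 by (simp only: mult_2)
  qed
  finally show ?thesis .
qed

lemma mem_VcI:
  assumes [measurable]: "u \<in> borel_measurable borel"
    and fin: "(\<integral>\<^sup>+x. indicator W x * ennreal ((u x)\<^sup>2) \<partial>lborel) < \<infinity>"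
    and zero: "AE x in lborel. x \<in> OmegaI \<Omega> \<epsilon> \<longrightarrow> u x = 0"
  shows "u \<in> Vc \<Omega> \<epsilon> \<sigma>"
proof -
  have "tnorm_sq \<Omega> \<epsilon> \<sigma> u < \<infinity>"
    by (rule order.strict_trans1[OF tnorm_sq_le[OF assms(1)]])
      (use fin finite_W in \<open>auto simp: ennreal_mult_less_top\<close>)
  then show ?thesis
    using fin zero by (simp add: Vc_def W_def[symmetric])
qed

lemma scaled_indicator_in_Vc:
  assumes [measurable]: "E \<in> sets borel" and "E \<subseteq> \<Omega>"
  shows "(\<lambda>x. a * indicator E x) \<in> Vc \<Omega> \<epsilon> \<sigma>"
proof (rule mem_VcI)
  have "(\<integral>\<^sup>+x. indicator W x * ennreal ((a * indicator E x)\<^sup>2) \<partial>lborel) \<le> (\<integral>\<^sup>+x. ennreal (a\<^sup>2) * indicator W x \<partial>lborel)"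
    by (intro nn_integral_mono) (auto simp: indicator_def)
  also have "\<dots> < \<infinity>"
    using finite_W by (simp add: nn_integral_cmult_indicator ennreal_mult_less_top)
  finally show "(\<integral>\<^sup>+x. indicator W x * ennreal ((a * indicator E x)\<^sup>2) \<partial>lborel) < \<infinity>" .
  show "AE x in lborel. x \<in> OmegaI \<Omega> \<epsilon> \<longrightarrow> a * indicator E x = 0"
    using assms(2) by (auto simp: OmegaI_def indicator_def)
qed measurable

lemma CVc_scaled_indicator:
  assumes [measurable]: "E \<in> sets borel" and "E \<subseteq> \<Omega>" and \<psi>: "continuous_on UNIV \<psi>"
  shows "CVc \<Omega> \<epsilon> \<sigma> T (\<lambda>t x. \<psi> t * indicator E x)"
  unfolding CVc_def
proof (intro conjI ballI scaled_indicator_in_Vc assms)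
  fix t
  let ?i = "indicator E :: 'a \<Rightarrow> real"
  have "(\<lambda>x. \<psi> s * ?i x - \<psi> t * ?i x) = (\<lambda>x. (\<psi> s - \<psi> t) * ?i x)" for s
    by (simp add: algebra_simps)
  then have "tnorm \<Omega> \<epsilon> \<sigma> (\<lambda>x. \<psi> s * ?i x - \<psi> t * ?i x) = sqrt (1/2 * ((\<psi> s - \<psi> t)\<^sup>2 * enn2real (tnorm_sq \<Omega> \<epsilon> \<sigma> ?i)))" for s
    by (simp add: tnorm_def tnorm_sq_scale enn2real_mult)
  moreover have "(\<psi> \<longlongrightarrow> \<psi> t) (at t within {0..T})"
    using continuous_on_subset[OF \<psi>, of "{0..T}"] \<psi>
    by (metis UNIV_I continuous_on_def tendsto_within_subset top_greatest)
  then have "((\<lambda>s. sqrt (1/2 * ((\<psi> s - \<psi> t)\<^sup>2 * enn2real (tnorm_sq \<Omega> \<epsilon> \<sigma> ?i)))) \<longlongrightarrow>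
      sqrt (1/2 * ((\<psi> t - \<psi> t)\<^sup>2 * enn2real (tnorm_sq \<Omega> \<epsilon> \<sigma> ?i)))) (at t within {0..T})"
    by (intro tendsto_intros)
  ultimately show "((\<lambda>s. tnorm \<Omega> \<epsilon> \<sigma> (\<lambda>x. \<psi> s * ?i x - \<psi> t * ?i x)) \<longlongrightarrow> 0) (at t within {0..T})"
    by simp
qed

end

lemma nn_integral_lborel_translate:
  fixes f :: "'a::euclidean_space \<Rightarrow> ennreal"
  assumes [measurable]: "f \<in> borel_measurable borel"
  shows "(\<integral>\<^sup>+x. f (x + a) \<partial>lborel) = (\<integral>\<^sup>+x. f x \<partial>lborel)"
proof -
  have "(\<integral>\<^sup>+x. f x \<partial>lborel) = (\<integral>\<^sup>+x. f x \<partial>(distr lborel borel ((+) a)))"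
    by (simp add: lborel_distr_plus)
  also have "\<dots> = (\<integral>\<^sup>+x. f (x + a) \<partial>lborel)"
    by (subst nn_integral_distr) (auto simp: add.commute)
  finally show ?thesis by simp
qed

context nonlocal_domain
begin

lemma shift_energy_le:
  fixes u :: "'a \<Rightarrow> real"
  assumes [measurable]: "u \<in> borel_measurable borel"
    and zero: "AE x in lborel. x \<in> OmegaI \<Omega> \<epsilon> \<longrightarrow> u x = 0"
  defines "\<rho> \<equiv> \<lambda>x. indicator \<Omega> x * u x"
  shows "(\<integral>\<^sup>+h. indicator (ball 0 \<epsilon>) h * (\<integral>\<^sup>+x. ennreal ((\<rho> (x + h) - \<rho> x)\<^sup>2) \<partial>lborel) \<partial>lborel)
    \<le> ennreal (exp (\<epsilon>\<^sup>2 / (2 * \<sigma>\<^sup>2)) / J0) * tnorm_sq \<Omega> \<epsilon> \<sigma> u"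
proof -
  let ?c = "exp (\<epsilon>\<^sup>2 / (2 * \<sigma>\<^sup>2)) / J0"
  have [measurable]: "\<rho> \<in> borel_measurable borel" "ball (0::'a) \<epsilon> \<in> sets borel"
    unfolding \<rho>_def by simp_all
  have "(\<integral>\<^sup>+h. indicator (ball 0 \<epsilon>) h * (\<integral>\<^sup>+x. ennreal ((\<rho> (x + h) - \<rho> x)\<^sup>2) \<partial>lborel) \<partial>lborel)
      = (\<integral>\<^sup>+h. \<integral>\<^sup>+x. indicator (ball 0 \<epsilon>) h * ennreal ((\<rho> (x + h) - \<rho> x)\<^sup>2) \<partial>lborel \<partial>lborel)"
    by (intro nn_integral_cong nn_integral_cmult[symmetric]) measurable
  also have "\<dots> = (\<integral>\<^sup>+x. \<integral>\<^sup>+h. indicator (ball 0 \<epsilon>) h * ennreal ((\<rho> (x + h) - \<rho> x)\<^sup>2) \<partial>lborel \<partial>lborel)"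
    by (rule lborel_pair.Fubini'[symmetric]) measurable
  also have "\<dots> = (\<integral>\<^sup>+x. \<integral>\<^sup>+y. indicator (ball 0 \<epsilon>) (y - x) * ennreal ((\<rho> y - \<rho> x)\<^sup>2) \<partial>lborel \<partial>lborel)"
  proof (rule nn_integral_cong)
    fix x
    have "(\<lambda>y. indicator (ball 0 \<epsilon>) (y - x) * ennreal ((\<rho> y - \<rho> x)\<^sup>2)) \<in> borel_measurable borel"
      by measurable
    from nn_integral_lborel_translate[OF this, of x]
    show "(\<integral>\<^sup>+h. indicator (ball 0 \<epsilon>) h * ennreal ((\<rho> (x + h) - \<rho> x)\<^sup>2) \<partial>lborel)
      = (\<integral>\<^sup>+y. indicator (ball 0 \<epsilon>) (y - x) * ennreal ((\<rho> y - \<rho> x)\<^sup>2) \<partial>lborel)"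
      by (simp add: add.commute)
  qed
  also have "\<dots> \<le> (\<integral>\<^sup>+x. \<integral>\<^sup>+y. ennreal ?c * (indicator W x * (indicator W y * ennreal ((u y - u x)\<^sup>2 * J x y))) \<partial>lborel \<partial>lborel)"
  proof (rule nn_integral_mono_AE)
    show "AE x in lborel. (\<integral>\<^sup>+y. indicator (ball 0 \<epsilon>) (y - x) * ennreal ((\<rho> y - \<rho> x)\<^sup>2) \<partial>lborel)
      \<le> (\<integral>\<^sup>+y. ennreal ?c * (indicator W x * (indicator W y * ennreal ((u y - u x)\<^sup>2 * J x y))) \<partial>lborel)"
      using zero
    proof eventually_elim
      case (elim x)
      have sph: "AE y in lborel. y \<notin> sphere (0::'a) (norm x)"
      proof (rule AE_not_in)
        have "sphere (0::'a) (norm x) \<in> sets borel" by simp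
        then show "sphere (0::'a) (norm x) \<in> null_sets lborel"
          using negligible_sphere[of 0 "norm x"]
          by (simp add: negligible_iff_null_sets null_sets_completion_iff)
      qed
      show ?case
      proof (rule nn_integral_mono_AE)
        show "AE y in lborel. indicator (ball 0 \<epsilon>) (y - x) * ennreal ((\<rho> y - \<rho> x)\<^sup>2)
          \<le> ennreal ?c * (indicator W x * (indicator W y * ennreal ((u y - u x)\<^sup>2 * J x y)))"
          using zero sph
        proof eventually_elim
          case (elim y)
          note y0 = this
          show ?case
          proof (cases "norm (y - x) < \<epsilon> \<and> (x \<in> \<Omega> \<or> y \<in> \<Omega>)")
            case False
            then have *: "indicator (ball 0 \<epsilon>) (y - x) * ennreal ((\<rho> y - \<rho> x)\<^sup>2) = 0"
              by (auto simp: \<rho>_def indicator_def)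
            show ?thesis unfolding * by simp
          next
            case True
            have inW: "z' \<in> W" if "z \<in> \<Omega>" "norm (z' - z) < \<epsilon>" for z z'
              using that unfolding W_eq by (auto simp: dist_norm norm_minus_commute)
            have W: "x \<in> W" "y \<in> W"
              using True inW[of x y] inW[of y x] Omega_subset_W by (auto simp: norm_minus_commute)
            have "\<rho> x = u x"
              using W(1) \<open>x \<in> OmegaI \<Omega> \<epsilon> \<longrightarrow> u x = 0\<close> by (auto simp: \<rho>_def W_def indicator_def)
            moreover have "\<rho> y = u y"
              using W(2) y0 by (auto simp: \<rho>_def W_def indicator_def)
            moreover have "1 \<le> ?c * J x y"
            proof -
              have "J x y = J0 * exp (- (norm (x - y))\<^sup>2 / (2 * \<sigma>\<^sup>2))"
                using y0 True by (auto simp: J_eq Gam_eq dist_norm norm_minus_commute)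
              moreover have "(norm (x - y))\<^sup>2 \<le> \<epsilon>\<^sup>2"
                using True by (intro power_mono) (auto simp: norm_minus_commute)
              then have "(norm (x - y))\<^sup>2 / (2 * \<sigma>\<^sup>2) \<le> \<epsilon>\<^sup>2 / (2 * \<sigma>\<^sup>2)"
                by (intro divide_right_mono) auto
              then have "1 \<le> exp (\<epsilon>\<^sup>2 / (2 * \<sigma>\<^sup>2)) * exp (- (norm (x - y))\<^sup>2 / (2 * \<sigma>\<^sup>2))"
                by (simp add: exp_add[symmetric])
              ultimately show ?thesis using J0_pos by simp
            qed
            then have "(u y - u x)\<^sup>2 * 1 \<le> (u y - u x)\<^sup>2 * (?c * J x y)"
              by (intro mult_left_mono) auto
            then have "ennreal ((u y - u x)\<^sup>2) \<le> ennreal ?c * ennreal ((u y - u x)\<^sup>2 * J x y)"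
              using J0_pos J_nonneg by (subst ennreal_mult[symmetric]) (auto intro!: ennreal_leI simp: mult_ac)
            ultimately show ?thesis
              using W by (auto simp: indicator_def)
          qed
        qed
      qed
    qed
  qed
  also have "\<dots> = ennreal ?c * tnorm_sq \<Omega> \<epsilon> \<sigma> u"
    unfolding tnorm_sq_eq[OF assms(1)] by (simp add: nn_integral_cmult)
  finally show ?thesis .
qed

lemma shift_chain_le:
  fixes \<rho> :: "'a \<Rightarrow> real"
  assumes [measurable]: "\<rho> \<in> borel_measurable borel"
    and supp: "\<And>x. x \<notin> \<Omega> \<Longrightarrow> \<rho> x = 0"
    and leave: "\<And>x. x \<in> \<Omega> \<Longrightarrow> x + real n *\<^sub>R h \<notin> \<Omega>"
  shows "(\<integral>\<^sup>+x. ennreal ((\<rho> x)\<^sup>2) \<partial>lborel) \<le> ennreal ((real n)\<^sup>2) * (\<integral>\<^sup>+x. ennreal ((\<rho> (x + h) - \<rho> x)\<^sup>2) \<partial>lborel)"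
proof -
  let ?g = "\<lambda>x. ennreal ((\<rho> (x + h) - \<rho> x)\<^sup>2)"
  have "ennreal ((\<rho> x)\<^sup>2) \<le> ennreal (real n) * (\<Sum>j<n. ?g (x + real j *\<^sub>R h))" for x
  proof (cases "x \<in> \<Omega>")
    case True
    have "(\<Sum>j<n. \<rho> (x + real (Suc j) *\<^sub>R h) - \<rho> (x + real j *\<^sub>R h)) = \<rho> (x + real n *\<^sub>R h) - \<rho> x"
      by (subst sum_lessThan_telescope[of "\<lambda>j. \<rho> (x + real j *\<^sub>R h)"]) simp
    also have "\<dots> = - \<rho> x" using leave[OF True] supp by simp
    finally have "(\<rho> x)\<^sup>2 = (\<Sum>j<n. \<rho> (x + real (Suc j) *\<^sub>R h) - \<rho> (x + real j *\<^sub>R h))\<^sup>2" by simp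
    also have "\<dots> \<le> (\<Sum>j<n. (\<rho> (x + real (Suc j) *\<^sub>R h) - \<rho> (x + real j *\<^sub>R h))\<^sup>2) * real (card {..<n})"
      by (rule sum_squared_le_sum_of_squares)
    also have "\<dots> = real n * (\<Sum>j<n. (\<rho> (x + real j *\<^sub>R h + h) - \<rho> (x + real j *\<^sub>R h))\<^sup>2)"
      by (simp add: algebra_simps)
    finally have "ennreal ((\<rho> x)\<^sup>2) \<le> ennreal (real n * (\<Sum>j<n. (\<rho> (x + real j *\<^sub>R h + h) - \<rho> (x + real j *\<^sub>R h))\<^sup>2))"
      by (rule ennreal_leI)
    then show ?thesis
      by (simp add: ennreal_mult sum_nonneg sum_ennreal)
  qed (simp add: supp)
  then have "(\<integral>\<^sup>+x. ennreal ((\<rho> x)\<^sup>2) \<partial>lborel) \<le> (\<integral>\<^sup>+x. ennreal (real n) * (\<Sum>j<n. ?g (x + real j *\<^sub>R h)) \<partial>lborel)"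
    by (intro nn_integral_mono)
  also have "\<dots> = ennreal (real n) * (\<Sum>j<n. \<integral>\<^sup>+x. ?g (x + real j *\<^sub>R h) \<partial>lborel)"
    by (subst nn_integral_cmult, measurable) (subst nn_integral_sum, auto)
  also have "\<dots> = ennreal (real n) * (\<Sum>j<n. \<integral>\<^sup>+x. ?g x \<partial>lborel)"
    by (subst nn_integral_lborel_translate[of ?g]) auto
  also have "\<dots> = ennreal ((real n)\<^sup>2) * (\<integral>\<^sup>+x. ?g x \<partial>lborel)"
    by (simp add: power2_eq_square ennreal_mult mult.assoc ennreal_of_nat_eq_real_of_nat)
  finally show ?thesis .
qed

text \<open>Moving along a vector \<open>h\<close> of length between \<open>\<epsilon>/4\<close> and \<open>\<epsilon>\<close>, every point leaves \<open>\<Omega>\<close> after a bounded number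
  of steps; averaging the telescoping estimate over a ball of such \<open>h\<close> gives the inequality.\<close>
lemma nonlocal_Poincare:
  obtains C where "0 \<le> C" "\<And>u. u \<in> borel_measurable borel \<Longrightarrow> (AE x in lborel. x \<in> OmegaI \<Omega> \<epsilon> \<longrightarrow> u x = 0) \<Longrightarrow>
    (\<integral>\<^sup>+x. indicator \<Omega> x * ennreal ((u x)\<^sup>2) \<partial>lborel) \<le> ennreal C * tnorm_sq \<Omega> \<epsilon> \<sigma> u"
proof -
  obtain R where R: "\<And>x. x \<in> \<Omega> \<Longrightarrow> norm x \<le> R"
    using bounded_Omega by (auto simp: bounded_iff)
  obtain n :: nat where n: "8 * R / \<epsilon> < real n"
    using reals_Archimedean2 by blast
  obtain e :: 'a where e: "e \<in> Basis" using nonempty_Basis by blast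
  define B where "B = ball ((\<epsilon> / 2) *\<^sub>R e) (\<epsilon> / 4)"
  have Bm[measurable]: "B \<in> sets borel" by (simp add: B_def)
  have Bn: "\<epsilon> / 4 < norm h \<and> norm h < \<epsilon>" if "h \<in> B" for h
  proof -
    have "norm ((\<epsilon> / 2) *\<^sub>R e) = \<epsilon> / 2" using e eps by simp
    moreover have "norm ((\<epsilon> / 2) *\<^sub>R e - h) < \<epsilon> / 4" using that by (simp add: B_def dist_norm)
    ultimately show ?thesis
      using norm_triangle_ineq2[of "(\<epsilon> / 2) *\<^sub>R e" h] norm_triangle_ineq2[of h "(\<epsilon> / 2) *\<^sub>R e"] eps
      by (simp add: norm_minus_commute)
  qed
  have leave: "x + real n *\<^sub>R h \<notin> \<Omega>" if "h \<in> B" "x \<in> \<Omega>" for x h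
  proof
    assume "x + real n *\<^sub>R h \<in> \<Omega>"
    from R[OF this] R[OF that(2)] have "norm (real n *\<^sub>R h) \<le> 2 * R"
      using norm_triangle_ineq4[of "x + real n *\<^sub>R h" x] by simp
    then have "real n * norm h \<le> 2 * R" by simp
    moreover have "real n * (\<epsilon> / 4) \<le> real n * norm h"
      using Bn[OF that(1)] by (intro mult_left_mono) auto
    ultimately show False using n eps by (simp add: field_simps)
  qed
  define b where "b = measure lborel B"
  have b: "emeasure lborel B = ennreal b" "0 < b"
    using eps content_ball_pos[of "\<epsilon> / 4" "(\<epsilon> / 2) *\<^sub>R e"] emeasure_bounded_finite[of B]
    by (auto simp: b_def B_def emeasure_eq_ennreal_measure)
  let ?c = "exp (\<epsilon>\<^sup>2 / (2 * \<sigma>\<^sup>2)) / J0"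
  show thesis
  proof (rule that)
    show "0 \<le> (real n)\<^sup>2 * ?c / b" using J0_pos b by simp
    fix u :: "'a \<Rightarrow> real"
    assume u[measurable]: "u \<in> borel_measurable borel" and zero: "AE x in lborel. x \<in> OmegaI \<Omega> \<epsilon> \<longrightarrow> u x = 0"
    define \<rho> where "\<rho> x = indicator \<Omega> x * u x" for x
    have [measurable]: "\<rho> \<in> borel_measurable borel" "ball (0::'a) \<epsilon> \<in> sets borel"
      unfolding \<rho>_def by simp_all
    let ?I = "\<integral>\<^sup>+x. ennreal ((\<rho> x)\<^sup>2) \<partial>lborel"
    have "ennreal b * ?I = (\<integral>\<^sup>+h. indicator B h * ?I \<partial>lborel)"
      by (subst nn_integral_multc) (auto simp: b)
    also have "\<dots> \<le> (\<integral>\<^sup>+h. ennreal ((real n)\<^sup>2) * (indicator (ball 0 \<epsilon>) h * (\<integral>\<^sup>+x. ennreal ((\<rho> (x + h) - \<rho> x)\<^sup>2) \<partial>lborel)) \<partial>lborel)"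
    proof (intro nn_integral_mono)
      fix h
      show "indicator B h * ?I \<le> ennreal ((real n)\<^sup>2) * (indicator (ball 0 \<epsilon>) h * (\<integral>\<^sup>+x. ennreal ((\<rho> (x + h) - \<rho> x)\<^sup>2) \<partial>lborel))"
      proof (cases "h \<in> B")
        case True
        have "?I \<le> ennreal ((real n)\<^sup>2) * (\<integral>\<^sup>+x. ennreal ((\<rho> (x + h) - \<rho> x)\<^sup>2) \<partial>lborel)"
          using leave[OF True] by (intro shift_chain_le) (auto simp: \<rho>_def)
        then show ?thesis using True Bn[OF True] by simp
      qed simp
    qed
    also have "\<dots> = ennreal ((real n)\<^sup>2) * (\<integral>\<^sup>+h. indicator (ball 0 \<epsilon>) h * (\<integral>\<^sup>+x. ennreal ((\<rho> (x + h) - \<rho> x)\<^sup>2) \<partial>lborel) \<partial>lborel)"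
      by (rule nn_integral_cmult) measurable
    also have "\<dots> \<le> ennreal ((real n)\<^sup>2) * (ennreal ?c * tnorm_sq \<Omega> \<epsilon> \<sigma> u)"
      unfolding \<rho>_def by (intro mult_left_mono shift_energy_le u zero) auto
    finally have main: "ennreal b * ?I \<le> ennreal ((real n)\<^sup>2) * (ennreal ?c * tnorm_sq \<Omega> \<epsilon> \<sigma> u)" .
    have "?I = ennreal (1 / b) * (ennreal b * ?I)"
      using b by (simp add: mult.assoc[symmetric] ennreal_mult[symmetric])
    also have "\<dots> \<le> ennreal (1 / b) * (ennreal ((real n)\<^sup>2) * (ennreal ?c * tnorm_sq \<Omega> \<epsilon> \<sigma> u))"
      by (intro mult_left_mono main) simp
    also have "\<dots> = ennreal ((real n)\<^sup>2 * ?c / b) * tnorm_sq \<Omega> \<epsilon> \<sigma> u"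
      using b J0_pos by (simp add: mult.assoc[symmetric] ennreal_mult[symmetric]) (simp add: mult.commute)
    also have "?I = (\<integral>\<^sup>+x. indicator \<Omega> x * ennreal ((u x)\<^sup>2) \<partial>lborel)"
      by (intro nn_integral_cong) (auto simp: \<rho>_def indicator_def)
    finally show "(\<integral>\<^sup>+x. indicator \<Omega> x * ennreal ((u x)\<^sup>2) \<partial>lborel) \<le> ennreal ((real n)\<^sup>2 * ?c / b) * tnorm_sq \<Omega> \<epsilon> \<sigma> u" .
  qed
qed

end

lemma integrable_of_L2:
  assumes [measurable]: "u \<in> borel_measurable borel" "S \<in> sets borel"
    and S: "emeasure lborel S < \<infinity>" and fin: "(\<integral>\<^sup>+x. indicator S x * ennreal ((u x)\<^sup>2) \<partial>lborel) < \<infinity>"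
  shows "integrable lborel (\<lambda>x. indicator S x * (u x)\<^sup>2)" "integrable lborel (\<lambda>x. indicator S x * u x :: real)"
proof -
  have "(\<integral>\<^sup>+x. ennreal (indicator S x * (u x)\<^sup>2) \<partial>lborel) = (\<integral>\<^sup>+x. indicator S x * ennreal ((u x)\<^sup>2) \<partial>lborel)"
    by (intro nn_integral_cong) (auto simp: indicator_def)
  then show 1: "integrable lborel (\<lambda>x. indicator S x * (u x)\<^sup>2)"
    using fin by (intro integrableI_nonneg) auto
  have "integrable lborel (\<lambda>x. indicator S x + indicator S x * (u x)\<^sup>2)"
    using S by (intro Bochner_Integration.integrable_add 1) auto
  then show "integrable lborel (\<lambda>x. indicator S x * u x)"
  proof (rule Bochner_Integration.integrable_bound)
    show "AE x in lborel. norm (indicator S x * u x) \<le> norm (indicator S x + indicator S x * (u x)\<^sup>2)"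
    proof (rule AE_I2)
      fix x
      have "\<bar>u x\<bar> \<le> 1 + (u x)\<^sup>2"
        using zero_le_power2[of "\<bar>u x\<bar> - 1"] by (simp add: power2_eq_square algebra_simps)
      then show "norm (indicator S x * u x) \<le> norm (indicator S x + indicator S x * (u x)\<^sup>2)"
        by (auto simp: indicator_def)
    qed
  qed measurable
qed

context nonlocal_domain
begin

definition NL :: "('a \<Rightarrow> real) \<Rightarrow> 'a \<Rightarrow> real" where
  "NL u x = (\<integral>y. indicator W y * ((u x - u y) * J x y) \<partial>lborel)"

lemma NL_bound:
  assumes [measurable]: "u \<in> borel_measurable borel" and ui: "integrable lborel (\<lambda>x. indicator W x * u x)"
  shows "\<bar>NL u x\<bar> \<le> J0 * measure lborel W * \<bar>u x\<bar> + J0 * (\<integral>y. indicator W y * \<bar>u y\<bar> \<partial>lborel)"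
proof -
  have ui': "integrable lborel (\<lambda>y. indicator W y * \<bar>u y\<bar>)"
    using integrable_abs[OF ui] by (simp add: abs_mult)
  have Wi: "integrable lborel (indicator W :: 'a \<Rightarrow> real)"
    using finite_W by simp
  have bi: "integrable lborel (\<lambda>y. J0 * \<bar>u x\<bar> * indicator W y + J0 * (indicator W y * \<bar>u y\<bar>))"
    by (intro Bochner_Integration.integrable_add integrable_mult_right ui' Wi)
  have "\<bar>NL u x\<bar> \<le> (\<integral>y. \<bar>indicator W y * ((u x - u y) * J x y)\<bar> \<partial>lborel)"
    unfolding NL_def by (rule integral_abs_bound)
  also have "\<dots> \<le> (\<integral>y. J0 * \<bar>u x\<bar> * indicator W y + J0 * (indicator W y * \<bar>u y\<bar>) \<partial>lborel)"
  proof (rule integral_mono')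
    show "\<bar>indicator W y * ((u x - u y) * J x y)\<bar> \<le> J0 * \<bar>u x\<bar> * indicator W y + J0 * (indicator W y * \<bar>u y\<bar>)" for y
    proof (cases "y \<in> W")
      case True
      have "\<bar>u x - u y\<bar> * J x y \<le> (\<bar>u x\<bar> + \<bar>u y\<bar>) * J0"
        using J_le J_nonneg by (intro mult_mono) auto
      then show ?thesis using True J_nonneg[of x y] by (simp add: abs_mult distrib_left distrib_right mult_ac)
    qed simp
    show "0 \<le> J0 * \<bar>u x\<bar> * indicator W y + J0 * (indicator W y * \<bar>u y\<bar>)" for y
      using J0_pos by auto
  qed (rule bi)
  also have "\<dots> = J0 * \<bar>u x\<bar> * measure lborel W + J0 * (\<integral>y. indicator W y * \<bar>u y\<bar> \<partial>lborel)"
    using ui' Wi by simp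
  finally show ?thesis by (simp add: mult_ac)
qed

lemma abil_indicator:
  assumes [measurable]: "u \<in> borel_measurable borel" "E \<in> sets borel" and E: "E \<subseteq> \<Omega>"
    and ui: "integrable lborel (\<lambda>x. indicator W x * u x)"
  shows "abil \<Omega> \<epsilon> \<sigma> \<delta> u (\<lambda>x. a * indicator E x) = a * (\<integral>x. indicator E x * (NL u x + \<delta> * u x) \<partial>lborel)"
proof -
  define A where "A z = indicator W (fst z) * indicator W (snd z) * ((u (fst z) - u (snd z)) * indicator E (fst z) * J (fst z) (snd z))" for z
  have EW: "E \<subseteq> W" using E Omega_subset_W by blast
  have ui': "integrable lborel (\<lambda>y. indicator W y * \<bar>u y\<bar>)"
    using integrable_abs[OF ui] by (simp add: abs_mult)
  have Wi: "integrable lborel (indicator W :: 'a \<Rightarrow> real)"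
    using finite_W by simp
  have Am[measurable]: "A \<in> borel_measurable (lborel \<Otimes>\<^sub>M lborel)"
    unfolding A_def by measurable
  have "integrable (lborel \<Otimes>\<^sub>M lborel) (\<lambda>z. J0 * ((indicator W (fst z) * \<bar>u (fst z)\<bar>) * indicator W (snd z)
      + indicator W (fst z) * (indicator W (snd z) * \<bar>u (snd z)\<bar>)))"
    by (intro integrable_mult_right Bochner_Integration.integrable_add integrable_pair_product ui' Wi)
  then have Ai: "integrable (lborel \<Otimes>\<^sub>M lborel) A"
  proof (rule Bochner_Integration.integrable_bound)
    show "AE z in lborel \<Otimes>\<^sub>M lborel. norm (A z) \<le> norm (J0 * ((indicator W (fst z) * \<bar>u (fst z)\<bar>) * indicator W (snd z)
      + indicator W (fst z) * (indicator W (snd z) * \<bar>u (snd z)\<bar>)))"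
    proof (rule AE_I2)
      fix z :: "'a \<times> 'a"
      obtain x y where z: "z = (x, y)" by fastforce
      have "\<bar>u x - u y\<bar> * J x y \<le> (\<bar>u x\<bar> + \<bar>u y\<bar>) * J0"
        using J_le J_nonneg by (intro mult_mono) auto
      then show "norm (A z) \<le> norm (J0 * ((indicator W (fst z) * \<bar>u (fst z)\<bar>) * indicator W (snd z)
        + indicator W (fst z) * (indicator W (snd z) * \<bar>u (snd z)\<bar>)))"
        using J_nonneg[of x y] J0_pos by (auto simp: A_def z indicator_def abs_mult mult.commute)
    qed
  qed measurable
  have swap: "integrable (lborel \<Otimes>\<^sub>M lborel) (\<lambda>z. A (snd z, fst z))"
    "(\<integral>z. A (snd z, fst z) \<partial>(lborel \<Otimes>\<^sub>M lborel)) = integral\<^sup>L (lborel \<Otimes>\<^sub>M lborel) A"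
    using lborel_pair.integrable_product_swap[OF Ai] lborel_pair.integral_product_swap[OF Am]
    by (simp_all add: case_prod_unfold)
  have inner: "(\<integral>y. A (x, y) \<partial>lborel) = indicator E x * NL u x" for x
  proof -
    have "A (x, y) = indicator E x * (indicator W y * ((u x - u y) * J x y))" for y
      using EW by (auto simp: A_def indicator_def)
    then show ?thesis by (simp add: NL_def)
  qed
  have IA: "integral\<^sup>L (lborel \<Otimes>\<^sub>M lborel) A = (\<integral>x. indicator E x * NL u x \<partial>lborel)"
    using lborel_pair.integral_fst'[OF Ai] by (simp add: inner)
  have IAi: "integrable lborel (\<lambda>x. indicator E x * NL u x)"
    using lborel_pair.integrable_fst'[OF Ai] by (simp add: inner)
  have "integrable lborel (\<lambda>x. indicator E x *\<^sub>R (indicator W x * u x))"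
    by (rule integrable_mult_indicator[OF _ ui]) simp
  moreover have "indicator E x *\<^sub>R (indicator W x * u x) = indicator E x * u x" for x
    using EW by (auto simp: indicator_def)
  ultimately have Eu: "integrable lborel (\<lambda>x. indicator E x * u x)"
    by (simp only:)
  have "(\<integral>z. indicator (W \<times> W) z * (Dstar \<sigma> \<epsilon> u (fst z) (snd z) * Dstar \<sigma> \<epsilon> (\<lambda>x. a * indicator E x) (fst z) (snd z)) \<partial>(lborel \<Otimes>\<^sub>M lborel))
      = (\<integral>z. a * (A z + A (snd z, fst z)) \<partial>(lborel \<Otimes>\<^sub>M lborel))"
  proof (intro Bochner_Integration.integral_cong refl)
    fix z :: "'a \<times> 'a"
    obtain x y where z: "z = (x, y)" by fastforce
    show "indicator (W \<times> W) z * (Dstar \<sigma> \<epsilon> u (fst z) (snd z) * Dstar \<sigma> \<epsilon> (\<lambda>x. a * indicator E x) (fst z) (snd z))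
      = a * (A z + A (snd z, fst z))"
      unfolding Dstar_mult z A_def using J_sym[of y x]
      by (cases "x \<in> W"; cases "y \<in> W") (auto simp: algebra_simps)
  qed
  also have "\<dots> = a * (2 * (\<integral>x. indicator E x * NL u x \<partial>lborel))"
    using Ai swap by (simp add: IA)
  finally have 1: "(\<integral>z. indicator (W \<times> W) z * (Dstar \<sigma> \<epsilon> u (fst z) (snd z) * Dstar \<sigma> \<epsilon> (\<lambda>x. a * indicator E x) (fst z) (snd z)) \<partial>(lborel \<Otimes>\<^sub>M lborel))
    = a * (2 * (\<integral>x. indicator E x * NL u x \<partial>lborel))" .
  have 2: "(\<integral>x. indicator \<Omega> x * (u x * (a * indicator E x)) \<partial>lborel) = a * (\<integral>x. indicator E x * u x \<partial>lborel)"
  proof -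
    have "indicator \<Omega> x * (u x * (a * indicator E x)) = a * (indicator E x * u x)" for x
      using E by (auto simp: indicator_def)
    then show ?thesis by (simp only: integral_mult_right_zero)
  qed
  have 3: "(\<integral>x. indicator E x * (NL u x + \<delta> * u x) \<partial>lborel)
      = (\<integral>x. indicator E x * NL u x \<partial>lborel) + \<delta> * (\<integral>x. indicator E x * u x \<partial>lborel)"
  proof -
    have "(\<integral>x. indicator E x * (NL u x + \<delta> * u x) \<partial>lborel) = (\<integral>x. indicator E x * NL u x + \<delta> * (indicator E x * u x) \<partial>lborel)"
      by (simp add: algebra_simps)
    also have "\<dots> = (\<integral>x. indicator E x * NL u x \<partial>lborel) + \<delta> * (\<integral>x. indicator E x * u x \<partial>lborel)"
      using IAi Eu by simp
    finally show ?thesis .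
  qed
  show ?thesis
    unfolding abil_def W_def[symmetric] 1 2 3 by (simp add: algebra_simps)
qed

end

lemma square_sum_le: "((a::real) + b)\<^sup>2 \<le> 2 * (a\<^sup>2 + b\<^sup>2)"
  using zero_le_power2[of "a - b"] by (simp add: power2_eq_square algebra_simps)

lemma abs_le_add_square_div:
  fixes e \<eta> :: real
  assumes "0 < \<eta>"
  shows "\<bar>e\<bar> \<le> \<eta> + (1 / \<eta>) * e\<^sup>2"
proof -
  have "0 \<le> (\<bar>e\<bar> - \<eta>)\<^sup>2" "0 \<le> \<bar>e\<bar> * \<eta>" using assms by auto
  then have "\<bar>e\<bar> * \<eta> \<le> \<eta>\<^sup>2 + e\<^sup>2"
    by (simp add: power2_eq_square algebra_simps)
  then show ?thesis using assms by (simp add: field_simps power2_eq_square)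
qed

lemma nn_L2_sum_le:
  assumes [measurable]: "u \<in> borel_measurable borel" "v \<in> borel_measurable borel" "S \<in> sets borel"
  shows "(\<integral>\<^sup>+x. indicator S x * ennreal ((u x + v x :: real)\<^sup>2) \<partial>lborel)
    \<le> 2 * ((\<integral>\<^sup>+x. indicator S x * ennreal ((u x)\<^sup>2) \<partial>lborel) + (\<integral>\<^sup>+x. indicator S x * ennreal ((v x)\<^sup>2) \<partial>lborel))"
proof -
  have "(\<integral>\<^sup>+x. indicator S x * ennreal ((u x + v x)\<^sup>2) \<partial>lborel)
      \<le> (\<integral>\<^sup>+x. 2 * (indicator S x * ennreal ((u x)\<^sup>2) + indicator S x * ennreal ((v x)\<^sup>2)) \<partial>lborel)"
  proof (rule nn_integral_mono)
    fix x
    have "ennreal ((u x + v x)\<^sup>2) \<le> ennreal (2 * ((u x)\<^sup>2 + (v x)\<^sup>2))"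
      by (intro ennreal_leI square_sum_le)
    also have "\<dots> = 2 * (ennreal ((u x)\<^sup>2) + ennreal ((v x)\<^sup>2))"
      by (simp add: ennreal_mult)
    finally show "indicator S x * ennreal ((u x + v x)\<^sup>2)
      \<le> 2 * (indicator S x * ennreal ((u x)\<^sup>2) + indicator S x * ennreal ((v x)\<^sup>2))"
      by (cases "x \<in> S") auto
  qed
  also have "\<dots> = 2 * ((\<integral>\<^sup>+x. indicator S x * ennreal ((u x)\<^sup>2) \<partial>lborel) + (\<integral>\<^sup>+x. indicator S x * ennreal ((v x)\<^sup>2) \<partial>lborel))"
    by (simp add: nn_integral_cmult nn_integral_add)
  finally show ?thesis .
qed

context nonlocal_domain
begin

lemma Vc_zero_AE: "u \<in> Vc \<Omega> \<epsilon> \<sigma> \<Longrightarrow> AE x in lborel. x \<in> OmegaI \<Omega> \<epsilon> \<longrightarrow> u x = 0"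
  by (simp add: Vc_def)

lemma Vc_L2: "u \<in> Vc \<Omega> \<epsilon> \<sigma> \<Longrightarrow> (\<integral>\<^sup>+x. indicator W x * ennreal ((u x)\<^sup>2) \<partial>lborel) < \<infinity>"
  by (simp add: Vc_def W_def)

lemma Vc_diff:
  assumes [measurable]: "u \<in> borel_measurable borel" "v \<in> borel_measurable borel"
    and u: "u \<in> Vc \<Omega> \<epsilon> \<sigma>" and v: "v \<in> Vc \<Omega> \<epsilon> \<sigma>"
  shows "(\<lambda>x. u x - v x) \<in> Vc \<Omega> \<epsilon> \<sigma>"
proof (rule mem_VcI)
  have "(\<integral>\<^sup>+x. indicator W x * ennreal ((u x + - v x)\<^sup>2) \<partial>lborel)
      \<le> 2 * ((\<integral>\<^sup>+x. indicator W x * ennreal ((u x)\<^sup>2) \<partial>lborel) + (\<integral>\<^sup>+x. indicator W x * ennreal ((- v x)\<^sup>2) \<partial>lborel))"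
    by (rule nn_L2_sum_le) measurable
  also have "\<dots> < \<infinity>"
    using Vc_L2[OF u] Vc_L2[OF v] by (simp add: ennreal_mult_less_top)
  finally show "(\<integral>\<^sup>+x. indicator W x * ennreal ((u x - v x)\<^sup>2) \<partial>lborel) < \<infinity>" by simp
  show "AE x in lborel. x \<in> OmegaI \<Omega> \<epsilon> \<longrightarrow> u x - v x = 0"
    using Vc_zero_AE[OF u] Vc_zero_AE[OF v] by eventually_elim simp
qed measurable

lemma L2_dist_le_tnorm:
  obtains C where "0 \<le> C" "\<And>u v. u \<in> borel_measurable borel \<Longrightarrow> v \<in> borel_measurable borel \<Longrightarrow>
    u \<in> Vc \<Omega> \<epsilon> \<sigma> \<Longrightarrow> v \<in> Vc \<Omega> \<epsilon> \<sigma> \<Longrightarrow>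
    (\<integral>\<^sup>+x. indicator \<Omega> x * ennreal ((u x - v x)\<^sup>2) \<partial>lborel) \<le> ennreal (C * (tnorm \<Omega> \<epsilon> \<sigma> (\<lambda>x. u x - v x))\<^sup>2)"
proof (rule nonlocal_Poincare)
  fix C assume C: "0 \<le> C" and P: "\<And>u. u \<in> borel_measurable borel \<Longrightarrow> (AE x in lborel. x \<in> OmegaI \<Omega> \<epsilon> \<longrightarrow> u x = 0) \<Longrightarrow>
    (\<integral>\<^sup>+x. indicator \<Omega> x * ennreal ((u x)\<^sup>2) \<partial>lborel) \<le> ennreal C * tnorm_sq \<Omega> \<epsilon> \<sigma> u"
  show thesis
  proof (rule that[of "2 * C"])
    show "0 \<le> 2 * C" using C by simp
    fix u v assume uv[measurable]: "u \<in> borel_measurable borel" "v \<in> borel_measurable borel"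
      and V: "u \<in> Vc \<Omega> \<epsilon> \<sigma>" "v \<in> Vc \<Omega> \<epsilon> \<sigma>"
    let ?d = "\<lambda>x. u x - v x"
    have d: "?d \<in> Vc \<Omega> \<epsilon> \<sigma>" by (rule Vc_diff[OF uv V])
    then have "tnorm_sq \<Omega> \<epsilon> \<sigma> ?d < \<infinity>" by (simp add: Vc_def)
    then have "tnorm_sq \<Omega> \<epsilon> \<sigma> ?d = ennreal (enn2real (tnorm_sq \<Omega> \<epsilon> \<sigma> ?d))" by simp
    also have "enn2real (tnorm_sq \<Omega> \<epsilon> \<sigma> ?d) = 2 * (tnorm \<Omega> \<epsilon> \<sigma> ?d)\<^sup>2"
      by (simp add: tnorm_def)
    finally have "ennreal C * tnorm_sq \<Omega> \<epsilon> \<sigma> ?d = ennreal (2 * C * (tnorm \<Omega> \<epsilon> \<sigma> ?d)\<^sup>2)"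
      using C by (simp add: ennreal_mult[symmetric] mult_ac)
    then show "(\<integral>\<^sup>+x. indicator \<Omega> x * ennreal ((u x - v x)\<^sup>2) \<partial>lborel) \<le> ennreal (2 * C * (tnorm \<Omega> \<epsilon> \<sigma> ?d)\<^sup>2)"
      using P[OF _ Vc_zero_AE[OF d]] by simp
  qed
qed

lemma CVc_L2_bounded:
  fixes k :: "real \<Rightarrow> 'a \<Rightarrow> real"
  assumes km[measurable]: "\<And>t. k t \<in> borel_measurable borel" and k: "CVc \<Omega> \<epsilon> \<sigma> T k" and T: "0 \<le> T"
  obtains B where "0 \<le> B" "\<And>t. t \<in> {0..T} \<Longrightarrow> (\<integral>\<^sup>+x. indicator \<Omega> x * ennreal ((k t x)\<^sup>2) \<partial>lborel) \<le> ennreal B"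
proof (rule L2_dist_le_tnorm)
  fix C assume C: "0 \<le> C" and P: "\<And>u v. u \<in> borel_measurable borel \<Longrightarrow> v \<in> borel_measurable borel \<Longrightarrow>
    u \<in> Vc \<Omega> \<epsilon> \<sigma> \<Longrightarrow> v \<in> Vc \<Omega> \<epsilon> \<sigma> \<Longrightarrow>
    (\<integral>\<^sup>+x. indicator \<Omega> x * ennreal ((u x - v x)\<^sup>2) \<partial>lborel) \<le> ennreal (C * (tnorm \<Omega> \<epsilon> \<sigma> (\<lambda>x. u x - v x))\<^sup>2)"
  have V: "k t \<in> Vc \<Omega> \<epsilon> \<sigma>" if "t \<in> {0..T}" for t using k that by (simp add: CVc_def)
  define n where "n t = (\<integral>\<^sup>+x. indicator \<Omega> x * ennreal ((k t x)\<^sup>2) \<partial>lborel)" for t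
  define Q where "Q a b \<longleftrightarrow> (\<exists>B\<ge>0. \<forall>t\<in>{a..b} \<inter> {0..T}. n t \<le> ennreal B)" for a b
  have "Q 0 T"
    using T
  proof (induction rule: Bolzano)
    case (trans a b c)
    then obtain B1 B2 where B: "0 \<le> B1" "0 \<le> B2" "\<forall>t\<in>{a..b} \<inter> {0..T}. n t \<le> ennreal B1" "\<forall>t\<in>{b..c} \<inter> {0..T}. n t \<le> ennreal B2"
      by (auto simp: Q_def)
    have "n t \<le> ennreal (max B1 B2)" if t: "t \<in> {a..c} \<inter> {0..T}" for t
    proof (cases "t \<le> b")
      case True
      then have "n t \<le> ennreal B1" using B t by auto
      also have "\<dots> \<le> ennreal (max B1 B2)" by (intro ennreal_leI) simp
      finally show ?thesis .
    next
      case False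
      then have "n t \<le> ennreal B2" using B t by auto
      also have "\<dots> \<le> ennreal (max B1 B2)" by (intro ennreal_leI) simp
      finally show ?thesis .
    qed
    then show ?case unfolding Q_def using B by (intro exI[of _ "max B1 B2"]) auto
  next
    case (local x)
    then have x: "x \<in> {0..T}" by simp
    then have "((\<lambda>s. tnorm \<Omega> \<epsilon> \<sigma> (\<lambda>y. k s y - k x y)) \<longlongrightarrow> 0) (at x within {0..T})"
      using k by (simp add: CVc_def)
    then have "\<forall>\<^sub>F s in at x within {0..T}. tnorm \<Omega> \<epsilon> \<sigma> (\<lambda>y. k s y - k x y) < 1"
      by (rule order_tendstoD) simp
    then obtain d where d: "d > 0" "\<And>s. s \<in> {0..T} \<Longrightarrow> s \<noteq> x \<Longrightarrow> dist s x < d \<Longrightarrow> tnorm \<Omega> \<epsilon> \<sigma> (\<lambda>y. k s y - k x y) < 1"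
      by (auto simp: eventually_at)
    have "n x \<le> (\<integral>\<^sup>+y. indicator W y * ennreal ((k x y)\<^sup>2) \<partial>lborel)"
      unfolding n_def using Omega_subset_W by (intro nn_integral_mono) (auto simp: indicator_def)
    also have "\<dots> < \<infinity>" by (rule Vc_L2[OF V[OF x]])
    finally obtain b where b: "n x = ennreal b" "0 \<le> b"
      by (cases "n x") auto
    have bound: "n s \<le> ennreal (2 * (C + b))" if s: "s \<in> {0..T}" "dist s x < d" for s
    proof (cases "s = x")
      case True
      then show ?thesis unfolding True b(1) using b C by (intro ennreal_leI) simp
    next
      case False
      then have t1: "tnorm \<Omega> \<epsilon> \<sigma> (\<lambda>y. k s y - k x y) < 1" using d s by simp
      have t0: "0 \<le> tnorm \<Omega> \<epsilon> \<sigma> (\<lambda>y. k s y - k x y)" by (simp add: tnorm_def)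
      have "(tnorm \<Omega> \<epsilon> \<sigma> (\<lambda>y. k s y - k x y))\<^sup>2 \<le> 1"
        using t0 t1 by (simp add: power_le_one)
      then have "C * (tnorm \<Omega> \<epsilon> \<sigma> (\<lambda>y. k s y - k x y))\<^sup>2 \<le> C"
        using C by (simp add: mult_left_le)
      then have dd: "(\<integral>\<^sup>+y. indicator \<Omega> y * ennreal ((k s y - k x y)\<^sup>2) \<partial>lborel) \<le> ennreal C"
        using P[OF km km V[OF s(1)] V[OF x]] by (meson ennreal_leI order_trans)
      have "n s = (\<integral>\<^sup>+y. indicator \<Omega> y * ennreal (((k s y - k x y) + k x y)\<^sup>2) \<partial>lborel)"
        by (simp add: n_def)
      also have "\<dots> \<le> 2 * ((\<integral>\<^sup>+y. indicator \<Omega> y * ennreal ((k s y - k x y)\<^sup>2) \<partial>lborel) + n x)"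
        unfolding n_def by (rule nn_L2_sum_le) measurable
      also have "\<dots> \<le> 2 * (ennreal C + ennreal b)"
        using dd b by (intro mult_left_mono add_mono) auto
      also have "\<dots> = ennreal (2 * (C + b))"
        using C b by (simp add: ennreal_mult)
      finally show ?thesis .
    qed
    show ?case
    proof (intro exI[of _ d] conjI allI impI d(1))
      fix a b' assume ab: "a \<le> x \<and> x \<le> b' \<and> b' - a < d"
      have "\<forall>t\<in>{a..b'} \<inter> {0..T}. n t \<le> ennreal (2 * (C + b))"
      proof
        fix t assume "t \<in> {a..b'} \<inter> {0..T}"
        then show "n t \<le> ennreal (2 * (C + b))"
          using ab by (intro bound) (auto simp: dist_real_def)
      qed
      then show "Q a b'" unfolding Q_def using C b by (intro exI[of _ "2 * (C + b)"]) auto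
    qed
  qed
  then show thesis using that by (auto simp: Q_def n_def)
qed

lemma CVc_continuous_integral:
  fixes k :: "real \<Rightarrow> 'a \<Rightarrow> real"
  assumes km[measurable]: "\<And>t. k t \<in> borel_measurable borel" and k: "CVc \<Omega> \<epsilon> \<sigma> T k"
    and [measurable]: "E \<in> sets borel" and E: "E \<subseteq> \<Omega>"
  shows "continuous_on {0..T} (\<lambda>t. \<integral>x. indicator E x * k t x \<partial>lborel)"
proof (rule L2_dist_le_tnorm)
  fix C assume C: "0 \<le> C" and P: "\<And>u v. u \<in> borel_measurable borel \<Longrightarrow> v \<in> borel_measurable borel \<Longrightarrow>
    u \<in> Vc \<Omega> \<epsilon> \<sigma> \<Longrightarrow> v \<in> Vc \<Omega> \<epsilon> \<sigma> \<Longrightarrow>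
    (\<integral>\<^sup>+x. indicator \<Omega> x * ennreal ((u x - v x)\<^sup>2) \<partial>lborel) \<le> ennreal (C * (tnorm \<Omega> \<epsilon> \<sigma> (\<lambda>x. u x - v x))\<^sup>2)"
  have V: "k t \<in> Vc \<Omega> \<epsilon> \<sigma>" if "t \<in> {0..T}" for t using k that by (simp add: CVc_def)
  have L2: "(\<integral>\<^sup>+x. indicator S x * ennreal ((k t x)\<^sup>2) \<partial>lborel) < \<infinity>" if "t \<in> {0..T}" "S \<subseteq> W" for t S
  proof -
    have "(\<integral>\<^sup>+x. indicator S x * ennreal ((k t x)\<^sup>2) \<partial>lborel) \<le> (\<integral>\<^sup>+y. indicator W y * ennreal ((k t y)\<^sup>2) \<partial>lborel)"
      using that by (intro nn_integral_mono) (auto simp: indicator_def)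
    also have "\<dots> < \<infinity>" by (rule Vc_L2[OF V[OF that(1)]])
    finally show ?thesis .
  qed
  have EW: "E \<subseteq> W" using E Omega_subset_W by blast
  have Efin: "emeasure lborel E < \<infinity>"
    using bounded_subset[OF bounded_Omega E] by (rule emeasure_bounded_finite)
  have ki: "integrable lborel (\<lambda>x. indicator E x * k t x)" if "t \<in> {0..T}" for t
    by (rule integrable_of_L2(2)[OF km _ Efin L2[OF that EW]]) measurable
  let ?\<tau> = "\<lambda>s t. tnorm \<Omega> \<epsilon> \<sigma> (\<lambda>x. k s x - k t x)"
  have bound: "\<bar>(\<integral>x. indicator E x * k s x \<partial>lborel) - (\<integral>x. indicator E x * k t x \<partial>lborel)\<bar>
      \<le> (?\<tau> s t + \<bar>s - t\<bar>) * (measure lborel \<Omega> + C)" if st: "s \<in> {0..T}" "t \<in> {0..T}" "s \<noteq> t" for s t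
  proof -
    define \<eta> where "\<eta> = ?\<tau> s t + \<bar>s - t\<bar>"
    have t0: "0 \<le> ?\<tau> s t" by (simp add: tnorm_def)
    have \<eta>: "0 < \<eta>" "?\<tau> s t \<le> \<eta>" using st t0 by (auto simp: \<eta>_def)
    let ?d = "\<lambda>x. k s x - k t x"
    have dle: "(\<integral>\<^sup>+x. indicator \<Omega> x * ennreal ((?d x)\<^sup>2) \<partial>lborel) \<le> ennreal (C * (?\<tau> s t)\<^sup>2)"
      by (rule P[OF km km V[OF st(1)] V[OF st(2)]])
    then have dfin: "(\<integral>\<^sup>+x. indicator \<Omega> x * ennreal ((?d x)\<^sup>2) \<partial>lborel) < \<infinity>"
      by (rule order.strict_trans1) simp
    have di: "integrable lborel (\<lambda>x. indicator \<Omega> x * (?d x)\<^sup>2)"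
      by (rule integrable_of_L2(1)[OF _ _ finite_Omega dfin]) measurable
    have "ennreal (\<integral>x. indicator \<Omega> x * (?d x)\<^sup>2 \<partial>lborel) = (\<integral>\<^sup>+x. ennreal (indicator \<Omega> x * (?d x)\<^sup>2) \<partial>lborel)"
      by (rule nn_integral_eq_integral[OF di, symmetric]) simp
    also have "\<dots> = (\<integral>\<^sup>+x. indicator \<Omega> x * ennreal ((?d x)\<^sup>2) \<partial>lborel)"
      by (intro nn_integral_cong) (auto simp: indicator_def)
    also have "\<dots> \<le> ennreal (C * (?\<tau> s t)\<^sup>2)" by (rule dle)
    finally have "(\<integral>x. indicator \<Omega> x * (?d x)\<^sup>2 \<partial>lborel) \<le> C * (?\<tau> s t)\<^sup>2"
      using C by (simp add: ennreal_le_iff)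
    also have "\<dots> \<le> C * \<eta>\<^sup>2"
      using C \<eta> t0 by (intro mult_left_mono power_mono) auto
    finally have D: "(\<integral>x. indicator \<Omega> x * (?d x)\<^sup>2 \<partial>lborel) \<le> C * \<eta>\<^sup>2" .
    have "\<bar>(\<integral>x. indicator E x * k s x \<partial>lborel) - (\<integral>x. indicator E x * k t x \<partial>lborel)\<bar>
        = \<bar>\<integral>x. indicator E x * k s x - indicator E x * k t x \<partial>lborel\<bar>"
      using ki st by simp
    also have "\<dots> \<le> (\<integral>x. \<bar>indicator E x * k s x - indicator E x * k t x\<bar> \<partial>lborel)"
      by (rule integral_abs_bound)
    also have "\<dots> \<le> (\<integral>x. \<eta> * indicator \<Omega> x + (1 / \<eta>) * (indicator \<Omega> x * (?d x)\<^sup>2) \<partial>lborel)"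
    proof (rule integral_mono')
      show "integrable lborel (\<lambda>x. \<eta> * indicator \<Omega> x + (1 / \<eta>) * (indicator \<Omega> x * (?d x)\<^sup>2))"
        using finite_Omega di by (intro Bochner_Integration.integrable_add integrable_mult_right) auto
      fix x
      have "\<bar>?d x\<bar> \<le> \<eta> + (1 / \<eta>) * (?d x)\<^sup>2"
        by (rule abs_le_add_square_div[OF \<eta>(1)])
      then show "\<bar>indicator E x * k s x - indicator E x * k t x\<bar> \<le> \<eta> * indicator \<Omega> x + (1 / \<eta>) * (indicator \<Omega> x * (?d x)\<^sup>2)"
        using E \<eta>(1) by (auto simp: indicator_def)
      show "0 \<le> \<eta> * indicator \<Omega> x + (1 / \<eta>) * (indicator \<Omega> x * (?d x)\<^sup>2)"
        using \<eta>(1) by simp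
    qed
    also have "\<dots> = \<eta> * measure lborel \<Omega> + (1 / \<eta>) * (\<integral>x. indicator \<Omega> x * (?d x)\<^sup>2 \<partial>lborel)"
      using finite_Omega di by simp
    also have "\<dots> \<le> \<eta> * measure lborel \<Omega> + (1 / \<eta>) * (C * \<eta>\<^sup>2)"
      using D \<eta>(1) by (intro add_left_mono mult_left_mono) auto
    also have "\<dots> = \<eta> * (measure lborel \<Omega> + C)"
      using \<eta>(1) by (simp add: power2_eq_square algebra_simps)
    finally show ?thesis by (simp add: \<eta>_def)
  qed
  show ?thesis
    unfolding continuous_on_def
  proof
    fix t assume t: "t \<in> {0..T}"
    let ?G = "\<lambda>s. \<integral>x. indicator E x * k s x \<partial>lborel"
    have "((\<lambda>s. ?\<tau> s t) \<longlongrightarrow> 0) (at t within {0..T})" using k t by (simp add: CVc_def)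
    then have "((\<lambda>s. (?\<tau> s t + \<bar>s - t\<bar>) * (measure lborel \<Omega> + C)) \<longlongrightarrow> (0 + \<bar>t - t\<bar>) * (measure lborel \<Omega> + C)) (at t within {0..T})"
      by (intro tendsto_intros)
    then have lim: "((\<lambda>s. (?\<tau> s t + \<bar>s - t\<bar>) * (measure lborel \<Omega> + C)) \<longlongrightarrow> 0) (at t within {0..T})"
      by simp
    have "\<forall>\<^sub>F s in at t within {0..T}. s \<in> {0..T} \<and> s \<noteq> t"
      by (auto simp: eventually_at_filter)
    then have "\<forall>\<^sub>F s in at t within {0..T}. norm (?G s - ?G t) \<le> (?\<tau> s t + \<bar>s - t\<bar>) * (measure lborel \<Omega> + C)"
      by eventually_elim (use bound t in auto)
    then have "((\<lambda>s. ?G s - ?G t) \<longlongrightarrow> 0) (at t within {0..T})"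
      by (rule Lim_null_comparison[OF _ lim])
    then show "(?G \<longlongrightarrow> ?G t) (at t within {0..T})"
      by (rule LIM_zero_cancel)
  qed
qed

end

section \<open>Boundedness of solutions\<close>

lemma jointly_measurableD:
  assumes jm: "jointly_measurable k" and [measurable]: "f \<in> M \<rightarrow>\<^sub>M borel" "g \<in> M \<rightarrow>\<^sub>M borel"
  shows "(\<lambda>z. k (f z) (g z)) \<in> borel_measurable M"
proof -
  have "(\<lambda>z. (g z, f z)) \<in> M \<rightarrow>\<^sub>M lborel \<Otimes>\<^sub>M lborel" by measurable
  from measurable_compose[OF this jm[unfolded jointly_measurable_def]] show ?thesis by simp
qed

lemma Fubini_slab:
  fixes h :: "'a::euclidean_space \<Rightarrow> real \<Rightarrow> real"
  assumes hi: "integrable (lborel \<Otimes>\<^sub>M lborel) (\<lambda>z. indicator \<Omega> (fst z) * indicator {0..T} (snd z) * h (fst z) (snd z))"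
    and [measurable]: "E \<in> sets borel" and E: "E \<subseteq> \<Omega>" and S: "S \<in> sets borel" "S \<subseteq> {0..T}"
  shows "integrable lborel (\<lambda>r. indicator S r * (\<integral>x. indicator E x * h x r \<partial>lborel))"
    "integrable lborel (\<lambda>x. indicator E x * (\<integral>r. indicator S r * h x r \<partial>lborel))"
    "(\<integral>r. indicator S r * (\<integral>x. indicator E x * h x r \<partial>lborel) \<partial>lborel)
      = (\<integral>x. indicator E x * (\<integral>r. indicator S r * h x r \<partial>lborel) \<partial>lborel)"
proof -
  have [measurable]: "S \<in> sets borel" by fact
  define g where "g z = indicator E (fst z) * (indicator S (snd z) * h (fst z) (snd z))" for z
  have "E \<times> S \<in> sets (lborel \<Otimes>\<^sub>M lborel)" by measurable
  from integrable_mult_indicator[OF this hi]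
  have gi: "integrable (lborel \<Otimes>\<^sub>M lborel) g"
  proof (rule Bochner_Integration.integrable_cong[THEN iffD1, rotated 2])
    fix z :: "'a \<times> real"
    show "indicator (E \<times> S) z *\<^sub>R (indicator \<Omega> (fst z) * indicator {0..T} (snd z) * h (fst z) (snd z)) = g z"
      using E S by (cases z) (auto simp: g_def indicator_def)
  qed simp
  have 1: "(\<integral>r. g (x, r) \<partial>lborel) = indicator E x * (\<integral>r. indicator S r * h x r \<partial>lborel)" for x
    by (simp add: g_def)
  have 2: "(\<integral>x. g (x, r) \<partial>lborel) = indicator S r * (\<integral>x. indicator E x * h x r \<partial>lborel)" for r
  proof -
    have "g (x, r) = indicator S r * (indicator E x * h x r)" for x by (simp add: g_def)
    then show ?thesis by simp
  qed
  have gi': "integrable (lborel \<Otimes>\<^sub>M lborel) (\<lambda>(x, r). g (x, r))" using gi by simp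
  show "integrable lborel (\<lambda>x. indicator E x * (\<integral>r. indicator S r * h x r \<partial>lborel))"
    using lborel_pair.integrable_fst'[OF gi] by (simp add: 1)
  show "integrable lborel (\<lambda>r. indicator S r * (\<integral>x. indicator E x * h x r \<partial>lborel))"
    using lborel_pair.integrable_snd[of "\<lambda>x r. g (x, r)"] gi' by (simp add: 2)
  show "(\<integral>r. indicator S r * (\<integral>x. indicator E x * h x r \<partial>lborel) \<partial>lborel)
      = (\<integral>x. indicator E x * (\<integral>r. indicator S r * h x r \<partial>lborel) \<partial>lborel)"
    using lborel_pair.Fubini_integral[OF gi'] by (simp add: 1 2)
qed

context nonlocal_domain
begin

lemma NL_measurable[measurable]:
  assumes jm: "jointly_measurable k" and [measurable]: "f \<in> M \<rightarrow>\<^sub>M borel" "g \<in> M \<rightarrow>\<^sub>M borel"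
  shows "(\<lambda>z. NL (k (f z)) (g z)) \<in> borel_measurable M"
proof -
  note jointly_measurableD[OF jm, measurable]
  show ?thesis unfolding NL_def by measurable
qed

lemma Phi_measurable:
  assumes jm: "jointly_measurable k" and [measurable]: "f \<in> M \<rightarrow>\<^sub>M borel" "g \<in> M \<rightarrow>\<^sub>M borel" "\<phi> \<in> borel_measurable borel"
  shows "(\<lambda>z. Phi \<Omega> \<epsilon> \<sigma> \<phi> \<nu> k (g z) (f z)) \<in> borel_measurable M"
proof -
  note jointly_measurableD[OF jm, measurable]
  show ?thesis unfolding Phi_def W_def[symmetric] by measurable
qed

lemma CVc_L1_bounded:
  assumes km[measurable]: "\<And>t. k t \<in> borel_measurable borel" and k: "CVc \<Omega> \<epsilon> \<sigma> T k" and T: "0 \<le> T"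
  obtains C where "0 \<le> C" "\<forall>t\<in>{0..T}. integrable lborel (\<lambda>x. indicator W x * k t x)
    \<and> (\<integral>x. indicator W x * \<bar>k t x\<bar> \<partial>lborel) \<le> C
    \<and> (\<integral>\<^sup>+x. indicator \<Omega> x * ennreal \<bar>k t x\<bar> \<partial>lborel) \<le> ennreal C"
proof (rule CVc_L2_bounded[OF km k T])
  fix B assume B: "0 \<le> B" and bd: "\<And>t. t \<in> {0..T} \<Longrightarrow> (\<integral>\<^sup>+x. indicator \<Omega> x * ennreal ((k t x)\<^sup>2) \<partial>lborel) \<le> ennreal B"
  have V: "k t \<in> Vc \<Omega> \<epsilon> \<sigma>" if "t \<in> {0..T}" for t using k that by (simp add: CVc_def)
  let ?C = "measure lborel \<Omega> + B"
  have ki: "integrable lborel (\<lambda>x. indicator W x * k t x)" if "t \<in> {0..T}" for t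
    by (rule integrable_of_L2(2)[OF km W_measurable finite_W Vc_L2[OF V[OF that]]])
  have nn: "(\<integral>\<^sup>+x. indicator \<Omega> x * ennreal \<bar>k t x\<bar> \<partial>lborel) \<le> ennreal ?C" if t: "t \<in> {0..T}" for t
  proof -
    have "(\<integral>\<^sup>+x. indicator \<Omega> x * ennreal \<bar>k t x\<bar> \<partial>lborel) \<le> (\<integral>\<^sup>+x. indicator \<Omega> x + indicator \<Omega> x * ennreal ((k t x)\<^sup>2) \<partial>lborel)"
    proof (rule nn_integral_mono)
      fix x
      have "ennreal \<bar>k t x\<bar> \<le> ennreal (1 + (k t x)\<^sup>2)"
        using abs_le_add_square_div[of 1 "k t x"] by (intro ennreal_leI) simp
      then show "indicator \<Omega> x * ennreal \<bar>k t x\<bar> \<le> indicator \<Omega> x + indicator \<Omega> x * ennreal ((k t x)\<^sup>2)"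
        by (cases "x \<in> \<Omega>") auto
    qed
    also have "\<dots> = emeasure lborel \<Omega> + (\<integral>\<^sup>+x. indicator \<Omega> x * ennreal ((k t x)\<^sup>2) \<partial>lborel)"
      by (subst nn_integral_add) auto
    also have "\<dots> \<le> ennreal (measure lborel \<Omega>) + ennreal B"
      using bd[OF t] finite_Omega by (intro add_mono) (auto simp: emeasure_eq_ennreal_measure)
    finally show ?thesis using B by simp
  qed
  show thesis
  proof (rule that[of ?C], goal_cases)
    case 1
    show "0 \<le> ?C" using B by simp
  next
    case 2
    show ?case
    proof (intro ballI conjI)
      fix t assume t: "t \<in> {0..T}"
      show "integrable lborel (\<lambda>x. indicator W x * k t x)" by (rule ki[OF t])
      have "integrable lborel (\<lambda>x. indicator W x * \<bar>k t x\<bar>)"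
        using integrable_abs[OF ki[OF t]] by (simp add: abs_mult)
      then have "ennreal (\<integral>x. indicator W x * \<bar>k t x\<bar> \<partial>lborel) = (\<integral>\<^sup>+x. ennreal (indicator W x * \<bar>k t x\<bar>) \<partial>lborel)"
        by (rule nn_integral_eq_integral[symmetric]) simp
      also have "\<dots> = (\<integral>\<^sup>+x. indicator \<Omega> x * ennreal \<bar>k t x\<bar> \<partial>lborel)"
        using Vc_zero_AE[OF V[OF t]]
        by (intro nn_integral_cong_AE, eventually_elim) (auto simp: indicator_def W_def)
      also have "\<dots> \<le> ennreal ?C" by (rule nn[OF t])
      finally show "(\<integral>x. indicator W x * \<bar>k t x\<bar> \<partial>lborel) \<le> ?C"
        using B by (simp add: ennreal_le_iff del: ennreal_plus)
      show "(\<integral>\<^sup>+x. indicator \<Omega> x * ennreal \<bar>k t x\<bar> \<partial>lborel) \<le> ennreal ?C" by (rule nn[OF t])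
    qed
  qed
qed

lemma integrable_slab_solution:
  assumes jm: "jointly_measurable k"
    and bd: "\<And>t. t \<in> {0..T} \<Longrightarrow> (\<integral>\<^sup>+x. indicator \<Omega> x * ennreal \<bar>k t x\<bar> \<partial>lborel) \<le> ennreal C"
  shows "integrable (lborel \<Otimes>\<^sub>M lborel) (\<lambda>z. indicator \<Omega> (fst z) * indicator {0..T} (snd z) * k (snd z) (fst z))"
proof -
  note jointly_measurableD[OF jm, measurable]
  define f where "f z = indicator {0..T} (fst z) * (indicator \<Omega> (snd z) * k (fst z) (snd z))" for z
  have fm[measurable]: "f \<in> borel_measurable (lborel \<Otimes>\<^sub>M lborel)"
    unfolding f_def by measurable
  have "integrable (lborel \<Otimes>\<^sub>M lborel) f"
  proof (rule integrableI_bounded[OF fm])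
    have "(\<integral>\<^sup>+z. ennreal (norm (f z)) \<partial>(lborel \<Otimes>\<^sub>M lborel)) = (\<integral>\<^sup>+t. \<integral>\<^sup>+x. ennreal (norm (f (t, x))) \<partial>lborel \<partial>lborel)"
      by (rule lborel.nn_integral_fst[symmetric]) measurable
    also have "\<dots> \<le> (\<integral>\<^sup>+t. ennreal C * indicator {0..T} t \<partial>lborel)"
    proof (rule nn_integral_mono)
      fix t
      show "(\<integral>\<^sup>+x. ennreal (norm (f (t, x))) \<partial>lborel) \<le> ennreal C * indicator {0..T} t"
      proof (cases "t \<in> {0..T}")
        case True
        have "(\<integral>\<^sup>+x. ennreal (norm (f (t, x))) \<partial>lborel) = (\<integral>\<^sup>+x. indicator \<Omega> x * ennreal \<bar>k t x\<bar> \<partial>lborel)"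
          using True by (intro nn_integral_cong) (auto simp: f_def indicator_def)
        then show ?thesis using bd[OF True] True by simp
      qed (simp add: f_def)
    qed
    also have "\<dots> < \<infinity>"
      by (subst nn_integral_cmult_indicator) (auto simp: ennreal_mult_less_top emeasure_lborel_Icc_eq)
    finally show "(\<integral>\<^sup>+z. ennreal (norm (f z)) \<partial>(lborel \<Otimes>\<^sub>M lborel)) < \<infinity>" .
  qed
  from lborel_pair.integrable_product_swap[OF this]
  show ?thesis by (simp add: f_def case_prod_unfold mult_ac)
qed

lemma integrable_slab_const: "integrable (lborel \<Otimes>\<^sub>M lborel) (\<lambda>z. indicator \<Omega> (fst z) * indicator {0..T::real} (snd z) :: real)"
  using finite_Omega by (intro integrable_pair_product) (auto simp: emeasure_lborel_Icc_eq)

lemma integrable_slab_bounded: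
  fixes F :: "'a \<Rightarrow> real \<Rightarrow> real"
  assumes [measurable]: "(\<lambda>z. F (fst z) (snd z)) \<in> borel_measurable (lborel \<Otimes>\<^sub>M lborel)"
    and bd: "AE z in lborel \<Otimes>\<^sub>M lborel. z \<in> \<Omega> \<times> {0..T} \<longrightarrow> \<bar>F (fst z) (snd z)\<bar> \<le> m"
  shows "integrable (lborel \<Otimes>\<^sub>M lborel) (\<lambda>z. indicator \<Omega> (fst z) * indicator {0..T} (snd z) * F (fst z) (snd z))"
proof (rule Bochner_Integration.integrable_bound[OF integrable_mult_right[OF integrable_slab_const, of m]])
  show "AE z in lborel \<Otimes>\<^sub>M lborel. norm (indicator \<Omega> (fst z) * indicator {0..T} (snd z) * F (fst z) (snd z))
    \<le> norm (m * (indicator \<Omega> (fst z) * indicator {0..T} (snd z)))"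
    using bd by eventually_elim (auto simp: indicator_def)
qed measurable

lemma integrable_slab_NL:
  assumes jm: "jointly_measurable k"
    and ki: "\<And>t. t \<in> {0..T} \<Longrightarrow> integrable lborel (\<lambda>x. indicator W x * k t x)"
    and C: "\<And>t. t \<in> {0..T} \<Longrightarrow> (\<integral>x. indicator W x * \<bar>k t x\<bar> \<partial>lborel) \<le> C"
    and slab: "integrable (lborel \<Otimes>\<^sub>M lborel) (\<lambda>z. indicator \<Omega> (fst z) * indicator {0..T} (snd z) * k (snd z) (fst z))"
    and \<delta>: "0 \<le> \<delta>"
  shows "integrable (lborel \<Otimes>\<^sub>M lborel) (\<lambda>z. indicator \<Omega> (fst z) * indicator {0..T} (snd z) * (NL (k (snd z)) (fst z) + \<delta> * k (snd z) (fst z)))"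
    and "\<And>t x. t \<in> {0..T} \<Longrightarrow> \<bar>NL (k t) x + \<delta> * k t x\<bar> \<le> (J0 * measure lborel W + \<delta>) * \<bar>k t x\<bar> + J0 * C"
proof -
  note jointly_measurableD[OF jm, measurable] NL_measurable[OF jm, measurable]
  show b: "\<bar>NL (k t) x + \<delta> * k t x\<bar> \<le> (J0 * measure lborel W + \<delta>) * \<bar>k t x\<bar> + J0 * C" if t: "t \<in> {0..T}" for t x
  proof -
    have "\<bar>NL (k t) x\<bar> \<le> J0 * measure lborel W * \<bar>k t x\<bar> + J0 * (\<integral>y. indicator W y * \<bar>k t y\<bar> \<partial>lborel)"
      using ki[OF t] by (intro NL_bound) measurable
    also have "\<dots> \<le> J0 * measure lborel W * \<bar>k t x\<bar> + J0 * C"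
      using C[OF t] J0_pos by simp
    finally show ?thesis
      using \<delta> abs_triangle_ineq[of "NL (k t) x" "\<delta> * k t x"] by (simp add: abs_mult algebra_simps)
  qed
  let ?i = "\<lambda>z. indicator \<Omega> (fst z) * indicator {0..T} (snd z) :: real"
  have "integrable (lborel \<Otimes>\<^sub>M lborel) (\<lambda>z. (J0 * measure lborel W + \<delta>) * \<bar>?i z * k (snd z) (fst z)\<bar> + J0 * C * ?i z)"
    by (intro Bochner_Integration.integrable_add integrable_mult_right integrable_abs slab integrable_slab_const)
  then show "integrable (lborel \<Otimes>\<^sub>M lborel) (\<lambda>z. ?i z * (NL (k (snd z)) (fst z) + \<delta> * k (snd z) (fst z)))"
  proof (rule Bochner_Integration.integrable_bound)
    show "AE z in lborel \<Otimes>\<^sub>M lborel. norm (?i z * (NL (k (snd z)) (fst z) + \<delta> * k (snd z) (fst z)))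
      \<le> norm ((J0 * measure lborel W + \<delta>) * \<bar>?i z * k (snd z) (fst z)\<bar> + J0 * C * ?i z)"
    proof (rule AE_I2)
      fix z
      show "norm (?i z * (NL (k (snd z)) (fst z) + \<delta> * k (snd z) (fst z)))
        \<le> norm ((J0 * measure lborel W + \<delta>) * \<bar>?i z * k (snd z) (fst z)\<bar> + J0 * C * ?i z)"
      proof (cases "fst z \<in> \<Omega> \<and> snd z \<in> {0..T}")
        case True
        then show ?thesis using b[of "snd z" "fst z"] by auto
      qed auto
    qed
  qed measurable
qed

lemma weak_solution_integrated:
  fixes F :: "'a \<Rightarrow> real \<Rightarrow> real"
  assumes T: "0 < T" and jm: "jointly_measurable k" and CV: "CVc \<Omega> \<epsilon> \<sigma> T k"
    and wd: "weak_deriv_Vc' \<Omega> \<epsilon> \<sigma> T k kt"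
    and eq: "\<And>w. CVc \<Omega> \<epsilon> \<sigma> T w \<Longrightarrow> jointly_measurable w \<Longrightarrow>
      (\<integral>t. indicator {0..T} t * kt t (w t) \<partial>lborel)
      + (\<integral>t. indicator {0..T} t * abil \<Omega> \<epsilon> \<sigma> \<delta> (k t) (w t) \<partial>lborel)
      = (\<integral>t. indicator {0..T} t * (\<integral>x. indicator \<Omega> x * (F x t * w t x) \<partial>lborel) \<partial>lborel)"
    and ki: "\<And>t. t \<in> {0..T} \<Longrightarrow> integrable lborel (\<lambda>x. indicator W x * k t x)"
    and iN: "integrable (lborel \<Otimes>\<^sub>M lborel) (\<lambda>z. indicator \<Omega> (fst z) * indicator {0..T} (snd z) * (NL (k (snd z)) (fst z) + \<delta> * k (snd z) (fst z)))"
    and iF: "integrable (lborel \<Otimes>\<^sub>M lborel) (\<lambda>z. indicator \<Omega> (fst z) * indicator {0..T} (snd z) * F (fst z) (snd z))"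
    and Em[measurable]: "E \<in> sets borel" and E: "E \<subseteq> \<Omega>" and r: "0 < r" "r < T"
  shows "(\<integral>x. indicator E x * k r x \<partial>lborel) - (\<integral>x. indicator E x * k 0 x \<partial>lborel)
    = (\<integral>x. indicator E x * (\<integral>t. indicator {0..r} t * F x t \<partial>lborel) \<partial>lborel)
      - (\<integral>x. indicator E x * (\<integral>t. indicator {0..r} t * (NL (k t) x + \<delta> * k t x) \<partial>lborel) \<partial>lborel)"
proof -
  note jointly_measurableD[OF jm, measurable]
  define N where "N x t = NL (k t) x + \<delta> * k t x" for x t
  define a1 where "a1 t = (\<integral>x. indicator E x * N x t \<partial>lborel)" for t
  define f1 where "f1 t = (\<integral>x. indicator E x * F x t \<partial>lborel)" for t
  define q where "q t a = kt t (\<lambda>x. a * indicator E x)" for t a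
  have iN': "integrable (lborel \<Otimes>\<^sub>M lborel) (\<lambda>z. indicator \<Omega> (fst z) * indicator {0..T} (snd z) * N (fst z) (snd z))"
    using iN by (simp add: N_def)
  have a1i: "integrable lborel (\<lambda>t. indicator {0..T} t * a1 t)"
    unfolding a1_def by (rule Fubini_slab(1)[OF iN' Em E]) auto
  have f1i: "integrable lborel (\<lambda>t. indicator {0..T} t * f1 t)"
    unfolding f1_def by (rule Fubini_slab(1)[OF iF Em E]) auto
  have fi: "integrable lborel (\<lambda>t. indicator {0..T} t * (a1 t - f1 t))"
    using Bochner_Integration.integrable_diff[OF a1i f1i] by (simp add: right_diff_distrib)
  have V: "(\<lambda>x. a * indicator E x) \<in> Vc \<Omega> \<epsilon> \<sigma>" for a
    by (rule scaled_indicator_in_Vc[OF Em E])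
  have meas: "(\<lambda>t. indicator {0<..<T} t * q t a) \<in> borel_measurable lborel" for a
    using wd V[of a] unfolding weak_deriv_Vc'_def q_def by blast
  obtain g where gm[measurable]: "g \<in> borel_measurable lborel"
    and g2: "(\<integral>\<^sup>+t. indicator {0<..<T} t * ennreal ((g t)\<^sup>2) \<partial>lborel) < \<infinity>"
    and gAE: "AE t in lborel. t \<in> {0<..<T} \<longrightarrow>
              (\<forall>u\<in>Vc \<Omega> \<epsilon> \<sigma>. \<forall>v\<in>Vc \<Omega> \<epsilon> \<sigma>. \<forall>a b.
                  kt t (\<lambda>x. a * u x + b * v x) = a * kt t u + b * kt t v) \<and>
              (\<forall>v\<in>Vc \<Omega> \<epsilon> \<sigma>. \<bar>kt t v\<bar> \<le> g t * tnorm \<Omega> \<epsilon> \<sigma> v)"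
    using wd unfolding weak_deriv_Vc'_def by blast
  have lin: "AE t in lborel. t \<in> {0<..<T} \<longrightarrow> (\<forall>a. q t a = a * q t 1)"
    using gAE
  proof eventually_elim
    case (elim t)
    show ?case
    proof (intro impI allI)
      fix a assume "t \<in> {0<..<T}"
      then have "\<forall>u\<in>Vc \<Omega> \<epsilon> \<sigma>. \<forall>v\<in>Vc \<Omega> \<epsilon> \<sigma>. \<forall>a b. kt t (\<lambda>x. a * u x + b * v x) = a * kt t u + b * kt t v"
        using elim by blast
      from this[rule_format, OF V[of 1] V[of 1], of a 0]
      show "q t a = a * q t 1" by (simp add: q_def)
    qed
  qed
  have qi: "integrable lborel (\<lambda>t. indicator {0<..<T} t * q t 1)"
  proof -
    let ?n = "tnorm \<Omega> \<epsilon> \<sigma> (\<lambda>x. 1 * indicator E x)"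
    have "integrable lborel (\<lambda>t. indicator {0<..<T} t * g t)"
      by (rule integrable_of_L2(2)[OF _ _ _ g2]) (use gm T in auto)
    then have "integrable lborel (\<lambda>t. (indicator {0<..<T} t * g t) * ?n)"
      by (rule integrable_mult_left)
    then show ?thesis
    proof (rule Bochner_Integration.integrable_bound)
      show "AE t in lborel. norm (indicator {0<..<T} t * q t 1) \<le> norm (indicator {0<..<T} t * g t * ?n)"
        using gAE
      proof eventually_elim
        case (elim t)
        show ?case
        proof (cases "t \<in> {0<..<T}")
          case True
          then have "\<bar>q t 1\<bar> \<le> g t * ?n" using elim V[of 1] unfolding q_def by blast
          then show ?thesis using True by simp
        qed simp
      qed
    qed (rule meas)
  qed
  have main: "(\<integral>x. indicator E x * k r x \<partial>lborel) - (\<integral>x. indicator E x * k 0 x \<partial>lborel)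
      = - (\<integral>t. indicator {0..r} t * (a1 t - f1 t) \<partial>lborel)"
  proof (rule weak_equation_integrated[OF meas lin qi fi _ _ _ r])
    show "continuous_on {0..T} (\<lambda>t. \<integral>x. indicator E x * k t x \<partial>lborel)"
      by (rule CVc_continuous_integral[OF _ CV Em E]) measurable
    fix \<psi> :: "real \<Rightarrow> real"
    show "(\<integral>t. indicator {0<..<T} t * (q t 1 * \<psi> t) \<partial>lborel)
        = - (\<integral>t. indicator {0<..<T} t * ((\<integral>x. indicator E x * k t x \<partial>lborel) * deriv \<psi> t) \<partial>lborel)"
      if "test_fun T \<psi>"
    proof -
      have "(\<integral>t. indicator {0<..<T} t * (q t 1 * \<psi> t) \<partial>lborel)
          = - (\<integral>t. indicator {0<..<T} t * ((\<integral>x. indicator \<Omega> x * (k t x * (1 * indicator E x)) \<partial>lborel) * deriv \<psi> t) \<partial>lborel)"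
        using wd V[of 1] that unfolding weak_deriv_Vc'_def q_def by blast
      moreover have "indicator \<Omega> x * (k t x * (1 * indicator E x)) = indicator E x * k t x" for x t
        using E by (auto simp: indicator_def)
      ultimately show ?thesis by (simp only:)
    qed
    show "(\<integral>t. indicator {0..T} t * q t (\<psi> t) \<partial>lborel) + (\<integral>t. indicator {0..T} t * (\<psi> t * (a1 t - f1 t)) \<partial>lborel) = 0"
      if \<psi>: "continuous_on UNIV \<psi>"
    proof -
      have \<psi>m[measurable]: "\<psi> \<in> borel_measurable borel"
        by (rule borel_measurable_continuous_onI[OF \<psi>])
      have "bounded (\<psi> ` {0..T})"
        by (intro compact_imp_bounded compact_continuous_image continuous_on_subset[OF \<psi>]) auto
      then obtain b where "\<forall>t\<in>{0..T}. \<bar>\<psi> t\<bar> \<le> b"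
        by (auto simp: bounded_iff)
      then have b: "\<bar>\<psi> t\<bar> \<le> b" if "t \<in> {0..T}" for t
        using that by blast
      have \<psi>i: "integrable lborel (\<lambda>t. indicator {0..T} t * (\<psi> t * h t))"
        if h: "integrable lborel (\<lambda>t. indicator {0..T} t * h t)" for h
      proof (rule Bochner_Integration.integrable_bound[OF integrable_mult_right[OF h, of b]])
        have "(\<lambda>t. \<psi> t * (indicator {0..T} t * h t)) \<in> borel_measurable lborel"
          by (rule borel_measurable_times[OF _ borel_measurable_integrable[OF h]]) simp
        then show "(\<lambda>t. indicator {0..T} t * (\<psi> t * h t)) \<in> borel_measurable lborel"
          by (simp add: mult_ac)
        show "AE t in lborel. norm (indicator {0..T} t * (\<psi> t * h t)) \<le> norm (b * (indicator {0..T} t * h t))"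
        proof (rule AE_I2)
          fix t
          show "norm (indicator {0..T} t * (\<psi> t * h t)) \<le> norm (b * (indicator {0..T} t * h t))"
          proof (cases "t \<in> {0..T}")
            case True
            have "\<bar>\<psi> t\<bar> \<le> \<bar>b\<bar>" using b[OF True] by linarith
            then show ?thesis using True by (simp add: abs_mult mult_right_mono)
          qed simp
        qed
      qed
      have jw: "jointly_measurable (\<lambda>t x. \<psi> t * indicator E x)"
        unfolding jointly_measurable_def by measurable
      have "(\<integral>t. indicator {0..T} t * q t (\<psi> t) \<partial>lborel)
          + (\<integral>t. indicator {0..T} t * abil \<Omega> \<epsilon> \<sigma> \<delta> (k t) (\<lambda>x. \<psi> t * indicator E x) \<partial>lborel)
          = (\<integral>t. indicator {0..T} t * (\<integral>x. indicator \<Omega> x * (F x t * (\<psi> t * indicator E x)) \<partial>lborel) \<partial>lborel)"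
        unfolding q_def by (rule eq[OF CVc_scaled_indicator[OF Em E \<psi>] jw])
      moreover have "(\<integral>t. indicator {0..T} t * abil \<Omega> \<epsilon> \<sigma> \<delta> (k t) (\<lambda>x. \<psi> t * indicator E x) \<partial>lborel)
          = (\<integral>t. indicator {0..T} t * (\<psi> t * a1 t) \<partial>lborel)"
      proof (intro Bochner_Integration.integral_cong refl)
        fix t
        show "indicator {0..T} t * abil \<Omega> \<epsilon> \<sigma> \<delta> (k t) (\<lambda>x. \<psi> t * indicator E x) = indicator {0..T} t * (\<psi> t * a1 t)"
        proof (cases "t \<in> {0..T}")
          case True
          have "abil \<Omega> \<epsilon> \<sigma> \<delta> (k t) (\<lambda>x. \<psi> t * indicator E x) = \<psi> t * a1 t"
            unfolding a1_def N_def by (rule abil_indicator[OF _ Em E ki[OF True]]) measurable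
          then show ?thesis by simp
        qed simp
      qed
      moreover have "(\<integral>x. indicator \<Omega> x * (F x t * (\<psi> t * indicator E x)) \<partial>lborel) = \<psi> t * f1 t" for t
      proof -
        have "indicator \<Omega> x * (F x t * (\<psi> t * indicator E x)) = \<psi> t * (indicator E x * F x t)" for x
          using E by (auto simp: indicator_def)
        then show ?thesis by (simp only: f1_def integral_mult_right_zero)
      qed
      moreover have "(\<integral>t. indicator {0..T} t * (\<psi> t * (a1 t - f1 t)) \<partial>lborel)
          = (\<integral>t. indicator {0..T} t * (\<psi> t * a1 t) \<partial>lborel) - (\<integral>t. indicator {0..T} t * (\<psi> t * f1 t) \<partial>lborel)"
        unfolding right_diff_distrib by (intro Bochner_Integration.integral_diff \<psi>i a1i f1i)
      ultimately show ?thesis by simp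
    qed
  qed
  have sub: "{0..r} \<in> sets borel" "{0..r} \<subseteq> {0..T}" using r by auto
  have ind: "integrable lborel (\<lambda>t. indicator {0..r} t * a1 t)" "integrable lborel (\<lambda>t. indicator {0..r} t * f1 t)"
    unfolding a1_def f1_def by (rule Fubini_slab(1)[OF iN' Em E sub], rule Fubini_slab(1)[OF iF Em E sub])
  have "(\<integral>t. indicator {0..r} t * (a1 t - f1 t) \<partial>lborel) = (\<integral>t. indicator {0..r} t * a1 t \<partial>lborel) - (\<integral>t. indicator {0..r} t * f1 t \<partial>lborel)"
    unfolding right_diff_distrib by (intro Bochner_Integration.integral_diff ind)
  also have "(\<integral>t. indicator {0..r} t * a1 t \<partial>lborel) = (\<integral>x. indicator E x * (\<integral>t. indicator {0..r} t * N x t \<partial>lborel) \<partial>lborel)"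
    unfolding a1_def by (rule Fubini_slab(3)[OF iN' Em E sub])
  also have "(\<integral>t. indicator {0..r} t * f1 t \<partial>lborel) = (\<integral>x. indicator E x * (\<integral>t. indicator {0..r} t * F x t \<partial>lborel) \<partial>lborel)"
    unfolding f1_def by (rule Fubini_slab(3)[OF iF Em E sub])
  finally show ?thesis using main by (simp add: N_def)
qed

lemma Phi_mono:
  fixes k :: "real \<Rightarrow> 'a \<Rightarrow> real"
  assumes [measurable]: "k t \<in> borel_measurable borel" and ki: "integrable lborel (\<lambda>x. indicator W x * k t x)"
    and \<phi>: "\<And>s. 0 \<le> \<phi> s" and L: "L-lipschitz_on UNIV \<phi>" and \<mu>: "\<mu> \<le> \<epsilon>"
  shows "0 \<le> Phi \<Omega> \<epsilon> \<sigma> \<phi> \<mu> k x t" "Phi \<Omega> \<epsilon> \<sigma> \<phi> \<mu> k x t \<le> Phi \<Omega> \<epsilon> \<sigma> \<phi> \<epsilon> k x t"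
proof -
  have [measurable]: "\<phi> \<in> borel_measurable borel"
    using lipschitz_on_continuous_on[OF L] by (rule borel_measurable_continuous_onI)
  show "0 \<le> Phi \<Omega> \<epsilon> \<sigma> \<phi> \<mu> k x t"
    unfolding Phi_def using \<phi> Gam_nonneg by (intro integral_nonneg_AE AE_I2) auto
  have "integrable lborel (\<lambda>y. J0 * (\<phi> 0 * indicator W y + L * \<bar>indicator W y * k t y\<bar>))"
    using finite_W ki by (intro integrable_mult_right Bochner_Integration.integrable_add integrable_abs) auto
  then have i: "integrable lborel (\<lambda>y. indicator W y * (\<phi> (k t y) * Gam \<sigma> \<epsilon> x y))"
  proof (rule Bochner_Integration.integrable_bound)
    show "AE y in lborel. norm (indicator W y * (\<phi> (k t y) * Gam \<sigma> \<epsilon> x y))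
      \<le> norm (J0 * (\<phi> 0 * indicator W y + L * \<bar>indicator W y * k t y\<bar>))"
    proof (rule AE_I2)
      fix y
      have "\<bar>\<phi> (k t y) - \<phi> 0\<bar> \<le> L * \<bar>k t y\<bar>"
        using lipschitz_onD[OF L, of "k t y" 0] by (simp add: dist_real_def)
      then have le: "\<phi> (k t y) \<le> \<phi> 0 + L * \<bar>k t y\<bar>" by linarith
      then have "\<phi> (k t y) * Gam \<sigma> \<epsilon> x y \<le> (\<phi> 0 + L * \<bar>k t y\<bar>) * J0"
        using \<phi>[of "k t y"] by (intro mult_mono Gam_le Gam_nonneg) auto
      moreover have "0 \<le> \<phi> (k t y) * Gam \<sigma> \<epsilon> x y"
        using \<phi> Gam_nonneg by simp
      moreover have "0 \<le> \<phi> 0 + L * \<bar>k t y\<bar>" using le \<phi>[of "k t y"] by linarith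
      ultimately show "norm (indicator W y * (\<phi> (k t y) * Gam \<sigma> \<epsilon> x y))
        \<le> norm (J0 * (\<phi> 0 * indicator W y + L * \<bar>indicator W y * k t y\<bar>))"
        using J0_pos by (cases "y \<in> W") (auto simp: abs_mult mult.commute)
    qed
  qed measurable
  show "Phi \<Omega> \<epsilon> \<sigma> \<phi> \<mu> k x t \<le> Phi \<Omega> \<epsilon> \<sigma> \<phi> \<epsilon> k x t"
    unfolding Phi_def W_def[symmetric]
    using \<phi> Gam_nonneg Gam_mono[OF \<mu>]
    by (intro integral_mono' i) (auto simp: indicator_def intro!: mult_left_mono)
qed

lemma Pop_bound:
  fixes k :: "real \<Rightarrow> 'a \<Rightarrow> real"
  assumes k: "k t \<in> borel_measurable borel" "integrable lborel (\<lambda>x. indicator W x * k t x)"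
    and \<phi>: "\<And>s. 0 \<le> \<phi> s" and L: "L-lipschitz_on UNIV \<phi>" and \<mu>: "\<mu> \<le> \<epsilon>"
    and p: "\<And>s. 0 \<le> p s" "\<And>s. p s \<le> Mp" and \<xi>: "0 < \<xi>" and t: "0 \<le> t" "t \<le> T" and A: "\<bar>A0 x\<bar> \<le> A"
  shows "\<bar>Pop \<Omega> \<epsilon> \<sigma> \<mu> \<xi> A0 p \<phi> k x t\<bar> \<le> A * exp T * Mp"
proof -
  let ?m = "Phi \<Omega> \<epsilon> \<sigma> \<phi> \<mu> k x t" and ?e = "Phi \<Omega> \<epsilon> \<sigma> \<phi> \<epsilon> k x t"
  have me: "0 \<le> ?m" "?m \<le> ?e" by (rule Phi_mono[where k=k and t=t, OF k \<phi> L \<mu>])+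
  then have "?m / (?e + \<xi>) \<le> 1" using \<xi> by (simp add: field_simps)
  then have "t * (?m / (?e + \<xi>)) \<le> T * 1"
    using t me \<xi> by (intro mult_mono) auto
  then have "exp (t * ?m / (?e + \<xi>)) \<le> exp T" by simp
  moreover have "\<bar>Pop \<Omega> \<epsilon> \<sigma> \<mu> \<xi> A0 p \<phi> k x t\<bar> = \<bar>A0 x\<bar> * exp (t * ?m / (?e + \<xi>)) * p (k t x)"
    using p by (simp add: Pop_def abs_mult)
  ultimately show ?thesis
    using A p by (auto intro!: mult_mono)
qed

lemma bounded_of_integrated_equation:
  fixes k :: "real \<Rightarrow> 'a \<Rightarrow> real" and F :: "'a \<Rightarrow> real \<Rightarrow> real"
  assumes T: "0 < T" and jm: "jointly_measurable k"
    and ki: "\<And>t. t \<in> {0..T} \<Longrightarrow> integrable lborel (\<lambda>x. indicator W x * k t x)"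
    and slab: "integrable (lborel \<Otimes>\<^sub>M lborel) (\<lambda>z. indicator \<Omega> (fst z) * indicator {0..T} (snd z) * k (snd z) (fst z))"
    and Nm[measurable]: "(\<lambda>z. N (fst z) (snd z)) \<in> borel_measurable (lborel \<Otimes>\<^sub>M lborel)"
    and Fm[measurable]: "(\<lambda>z. F (fst z) (snd z)) \<in> borel_measurable (lborel \<Otimes>\<^sub>M lborel)"
    and iN: "integrable (lborel \<Otimes>\<^sub>M lborel) (\<lambda>z. indicator \<Omega> (fst z) * indicator {0..T} (snd z) * N (fst z) (snd z))"
    and iF: "integrable (lborel \<Otimes>\<^sub>M lborel) (\<lambda>z. indicator \<Omega> (fst z) * indicator {0..T} (snd z) * F (fst z) (snd z))"
    and N: "\<And>t x. t \<in> {0..T} \<Longrightarrow> \<bar>N x t\<bar> \<le> A * \<bar>k t x\<bar> + B" and AB: "0 \<le> A" "0 \<le> B"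
    and F: "AE z in lborel \<Otimes>\<^sub>M lborel. z \<in> \<Omega> \<times> {0..T} \<longrightarrow> \<bar>F (fst z) (snd z)\<bar> \<le> m" and m: "0 \<le> m"
    and k0: "AE x in lborel. x \<in> \<Omega> \<longrightarrow> \<bar>k 0 x\<bar> \<le> K0" and K0: "0 \<le> K0"
    and eq: "\<And>E r. E \<in> sets borel \<Longrightarrow> E \<subseteq> \<Omega> \<Longrightarrow> 0 < r \<Longrightarrow> r < T \<Longrightarrow>
      (\<integral>x. indicator E x * k r x \<partial>lborel) - (\<integral>x. indicator E x * k 0 x \<partial>lborel)
      = (\<integral>x. indicator E x * (\<integral>t. indicator {0..r} t * F x t \<partial>lborel) \<partial>lborel)
        - (\<integral>x. indicator E x * (\<integral>t. indicator {0..r} t * N x t \<partial>lborel) \<partial>lborel)"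
  shows "AE z in lborel \<Otimes>\<^sub>M lborel. z \<in> \<Omega> \<times> {0<..<T} \<longrightarrow> \<bar>k (snd z) (fst z)\<bar> \<le> (K0 + B * T + m * T) * exp (A * T)"
proof -
  note jointly_measurableD[OF jm, measurable]
  have Nm'[measurable]: "(\<lambda>z. N (f z) (g z)) \<in> borel_measurable M"
    if [measurable]: "f \<in> M \<rightarrow>\<^sub>M borel" "g \<in> M \<rightarrow>\<^sub>M borel" for f g and M :: "'b measure"
  proof -
    have "(\<lambda>z. (f z, g z)) \<in> M \<rightarrow>\<^sub>M lborel \<Otimes>\<^sub>M lborel" by measurable
    from measurable_compose[OF this Nm] show ?thesis by simp
  qed
  have Fm'[measurable]: "(\<lambda>z. F (f z) (g z)) \<in> borel_measurable M"
    if [measurable]: "f \<in> M \<rightarrow>\<^sub>M borel" "g \<in> M \<rightarrow>\<^sub>M borel" for f g and M :: "'b measure"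
  proof -
    have "(\<lambda>z. (f z, g z)) \<in> M \<rightarrow>\<^sub>M lborel \<Otimes>\<^sub>M lborel" by measurable
    from measurable_compose[OF this Fm] show ?thesis by simp
  qed
  define D where "D x r = (\<integral>t. indicator {0..r} t * F x t \<partial>lborel) - (\<integral>t. indicator {0..r} t * N x t \<partial>lborel)" for x r
  have Dm[measurable]: "(\<lambda>z. D (fst z) (snd z)) \<in> borel_measurable (lborel \<Otimes>\<^sub>M lborel)"
  proof -
    have "D x r = (\<integral>t. (if 0 \<le> t \<and> t \<le> r then F x t else 0) \<partial>lborel) - (\<integral>t. (if 0 \<le> t \<and> t \<le> r then N x t else 0) \<partial>lborel)" for x r
      unfolding D_def by (intro arg_cong2[where f="(-)"] Bochner_Integration.integral_cong) (auto simp: indicator_def)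
    then show ?thesis by simp
  qed
  have rep: "AE x in lborel. x \<in> \<Omega> \<longrightarrow> k r x - k 0 x = D x r" if r: "0 < r" "r < T" for r
  proof -
    have sub: "{0..r} \<in> sets borel" "{0..r} \<subseteq> {0..T}" using r by auto
    have iW: "integrable lborel (\<lambda>x. indicator S x * k t x)" if t: "t \<in> {0..T}" and S: "S \<in> sets borel" "S \<subseteq> \<Omega>" for t S
    proof -
      have "indicator S x *\<^sub>R (indicator W x * k t x) = indicator S x * k t x" for x
        using S(2) Omega_subset_W by (auto simp: indicator_def)
      then show ?thesis using integrable_mult_indicator[OF _ ki[OF t], of S] S by (simp only: sets_lborel)
    qed
    have rT: "r \<in> {0..T}" "0 \<in> {0..T}" using r by auto
    have "AE x in lborel. indicator \<Omega> x * k r x - indicator \<Omega> x * k 0 x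
        = indicator \<Omega> x * (\<integral>t. indicator {0..r} t * F x t \<partial>lborel) - indicator \<Omega> x * (\<integral>t. indicator {0..r} t * N x t \<partial>lborel)"
    proof (rule density_unique_real)
      show "integrable lborel (\<lambda>x. indicator \<Omega> x * k r x - indicator \<Omega> x * k 0 x)"
        using rT by (intro Bochner_Integration.integrable_diff iW) auto
      show "integrable lborel (\<lambda>x. indicator \<Omega> x * (\<integral>t. indicator {0..r} t * F x t \<partial>lborel) - indicator \<Omega> x * (\<integral>t. indicator {0..r} t * N x t \<partial>lborel))"
        by (intro Bochner_Integration.integrable_diff Fubini_slab(2)[OF iF _ _ sub] Fubini_slab(2)[OF iN _ _ sub]) auto
      fix S :: "'a set" assume "S \<in> sets lborel"
      then have Sm[measurable]: "S \<in> sets borel" by simp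
      have SO: "S \<inter> \<Omega> \<in> sets borel" "S \<inter> \<Omega> \<subseteq> \<Omega>" by auto
      have split: "indicator S x *\<^sub>R (indicator \<Omega> x * a - indicator \<Omega> x * b) = indicator (S \<inter> \<Omega>) x * a - indicator (S \<inter> \<Omega>) x * b" for x and a b :: real
        by (auto simp: indicator_def)
      have "(\<integral>x\<in>S. (indicator \<Omega> x * k r x - indicator \<Omega> x * k 0 x) \<partial>lborel)
          = (\<integral>x. indicator (S \<inter> \<Omega>) x * k r x \<partial>lborel) - (\<integral>x. indicator (S \<inter> \<Omega>) x * k 0 x \<partial>lborel)"
        unfolding set_lebesgue_integral_def split
        by (intro Bochner_Integration.integral_diff iW rT SO)
      also have "\<dots> = (\<integral>x. indicator (S \<inter> \<Omega>) x * (\<integral>t. indicator {0..r} t * F x t \<partial>lborel) \<partial>lborel)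
          - (\<integral>x. indicator (S \<inter> \<Omega>) x * (\<integral>t. indicator {0..r} t * N x t \<partial>lborel) \<partial>lborel)"
        by (rule eq[OF SO r])
      also have "\<dots> = (\<integral>x\<in>S. (indicator \<Omega> x * (\<integral>t. indicator {0..r} t * F x t \<partial>lborel) - indicator \<Omega> x * (\<integral>t. indicator {0..r} t * N x t \<partial>lborel)) \<partial>lborel)"
        unfolding set_lebesgue_integral_def split
        by (intro Bochner_Integration.integral_diff[symmetric] Fubini_slab(2)[OF iF SO sub] Fubini_slab(2)[OF iN SO sub])
      finally show "(\<integral>x\<in>S. (indicator \<Omega> x * k r x - indicator \<Omega> x * k 0 x) \<partial>lborel)
        = (\<integral>x\<in>S. (indicator \<Omega> x * (\<integral>t. indicator {0..r} t * F x t \<partial>lborel) - indicator \<Omega> x * (\<integral>t. indicator {0..r} t * N x t \<partial>lborel)) \<partial>lborel)" .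
    qed
    then show ?thesis by eventually_elim (auto simp: D_def)
  qed
  have "AE r in lborel. AE x in lborel. x \<in> \<Omega> \<and> r \<in> {0<..<T} \<longrightarrow> k r x - k 0 x = D x r"
  proof (rule AE_I2)
    fix r
    show "AE x in lborel. x \<in> \<Omega> \<and> r \<in> {0<..<T} \<longrightarrow> k r x - k 0 x = D x r"
    proof (cases "r \<in> {0<..<T}")
      case True
      then show ?thesis using rep[of r] by simp
    qed auto
  qed
  moreover have "{z \<in> space (lborel \<Otimes>\<^sub>M lborel). fst z \<in> \<Omega> \<and> snd z \<in> {0<..<T} \<longrightarrow> k (snd z) (fst z) - k 0 (fst z) = D (fst z) (snd z)} \<in> sets (lborel \<Otimes>\<^sub>M lborel)"
    by measurable
  ultimately have rep': "AE x in lborel. AE r in lborel. x \<in> \<Omega> \<and> r \<in> {0<..<T} \<longrightarrow> k r x - k 0 x = D x r"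
    by (subst lborel_pair.AE_commute)
  have F': "AE x in lborel. AE r in lborel. x \<in> \<Omega> \<and> r \<in> {0..T} \<longrightarrow> \<bar>F x r\<bar> \<le> m"
    using lborel_pair.AE_pair[OF F] by simp
  have k': "AE x in lborel. integrable lborel (\<lambda>r. indicator \<Omega> x * indicator {0..T} r * k r x)"
    using lborel_pair.AE_integrable_fst'[OF slab] by simp
  have "AE x in lborel. AE r in lborel. x \<in> \<Omega> \<and> r \<in> {0<..<T} \<longrightarrow> \<bar>k r x\<bar> \<le> (K0 + B * T + m * T) * exp (A * T)"
    using rep' F' k' k0
  proof eventually_elim
    case (elim x)
    show ?case
    proof (cases "x \<in> \<Omega>")
      case x: True
      have kx: "integrable lborel (\<lambda>r. indicator {0..T} r * k r x)"
        using elim(3) x by simp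
      have "AE r in lborel. r \<in> {0<..<T} \<longrightarrow> \<bar>k r x\<bar> \<le> (K0 + B * T + m * T) * exp (A * T)"
      proof (rule Gronwall_AE[OF AB(1) _ kx])
        show "0 \<le> K0 + B * T + m * T" using K0 AB m T by simp
        show "AE t in lborel. t \<in> {0<..<T} \<longrightarrow> \<bar>k t x\<bar> \<le> K0 + B * T + m * T + A * (\<integral>r. indicator {0..t} r * \<bar>k r x\<bar> \<partial>lborel)"
          using elim(1)
        proof eventually_elim
          case (elim t)
          show ?case
          proof
            assume t: "t \<in> {0<..<T}"
            have t': "{0..t} \<subseteq> {0..T}" "0 \<le> t" "t \<le> T" using t by auto
            have "k t x - k 0 x = D x t" using elim x t by blast
            then have "\<bar>k t x\<bar> \<le> \<bar>k 0 x\<bar> + \<bar>D x t\<bar>" by linarith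
            also have "\<bar>k 0 x\<bar> \<le> K0" using \<open>x \<in> \<Omega> \<longrightarrow> \<bar>k 0 x\<bar> \<le> K0\<close> x by blast
            also have "\<bar>D x t\<bar> \<le> \<bar>\<integral>r. indicator {0..t} r * F x r \<partial>lborel\<bar> + \<bar>\<integral>r. indicator {0..t} r * N x r \<partial>lborel\<bar>"
              unfolding D_def by (rule abs_triangle_ineq4)
            also have "\<bar>\<integral>r. indicator {0..t} r * F x r \<partial>lborel\<bar> \<le> m * T"
            proof -
              have mi: "integrable lborel (\<lambda>r. m * indicator {0..t} r)"
                using t' by (intro integrable_mult_right integrable_real_indicator) auto
              have ae: "AE r in lborel. norm (indicator {0..t} r * F x r) \<le> m * indicator {0..t} r"
                using \<open>AE r in lborel. x \<in> \<Omega> \<and> r \<in> {0..T} \<longrightarrow> \<bar>F x r\<bar> \<le> m\<close>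
                by eventually_elim (use x t' in \<open>auto simp: indicator_def\<close>)
              have "(\<lambda>r. indicator {0..t} r * F x r) \<in> borel_measurable lborel" by measurable
              then have fi: "integrable lborel (\<lambda>r. indicator {0..t} r * F x r)"
                by (rule Bochner_Integration.integrable_bound[OF mi]) (use ae m in \<open>simp add: abs_mult\<close>)
              have "norm (\<integral>r. indicator {0..t} r * F x r \<partial>lborel) \<le> (\<integral>r. norm (indicator {0..t} r * F x r) \<partial>lborel)"
                by (rule integral_norm_bound)
              also have "\<dots> \<le> (\<integral>r. m * indicator {0..t} r \<partial>lborel)"
                by (rule integral_mono_AE[OF integrable_norm[OF fi] mi ae])
              also have "\<dots> = m * t" using t' by simp
              also have "\<dots> \<le> m * T" using t' m by (intro mult_left_mono) auto
              finally show ?thesis by simp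
            qed
            also have "\<bar>\<integral>r. indicator {0..t} r * N x r \<partial>lborel\<bar> \<le> A * (\<integral>r. indicator {0..t} r * \<bar>k r x\<bar> \<partial>lborel) + B * T"
            proof -
              have ki': "integrable lborel (\<lambda>r. indicator {0..t} r * \<bar>k r x\<bar>)"
              proof -
                have "indicator {0..t} r *\<^sub>R \<bar>indicator {0..T} r * k r x\<bar> = indicator {0..t} r * \<bar>k r x\<bar>" for r
                  using t' by (auto simp: indicator_def)
                moreover have "integrable lborel (\<lambda>r. indicator {0..t} r *\<^sub>R \<bar>indicator {0..T} r * k r x\<bar>)"
                  by (rule integrable_mult_indicator[OF _ integrable_abs[OF kx]]) simp
                ultimately show ?thesis by (simp only:)
              qed
              have Ii: "integrable lborel (indicator {0..t} :: real \<Rightarrow> real)"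
                using t' by (intro integrable_real_indicator) auto
              have "\<bar>\<integral>r. indicator {0..t} r * N x r \<partial>lborel\<bar> \<le> (\<integral>r. \<bar>indicator {0..t} r * N x r\<bar> \<partial>lborel)"
                by (rule integral_abs_bound)
              also have "\<dots> \<le> (\<integral>r. A * (indicator {0..t} r * \<bar>k r x\<bar>) + B * indicator {0..t} r \<partial>lborel)"
              proof (rule integral_mono')
                show "integrable lborel (\<lambda>r. A * (indicator {0..t} r * \<bar>k r x\<bar>) + B * indicator {0..t} r)"
                  by (intro Bochner_Integration.integrable_add integrable_mult_right ki' Ii)
                show "\<bar>indicator {0..t} r * N x r\<bar> \<le> A * (indicator {0..t} r * \<bar>k r x\<bar>) + B * indicator {0..t} r" for r
                  using N[of r x] t' by (cases "r \<in> {0..t}") auto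
                show "0 \<le> A * (indicator {0..t} r * \<bar>k r x\<bar>) + B * indicator {0..t} r" for r
                  using AB by simp
              qed
              also have "\<dots> = A * (\<integral>r. indicator {0..t} r * \<bar>k r x\<bar> \<partial>lborel) + B * t"
                using ki' Ii t' by simp
              also have "\<dots> \<le> A * (\<integral>r. indicator {0..t} r * \<bar>k r x\<bar> \<partial>lborel) + B * T"
                using t' AB by (intro add_left_mono mult_left_mono) auto
              finally show ?thesis .
            qed
            finally show "\<bar>k t x\<bar> \<le> K0 + B * T + m * T + A * (\<integral>r. indicator {0..t} r * \<bar>k r x\<bar> \<partial>lborel)"
              by simp
          qed
        qed
      qed
      then show ?thesis by eventually_elim simp
    qed auto
  qed
  then have ae: "AE x in lborel. AE r in lborel. (x, r) \<in> \<Omega> \<times> {0<..<T} \<longrightarrow>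
      \<bar>k (snd (x, r)) (fst (x, r))\<bar> \<le> (K0 + B * T + m * T) * exp (A * T)"
    by simp
  show ?thesis
  proof (rule lborel_pair.AE_pair_measure[OF _ ae])
    have [measurable]: "\<Omega> \<times> {0<..<T} \<in> sets (lborel \<Otimes>\<^sub>M lborel)" by measurable
    show "{z \<in> space (lborel \<Otimes>\<^sub>M lborel). z \<in> \<Omega> \<times> {0<..<T} \<longrightarrow> \<bar>k (snd z) (fst z)\<bar> \<le> (K0 + B * T + m * T) * exp (A * T)} \<in> sets (lborel \<Otimes>\<^sub>M lborel)"
      by measurable
  qed
qed

end

theorem theorem2:
  fixes \<Omega> :: "'a::euclidean_space set"
    and T \<epsilon> \<sigma> \<mu> \<xi> \<delta> Mp :: real
    and A0 k0 :: "'a \<Rightarrow> real"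
    and p \<phi> :: "real \<Rightarrow> real"
    and c :: "'a \<Rightarrow> real \<Rightarrow> real"
    and k :: "real \<Rightarrow> 'a \<Rightarrow> real"
  assumes dom: "open \<Omega>" "bounded \<Omega>" "connected \<Omega>" "lipschitz_domain \<Omega>"
      "piecewise_smooth_boundary \<Omega>" "cone_condition \<Omega>"
    and par: "T > 0" "\<epsilon> > 0" "\<sigma> > 0" "0 < \<mu>" "\<mu> < \<epsilon>" "\<xi> > 0" "\<delta> > 0"
    and p: "Mp > 0" "\<forall>s. 0 \<le> p s \<and> p s \<le> Mp" "p 0 = 0" "\<exists>L. L-lipschitz_on UNIV p"
    and phi: "\<forall>s. 0 \<le> \<phi> s" "\<exists>L. L-lipschitz_on UNIV \<phi>"
    and A0: "\<forall>x\<in>\<Omega>. 0 \<le> A0 x" "A0 \<in> borel_measurable lborel"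
      "\<exists>M. AE x in lborel. x \<in> \<Omega> \<longrightarrow> \<bar>A0 x\<bar> \<le> M"
    and k0: "k0 \<in> borel_measurable lborel" "\<exists>M. AE x in lborel. x \<in> \<Omega> \<longrightarrow> \<bar>k0 x\<bar> \<le> M"
      "(\<lambda>x. if x \<in> \<Omega> then k0 x else 0) \<in> Vc \<Omega> \<epsilon> \<sigma>"
    and c: "(\<lambda>z. c (fst z) (snd z)) \<in> borel_measurable (lborel \<Otimes>\<^sub>M lborel)"
      "\<exists>M. AE z in lborel \<Otimes>\<^sub>M lborel. z \<in> \<Omega> \<times> {0..T} \<longrightarrow> \<bar>c (fst z) (snd z)\<bar> \<le> M"
    and sol: "weak_solution \<Omega> \<epsilon> \<sigma> \<mu> \<xi> \<delta> T A0 p \<phi> c k0 k"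
  shows "k \<in> Vinf \<Omega> \<epsilon> \<sigma> T"
proof -
  interpret nonlocal_domain \<Omega> \<epsilon> \<sigma>
    by standard (use dom par in auto)
  have CV: "CVc \<Omega> \<epsilon> \<sigma> T k" and jm: "jointly_measurable k"
    and init: "AE x in lborel. x \<in> \<Omega> \<longrightarrow> k 0 x = k0 x"
    using sol by (auto simp: weak_solution_def)
  obtain kt where wd: "weak_deriv_Vc' \<Omega> \<epsilon> \<sigma> T k kt"
    and eq: "\<And>w. CVc \<Omega> \<epsilon> \<sigma> T w \<Longrightarrow> jointly_measurable w \<Longrightarrow>
      (\<integral>t. indicator {0..T} t * kt t (w t) \<partial>lborel)
      + (\<integral>t. indicator {0..T} t * abil \<Omega> \<epsilon> \<sigma> \<delta> (k t) (w t) \<partial>lborel)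
      = (\<integral>t. indicator {0..T} t *
          (\<integral>x. indicator \<Omega> x * ((Pop \<Omega> \<epsilon> \<sigma> \<mu> \<xi> A0 p \<phi> k x t - c x t) * w t x) \<partial>lborel) \<partial>lborel)"
    using sol unfolding weak_solution_def by blast
  note jointly_measurableD[OF jm, measurable] NL_measurable[OF jm, measurable]
  have km: "k t \<in> borel_measurable borel" for t by measurable
  obtain C where C: "0 \<le> C" and kC: "\<forall>t\<in>{0..T}. integrable lborel (\<lambda>x. indicator W x * k t x)
      \<and> (\<integral>x. indicator W x * \<bar>k t x\<bar> \<partial>lborel) \<le> C
      \<and> (\<integral>\<^sup>+x. indicator \<Omega> x * ennreal \<bar>k t x\<bar> \<partial>lborel) \<le> ennreal C"
    by (rule CVc_L1_bounded[OF km CV less_imp_le[OF par(1)]])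
  have ki: "integrable lborel (\<lambda>x. indicator W x * k t x)"
    and C1: "(\<integral>x. indicator W x * \<bar>k t x\<bar> \<partial>lborel) \<le> C"
    and C2: "(\<integral>\<^sup>+x. indicator \<Omega> x * ennreal \<bar>k t x\<bar> \<partial>lborel) \<le> ennreal C" if "t \<in> {0..T}" for t
    using kC that by blast+
  obtain Lp where Lp: "Lp-lipschitz_on UNIV p" using p(4) by blast
  obtain L where L: "L-lipschitz_on UNIV \<phi>" using phi(2) by blast
  have [measurable]: "p \<in> borel_measurable borel" "\<phi> \<in> borel_measurable borel"
    using lipschitz_on_continuous_on[OF Lp] lipschitz_on_continuous_on[OF L]
    by (auto intro: borel_measurable_continuous_onI)
  have [measurable]: "A0 \<in> borel_measurable borel" using A0(2) by simp
  note c(1)[measurable] Phi_measurable[OF jm, measurable]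
  obtain MA where MA: "AE x in lborel. x \<in> \<Omega> \<longrightarrow> \<bar>A0 x\<bar> \<le> MA" using A0(3) by blast
  obtain Mc where Mc: "AE z in lborel \<Otimes>\<^sub>M lborel. z \<in> \<Omega> \<times> {0..T} \<longrightarrow> \<bar>c (fst z) (snd z)\<bar> \<le> Mc" using c(2) by blast
  obtain Mk where Mk: "AE x in lborel. x \<in> \<Omega> \<longrightarrow> \<bar>k0 x\<bar> \<le> Mk" using k0(2) by blast
  define F where "F x t = Pop \<Omega> \<epsilon> \<sigma> \<mu> \<xi> A0 p \<phi> k x t - c x t" for x t
  define N where "N x t = NL (k t) x + \<delta> * k t x" for x t
  let ?m = "\<bar>MA * exp T * Mp + Mc\<bar>"
  have Fm[measurable]: "(\<lambda>z. F (fst z) (snd z)) \<in> borel_measurable (lborel \<Otimes>\<^sub>M lborel)"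
    unfolding F_def Pop_def by measurable
  have Nm[measurable]: "(\<lambda>z. N (fst z) (snd z)) \<in> borel_measurable (lborel \<Otimes>\<^sub>M lborel)"
    unfolding N_def by measurable
  have MA': "AE z in lborel \<Otimes>\<^sub>M lborel. fst z \<in> \<Omega> \<longrightarrow> \<bar>A0 (fst z)\<bar> \<le> MA"
  proof (rule lborel_pair.AE_pair_measure)
    show "{z \<in> space (lborel \<Otimes>\<^sub>M lborel). fst z \<in> \<Omega> \<longrightarrow> \<bar>A0 (fst z)\<bar> \<le> MA} \<in> sets (lborel \<Otimes>\<^sub>M lborel)"
      by measurable
    show "AE x in lborel. AE t in lborel. fst (x, t) \<in> \<Omega> \<longrightarrow> \<bar>A0 (fst (x, t))\<bar> \<le> MA"
      using MA by eventually_elim simp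
  qed
  have Fb: "AE z in lborel \<Otimes>\<^sub>M lborel. z \<in> \<Omega> \<times> {0..T} \<longrightarrow> \<bar>F (fst z) (snd z)\<bar> \<le> ?m"
    using MA' Mc
  proof eventually_elim
    case (elim z)
    show ?case
    proof
      assume z: "z \<in> \<Omega> \<times> {0..T}"
      then have t: "snd z \<in> {0..T}" and x: "fst z \<in> \<Omega>" by auto
      have "\<bar>Pop \<Omega> \<epsilon> \<sigma> \<mu> \<xi> A0 p \<phi> k (fst z) (snd z)\<bar> \<le> MA * exp T * Mp"
        using phi(1) p(2) par elim(1) x t
        by (intro Pop_bound[where t="snd z" and k=k and \<phi>=\<phi> and p=p, OF km ki[OF t] _ L]) auto
      moreover have "\<bar>c (fst z) (snd z)\<bar> \<le> Mc" using elim(2) z by blast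
      ultimately show "\<bar>F (fst z) (snd z)\<bar> \<le> ?m" unfolding F_def by linarith
    qed
  qed
  have slab: "integrable (lborel \<Otimes>\<^sub>M lborel) (\<lambda>z. indicator \<Omega> (fst z) * indicator {0..T} (snd z) * k (snd z) (fst z))"
    by (rule integrable_slab_solution[OF jm C2])
  have iF: "integrable (lborel \<Otimes>\<^sub>M lborel) (\<lambda>z. indicator \<Omega> (fst z) * indicator {0..T} (snd z) * F (fst z) (snd z))"
    by (rule integrable_slab_bounded[OF Fm Fb])
  note slabN = integrable_slab_NL[OF jm ki C1 slab less_imp_le[OF par(7)]]
  have iN: "integrable (lborel \<Otimes>\<^sub>M lborel) (\<lambda>z. indicator \<Omega> (fst z) * indicator {0..T} (snd z) * N (fst z) (snd z))"
    using slabN(1) by (simp add: N_def)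
  have k0b: "AE x in lborel. x \<in> \<Omega> \<longrightarrow> \<bar>k 0 x\<bar> \<le> \<bar>Mk\<bar>"
    using init Mk by eventually_elim auto
  have "AE z in lborel \<Otimes>\<^sub>M lborel. z \<in> \<Omega> \<times> {0<..<T} \<longrightarrow> \<bar>k (snd z) (fst z)\<bar>
      \<le> (\<bar>Mk\<bar> + (J0 * C) * T + ?m * T) * exp ((J0 * measure lborel W + \<delta>) * T)"
  proof (rule bounded_of_integrated_equation[OF par(1) jm ki slab Nm Fm iN iF _ _ _ Fb _ k0b])
    show "\<bar>N x t\<bar> \<le> (J0 * measure lborel W + \<delta>) * \<bar>k t x\<bar> + J0 * C" if "t \<in> {0..T}" for t x
      unfolding N_def by (rule slabN(2)) (use that in auto)
    show "0 \<le> J0 * measure lborel W + \<delta>" "0 \<le> J0 * C"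
      using J0_pos C par by auto
    fix E r assume E: "E \<in> sets borel" "E \<subseteq> \<Omega>" and r: "0 < r" "r < T"
    show "(\<integral>x. indicator E x * k r x \<partial>lborel) - (\<integral>x. indicator E x * k 0 x \<partial>lborel)
      = (\<integral>x. indicator E x * (\<integral>t. indicator {0..r} t * F x t \<partial>lborel) \<partial>lborel)
        - (\<integral>x. indicator E x * (\<integral>t. indicator {0..r} t * N x t \<partial>lborel) \<partial>lborel)"
      unfolding N_def
      by (rule weak_solution_integrated[OF par(1) jm CV wd eq[folded F_def] ki iN[unfolded N_def] iF E r])
  qed auto
  then show ?thesis
    using CV unfolding Vinf_def by blast
qed

end
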